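(* Let $d\ge 3$, $k\ge 1$, $c>0$ known, and let $(X,U,Y)\in\mathbb{R}^d\times\mathbb{R}^k\times\mathbb{R}^d$ have density $$\eta^{d+k/2}\,f\!\left(\eta\left(\|x-\theta\|^2+\|u\|^2+\|y-c\theta\|^2\right)\right)$$ with unknown $\theta\in\mathbb{R}^d$, $\eta>0$, where $f$ is a scale mixture of normals for which the Kullback-Leibler risks of the two predictive densities below are finite. Consider predictive densities, based on $(X,U)$, for the conditional density of $Y$ given $(X,U)$. Then the Bayes predictive density $\hat q_{\pi_h}$ with respect to the harmonic prior density $\pi_h(\theta,\eta)=\eta^{-1}\|\theta\|^{2-d}$ dominates, under Kullback-Leibler loss, the minimum risk equivariant predictive density $\hat q_{\pi_0}$, i.e. the Bayes predictive density with respect to $\pi_0(\theta,\eta)=\eta^{-1}$. Furthermore, the dominance holds simultaneously for all such scale mixtures of normals $f$.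
   Context: A scale mixture of normals is $f(t)=\int_{(0,\infty)}z^{-(2d+k)/2}\,\phi(t/z)\,dG(z)$, where $\phi(t)=(2\pi)^{-(2d+k)/2}e^{-t/2}$ and $G$ is a cumulative distribution function on $(0,\infty)$. Let $q_{\theta,\eta}(\cdot|x,u)$ be the conditional density of $Y$ given $(X,U)=(x,u)$. The Bayes predictive density for a prior density $\pi(\theta,\eta)$ (with respect to Lebesgue measure on $\mathbb{R}^d\times(0,\infty)$) is $\hat q_\pi(y;x,u)=\int q_{\theta,\eta}(y|x,u)\,\pi(\theta,\eta|x,u)\,d\theta\,d\eta$, with $\pi(\theta,\eta|x,u)$ the posterior density given $(X,U)=(x,u)$. The predictive density $\hat q_{\pi_0}(\cdot;x,u)$ is the multivariate Student density proportional in $y$ to $\left(1+\frac{\|y-cx\|^2}{(1+c^2)\|u\|^2}\right)^{-(d+k)/2}$. The Kullback-Leibler risk of a predictive density $\hat q(\cdot;x,u)$ is $R_{KL}((\theta,\eta),\hat q)=\mathbb{E}^{X,U,Y}_{\theta,\eta}\log\frac{q_{\theta,\eta}(Y|X,U)}{\hat q(Y;X,U)}$. $\hat q_1$ dominates $\hat q_0$ if $R_{KL}((\theta,\eta),\hat q_1)\le R_{KL}((\theta,\eta),\hat q_0)$ for all $(\theta,\eta)$, with strict inequality for at least one $(\theta,\eta)$. *)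

theory Defs
  imports "HOL-Probability.Probability"
begin

text \<open>
  Densities take values in \<^typ>\<open>ennreal\<close>: a scale mixture of normals may be infinite at \<open>0\<close>.
  Here \<open>n\<close> is the dimension of the whole observation, i.e. \<open>2d + k\<close>.
\<close>

definition std_normal_generator :: "nat \<Rightarrow> real \<Rightarrow> real" where
  "std_normal_generator n t = (2 * pi) powr (- real n / 2) * exp (- t / 2)"

text \<open>
  The mixing distribution on \<open>(0, \<infinity>)\<close> is a probability measure \<open>G\<close> on the reals; integration
  with respect to \<open>G\<close> is Stieltjes integration with respect to its distribution function
  \<^term>\<open>cdf G\<close>. A radial density \<open>f\<close> is only relevant on \<open>[0, \<infinity>)\<close>.
\<close>

definition scale_mixture_of_normals :: "nat \<Rightarrow> (real \<Rightarrow> ennreal) \<Rightarrow> bool" where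
  "scale_mixture_of_normals n f \<longleftrightarrow>
     (\<exists>G. real_distribution G \<and> cdf G 0 = 0 \<and>
        (\<forall>t\<ge>0. f t = (\<integral>\<^sup>+z\<in>{0<..}.
            ennreal (z powr (- real n / 2) * std_normal_generator n (t / z)) \<partial>G)))"

definition joint_density ::
    "real \<Rightarrow> (real \<Rightarrow> ennreal) \<Rightarrow> real^'d \<Rightarrow> real \<Rightarrow> real^'d \<Rightarrow> real^'k \<Rightarrow> real^'d \<Rightarrow> ennreal" where
  "joint_density c f \<theta> \<eta> x u y =
     ennreal (\<eta> powr (real CARD('d) + real CARD('k) / 2)) *
     f (\<eta> * ((norm (x - \<theta>))\<^sup>2 + (norm u)\<^sup>2 + (norm (y - c *\<^sub>R \<theta>))\<^sup>2))"

definition marginal_density ::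
    "real \<Rightarrow> (real \<Rightarrow> ennreal) \<Rightarrow> real^'d \<Rightarrow> real \<Rightarrow> real^'d \<Rightarrow> real^'k \<Rightarrow> ennreal" where
  "marginal_density c f \<theta> \<eta> x u = (\<integral>\<^sup>+y. joint_density c f \<theta> \<eta> x u y \<partial>lborel)"

definition conditional_density ::
    "real \<Rightarrow> (real \<Rightarrow> ennreal) \<Rightarrow> real^'d \<Rightarrow> real \<Rightarrow> real^'d \<Rightarrow> real^'k \<Rightarrow> real^'d \<Rightarrow> ennreal" where
  "conditional_density c f \<theta> \<eta> x u y =
     joint_density c f \<theta> \<eta> x u y / marginal_density c f \<theta> \<eta> x u"

definition posterior_density ::
    "real \<Rightarrow> (real \<Rightarrow> ennreal) \<Rightarrow> (real^'d \<Rightarrow> real \<Rightarrow> real) \<Rightarrow>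
     real^'d \<Rightarrow> real^'k \<Rightarrow> real^'d \<Rightarrow> real \<Rightarrow> ennreal" where
  "posterior_density c f \<pi> x u \<theta> \<eta> =
     marginal_density c f \<theta> \<eta> x u * ennreal (\<pi> \<theta> \<eta>) /
     set_nn_integral lborel (UNIV \<times> {0<..})
       (\<lambda>(\<theta>', \<eta>'). marginal_density c f \<theta>' \<eta>' x u * ennreal (\<pi> \<theta>' \<eta>'))"

definition bayes_predictive_density ::
    "real \<Rightarrow> (real \<Rightarrow> ennreal) \<Rightarrow> (real^'d \<Rightarrow> real \<Rightarrow> real) \<Rightarrow>
     real^'d \<Rightarrow> real^'k \<Rightarrow> real^'d \<Rightarrow> ennreal" where
  "bayes_predictive_density c f \<pi> x u y =
     set_nn_integral lborel (UNIV \<times> {0<..})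
       (\<lambda>(\<theta>, \<eta>). conditional_density c f \<theta> \<eta> x u y * posterior_density c f \<pi> x u \<theta> \<eta>)"

definition prior_0 :: "real^'d \<Rightarrow> real \<Rightarrow> real" where
  "prior_0 \<theta> \<eta> = 1 / \<eta>"

definition harmonic_prior :: "real^'d \<Rightarrow> real \<Rightarrow> real" where
  "harmonic_prior \<theta> \<eta> = 1 / \<eta> * norm \<theta> powr (2 - real CARD('d))"

definition sampling_distribution ::
    "real \<Rightarrow> (real \<Rightarrow> ennreal) \<Rightarrow> real^'d \<Rightarrow> real \<Rightarrow> ((real^'d) \<times> (real^'k) \<times> (real^'d)) measure" where
  "sampling_distribution c f \<theta> \<eta> =
     density lborel (\<lambda>(x, u, y). joint_density c f \<theta> \<eta> x u y)"

definition KL_loss ::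
    "real \<Rightarrow> (real \<Rightarrow> ennreal) \<Rightarrow> real^'d \<Rightarrow> real \<Rightarrow> (real^'d \<Rightarrow> real^'k \<Rightarrow> real^'d \<Rightarrow> ennreal) \<Rightarrow>
     (real^'d) \<times> (real^'k) \<times> (real^'d) \<Rightarrow> real" where
  "KL_loss c f \<theta> \<eta> q =
     (\<lambda>(x, u, y). ln (enn2real (conditional_density c f \<theta> \<eta> x u y) / enn2real (q x u y)))"

definition KL_risk ::
    "real \<Rightarrow> (real \<Rightarrow> ennreal) \<Rightarrow> real^'d \<Rightarrow> real \<Rightarrow>
     (real^'d \<Rightarrow> real^'k \<Rightarrow> real^'d \<Rightarrow> ennreal) \<Rightarrow> real" where
  "KL_risk c f \<theta> \<eta> q = (\<integral>p. KL_loss c f \<theta> \<eta> q p \<partial>sampling_distribution c f \<theta> \<eta>)"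

text \<open>
  For a predictive density \<open>q\<close> the negative part of the log-ratio always has expectation at most
  \<open>1\<close>, so the risk is finite exactly if the log-ratio is integrable. Only under this
  condition is the real number \<^const>\<open>KL_risk\<close> meaningful.
\<close>

definition finite_KL_risk ::
    "real \<Rightarrow> (real \<Rightarrow> ennreal) \<Rightarrow> (real^'d \<Rightarrow> real^'k \<Rightarrow> real^'d \<Rightarrow> ennreal) \<Rightarrow> bool" where
  "finite_KL_risk c f q \<longleftrightarrow>
     (\<forall>\<theta>. \<forall>\<eta>>0. integrable (sampling_distribution c f \<theta> \<eta>) (KL_loss c f \<theta> \<eta> q))"

definition dominates ::
    "real \<Rightarrow> (real \<Rightarrow> ennreal) \<Rightarrow> (real^'d \<Rightarrow> real^'k \<Rightarrow> real^'d \<Rightarrow> ennreal) \<Rightarrow>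
     (real^'d \<Rightarrow> real^'k \<Rightarrow> real^'d \<Rightarrow> ennreal) \<Rightarrow> bool" where
  "dominates c f q1 q0 \<longleftrightarrow>
     (\<forall>\<theta>. \<forall>\<eta>>0. KL_risk c f \<theta> \<eta> q1 \<le> KL_risk c f \<theta> \<eta> q0) \<and>
     (\<exists>\<theta>. \<exists>\<eta>>0. KL_risk c f \<theta> \<eta> q1 < KL_risk c f \<theta> \<eta> q0)"

end

theory Submission
  imports Defs
begin

text \<open>
  Given the mixing variable, the model is normal with unknown precision, and the Haar prior
  \<open>d\<eta>/\<eta>\<close> absorbs the mixing variable.  Hence the Bayes predictive densities do not depend on
  \<open>f\<close>, and it suffices to treat a normal model of precision \<open>p\<close>.  There, the ratio of the marginal
  densities under the two priors of an observation with location part \<open>x\<close> and an \<open>m\<close>-dimensional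
  residual \<open>v\<close> is, up to a constant,
  \<open>\<psi>\<^sub>m(x, v) = \<parallel>x\<parallel>^(2 - d) I(\<parallel>x\<parallel>\<^sup>2 / (\<parallel>x\<parallel>\<^sup>2 + \<parallel>v\<parallel>\<^sup>2))\<close>, where \<open>I\<close> is the distribution function of
  the beta law with parameters \<open>d/2 - 1\<close> and \<open>m/2\<close>.  Rotating \<open>(x, y)\<close> turns the full observation
  into one of the same kind with \<open>m = k + d\<close> and precision \<open>(1 + c\<^sup>2) p\<close>, so the risk difference is
  \<open>L(k + d, (1 + c\<^sup>2) p) - L(k, p)\<close> with \<open>L(m, p) = E\<^sub>p ln \<psi>\<^sub>m\<close>.

  It is positive because \<open>L(m, p)\<close> strictly increases in \<open>p\<close> (\<open>\<psi>\<^sub>m\<close> is superharmonic in \<open>x\<close> and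
  decreasing in \<open>\<parallel>v\<parallel>\<close>) and increases in \<open>m\<close>.  For the latter, \<open>\<parallel>x\<parallel>\<^sup>2\<close> is a mixture of gamma
  variables, which reduces the claim to a property of beta laws: the mean of \<open>ln F\<close> under the beta
  law with parameters \<open>a + q\<close> and \<open>b\<close>, where \<open>F\<close> is the distribution function of the one with
  parameters \<open>a\<close> and \<open>b\<close>, increases in \<open>b\<close>.  This holds since the quantile functions of beta laws
  with the same \<open>a\<close> and different \<open>b\<close> have a monotone ratio.
\<close>

section \<open>Haar measure and normal densities\<close>

text \<open>The obstacle is the monotonicity in \<open>m\<close>: there is no pointwise comparison.
  Enlarging \<open>m\<close> raises the beta distribution function at a fixed argument, but it also
  enlarges \<parallel>v\<parallel> and so lowers the argument; the two effects compete. On the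
  quantile scale they merge: the mean of -ln F is an integral over levels t of the probability of
  lying below the t-quantile, and at each level only two probabilities have to be compared. The
  shape of \<psi> comes from writing the harmonic prior as the integral of all centred normal
  densities over their variance. Smoothing with precision p cuts off the variances below 1/p, and
  averaging the cut over p compares two independent gamma variables, whence the beta distribution
  function. The risks depend on \<open>f\<close>, but their difference is the mean of a function of
  the data alone. That mean is positive for each value of the mixing variable; finiteness of the
  risks serves to integrate over the mixture by Fubini.\<close>

definition haar :: "real measure" where
  "haar = density lborel (\<lambda>t. ennreal (indicator {0<..} t / t))"

lemma sets_haar [simp, measurable_cong]: "sets haar = sets borel"
  by (simp add: haar_def)

lemma space_haar [simp]: "space haar = UNIV"
  by (simp add: haar_def)

interpretation haar: sigma_finite_measure haar
  unfolding haar_def by (subst sigma_finite_measure.sigma_finite_iff_density_finite[OF sigma_finite_lborel]) auto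

lemma nn_integral_haar:
  assumes [measurable]: "f \<in> borel_measurable borel"
  shows "(\<integral>\<^sup>+t. f t \<partial>haar) = (\<integral>\<^sup>+t. ennreal (indicator {0<..} t / t) * f t \<partial>lborel)"
  by (simp add: haar_def nn_integral_density)

lemma AE_haar_pos: "AE t in haar. t > 0"
  unfolding haar_def by (subst AE_density) (auto simp: indicator_def)

lemma nn_integral_haar_cong:
  "(\<And>t. t > 0 \<Longrightarrow> f t = g t) \<Longrightarrow> (\<integral>\<^sup>+t. f t \<partial>haar) = (\<integral>\<^sup>+t. g t \<partial>haar)"
  by (rule nn_integral_cong_AE) (use AE_haar_pos in eventually_elim, auto)

lemma nn_integral_haar_mono:
  "(\<And>t. t > 0 \<Longrightarrow> f t \<le> g t) \<Longrightarrow> (\<integral>\<^sup>+t. f t \<partial>haar) \<le> (\<integral>\<^sup>+t. g t \<partial>haar)"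
  by (rule nn_integral_mono_AE) (use AE_haar_pos in eventually_elim, auto)

lemma nn_integral_swap:
  assumes "sigma_finite_measure M" "sigma_finite_measure N"
    and "(\<lambda>(x, y). f x y) \<in> borel_measurable (M \<Otimes>\<^sub>M N)"
  shows "(\<integral>\<^sup>+x. \<integral>\<^sup>+y. f x y \<partial>N \<partial>M) = (\<integral>\<^sup>+y. \<integral>\<^sup>+x. f x y \<partial>M \<partial>N)"
proof -
  interpret pair_sigma_finite M N
    using assms(1,2) by (rule pair_sigma_finite.intro)
  show ?thesis using Fubini'[OF assms(3)] by simp
qed

lemmas nn_integral_swap_haar = nn_integral_swap[OF haar.sigma_finite_measure_axioms haar.sigma_finite_measure_axioms]
lemmas nn_integral_swap_lborel_haar = nn_integral_swap[OF sigma_finite_lborel haar.sigma_finite_measure_axioms]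
lemmas nn_integral_swap_lborel = nn_integral_swap[OF sigma_finite_lborel sigma_finite_lborel]

section \<open>Invariance of the Haar measure and gamma integrals\<close>

lemma nn_integral_haar_scale:
  fixes c :: real
  assumes [measurable]: "f \<in> borel_measurable borel" and c: "c > 0"
  shows "(\<integral>\<^sup>+t. f (c * t) \<partial>haar) = (\<integral>\<^sup>+t. f t \<partial>haar)"
proof -
  have "(\<integral>\<^sup>+t. f t \<partial>haar) = ennreal c * (\<integral>\<^sup>+t. ennreal (indicator {0<..} (c * t) / (c * t)) * f (c * t) \<partial>lborel)"
    using c nn_integral_real_affine[of "\<lambda>t. ennreal (indicator {0<..} t / t) * f t" c 0]
    by (simp add: nn_integral_haar)
  also have "\<dots> = (\<integral>\<^sup>+t. ennreal c * (ennreal (indicator {0<..} (c * t) / (c * t)) * f (c * t)) \<partial>lborel)"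
    by (simp add: nn_integral_cmult)
  also have "\<dots> = (\<integral>\<^sup>+t. ennreal (indicator {0<..} t / t) * f (c * t) \<partial>lborel)"
    using c by (intro nn_integral_cong)
      (auto simp: indicator_def mult.assoc[symmetric] ennreal_mult[symmetric] zero_less_mult_iff)
  also have "\<dots> = (\<integral>\<^sup>+t. f (c * t) \<partial>haar)"
    by (simp add: nn_integral_haar)
  finally show ?thesis by simp
qed

lemma nn_integral_haar_Gamma:
  assumes "p > 0" "c > 0"
  shows "(\<integral>\<^sup>+t. ennreal (t powr p * exp (- (c * t))) \<partial>haar) = ennreal (Gamma p / c powr p)"
proof -
  have *: "(\<integral>\<^sup>+t. ennreal (t powr p * exp (- t)) \<partial>haar) = ennreal (Gamma p)"
  proof -
    have "(\<integral>\<^sup>+t. ennreal (t powr p * exp (- t)) \<partial>haar) =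
       (\<integral>\<^sup>+t. ennreal (indicator {0<..} t / t) * ennreal (t powr p * exp (- t)) \<partial>lborel)"
      by (simp add: nn_integral_haar)
    also have "\<dots> = (\<integral>\<^sup>+t. ennreal (indicator {0..} t * t powr (p - 1) / exp t) \<partial>lborel)"
    proof (intro nn_integral_cong_AE)
      show "AE t in lborel. ennreal (indicator {0<..} t / t) * ennreal (t powr p * exp (- t))
        = ennreal (indicator {0..} t * t powr (p - 1) / exp t)"
        using AE_lborel_singleton[of "0::real"]
        by eventually_elim (auto simp: indicator_def ennreal_mult[symmetric] powr_diff exp_minus field_simps)
    qed
    finally show ?thesis using Gamma_conv_nn_integral_real[OF assms(1)] by simp
  qed
  have "(\<integral>\<^sup>+t. ennreal (t powr p * exp (- (c * t))) \<partial>haar) =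
        (\<integral>\<^sup>+t. ennreal (1 / c powr p) * ennreal ((c * t) powr p * exp (- (c * t))) \<partial>haar)"
    using assms by (intro nn_integral_haar_cong) (auto simp: ennreal_mult[symmetric] powr_mult)
  also have "\<dots> = ennreal (1 / c powr p) * (\<integral>\<^sup>+t. ennreal ((c * t) powr p * exp (- (c * t))) \<partial>haar)"
    by (simp add: nn_integral_cmult)
  also have "(\<integral>\<^sup>+t. ennreal ((c * t) powr p * exp (- (c * t))) \<partial>haar) = ennreal (Gamma p)"
    using nn_integral_haar_scale[of "\<lambda>t. ennreal (t powr p * exp (- t))" c] assms * by simp
  finally show ?thesis using assms by (simp add: ennreal_mult[symmetric])
qed

text \<open>Inserting \<open>1 = \<integral> e(t s) ds/s\<close> reduces inversion invariance to scaling invariance.\<close>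

lemma nn_integral_haar_inverse:
  assumes [measurable]: "f \<in> borel_measurable borel"
  shows "(\<integral>\<^sup>+t. f (inverse t) \<partial>haar) = (\<integral>\<^sup>+t. f t \<partial>haar)"
proof -
  define e where "e s = ennreal (s * exp (- s))" for s :: real
  have [measurable]: "e \<in> borel_measurable borel" unfolding e_def by measurable
  have e1: "(\<integral>\<^sup>+s. e s \<partial>haar) = 1"
  proof -
    have "(\<integral>\<^sup>+s. e s \<partial>haar) = (\<integral>\<^sup>+t. ennreal (t powr 1 * exp (- (1 * t))) \<partial>haar)"
      by (rule nn_integral_haar_cong) (simp add: e_def)
    thus ?thesis using nn_integral_haar_Gamma[of 1 1] by simp
  qed
  have "(\<integral>\<^sup>+t. f (inverse t) \<partial>haar) = (\<integral>\<^sup>+t. \<integral>\<^sup>+s. f (inverse t) * e (t * s) \<partial>haar \<partial>haar)"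
    by (intro nn_integral_haar_cong) (simp add: nn_integral_cmult nn_integral_haar_scale e1)
  also have "\<dots> = (\<integral>\<^sup>+s. \<integral>\<^sup>+t. f (inverse t) * e (t * s) \<partial>haar \<partial>haar)"
    by (rule nn_integral_swap_haar) measurable
  also have "\<dots> = (\<integral>\<^sup>+s. \<integral>\<^sup>+t. f (s * inverse t) * e t \<partial>haar \<partial>haar)"
  proof (rule nn_integral_haar_cong, goal_cases)
    case _: (1 s)
    show ?case
      using \<open>s > 0\<close> nn_integral_haar_scale[of "\<lambda>t. f (inverse t) * e (t * s)" "inverse s"]
      by (simp add: mult_ac)
  qed
  also have "\<dots> = (\<integral>\<^sup>+t. \<integral>\<^sup>+s. f (s * inverse t) * e t \<partial>haar \<partial>haar)"
    by (rule nn_integral_swap_haar) measurable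
  also have "\<dots> = (\<integral>\<^sup>+t. (\<integral>\<^sup>+s. f s \<partial>haar) * e t \<partial>haar)"
  proof (rule nn_integral_haar_cong, goal_cases)
    case _: (1 t)
    thus ?case
      using nn_integral_haar_scale[of f "inverse t"] by (subst nn_integral_multc) (auto simp: mult.commute)
  qed
  also have "\<dots> = (\<integral>\<^sup>+s. f s \<partial>haar)"
    by (simp add: nn_integral_cmult e1)
  finally show ?thesis .
qed

section \<open>Translation, dilation and reflection of Lebesgue measure\<close>

lemma nn_integral_lborel_shift:
  fixes f :: "'a::euclidean_space \<Rightarrow> ennreal"
  assumes [measurable]: "f \<in> borel_measurable borel"
  shows "(\<integral>\<^sup>+x. f (x + a) \<partial>lborel) = (\<integral>\<^sup>+x. f x \<partial>lborel)"
proof -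
  have "(\<integral>\<^sup>+x. f x \<partial>lborel) = (\<integral>\<^sup>+x. f x \<partial>distr lborel borel ((+) a))"
    by (simp add: lborel_distr_plus)
  also have "\<dots> = (\<integral>\<^sup>+x. f (a + x) \<partial>lborel)"
    by (subst nn_integral_distr) auto
  finally show ?thesis by (simp add: add.commute)
qed

lemma nn_integral_lborel_scale:
  fixes f :: "'a::euclidean_space \<Rightarrow> ennreal"
  assumes [measurable]: "f \<in> borel_measurable borel" and c: "c > 0"
  shows "(\<integral>\<^sup>+x. f x \<partial>lborel) = ennreal (c ^ DIM('a)) * (\<integral>\<^sup>+x. f (c *\<^sub>R x) \<partial>lborel)"
proof -
  have "(\<integral>\<^sup>+x. f x \<partial>lborel)
    = (\<integral>\<^sup>+x. f x \<partial>density (distr lborel borel (\<lambda>x. 0 + c *\<^sub>R x)) (\<lambda>_. ennreal (\<bar>c\<bar> ^ DIM('a))))"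
    using c by (subst lborel_affine[of c 0]) auto
  also have "\<dots> = ennreal (c ^ DIM('a)) * (\<integral>\<^sup>+x. f (c *\<^sub>R x) \<partial>lborel)"
    using c by (simp add: nn_integral_density nn_integral_distr nn_integral_cmult)
  finally show ?thesis .
qed

lemma nn_integral_lborel_reflect:
  fixes f :: "'a::euclidean_space \<Rightarrow> ennreal"
  assumes [measurable]: "f \<in> borel_measurable borel"
  shows "(\<integral>\<^sup>+x. f (- x) \<partial>lborel) = (\<integral>\<^sup>+x. f x \<partial>lborel)"
proof -
  have "(\<integral>\<^sup>+x. f x \<partial>lborel)
    = (\<integral>\<^sup>+x. f x \<partial>density (distr lborel borel (\<lambda>x. 0 + (-1) *\<^sub>R x)) (\<lambda>_. ennreal (\<bar>-1\<bar> ^ DIM('a))))"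
    by (subst lborel_affine[of "-1" 0]) auto
  also have "\<dots> = (\<integral>\<^sup>+x. f (- x) \<partial>lborel)"
    by (simp add: nn_integral_density nn_integral_distr)
  finally show ?thesis by simp
qed

section \<open>Centred isotropic normal densities, parametrised by precision\<close>

definition normal_dens :: "real \<Rightarrow> 'a::euclidean_space \<Rightarrow> real" where
  "normal_dens p x = (p / (2 * pi)) powr (real DIM('a) / 2) * exp (- (p * (norm x)\<^sup>2 / 2))"

lemma normal_dens_measurable [measurable]:
  assumes "f \<in> borel_measurable M" "g \<in> borel_measurable M"
  shows "(\<lambda>x. normal_dens (f x) (g x)) \<in> borel_measurable M"
  using assms unfolding normal_dens_def by measurable

lemma normal_dens_nonneg [simp]: "normal_dens p x \<ge> 0"
  by (simp add: normal_dens_def)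

lemma normal_dens_pos: "p > 0 \<Longrightarrow> normal_dens p x > 0"
  by (simp add: normal_dens_def)

lemma normal_dens_minus_commute: "normal_dens p (x - y) = normal_dens p (y - x)"
  by (simp add: normal_dens_def norm_minus_commute)

lemma normal_dens_scale:
  fixes x :: "'a::euclidean_space"
  assumes "c > 0" "p > 0"
  shows "normal_dens p (c *\<^sub>R x) * c ^ DIM('a) = normal_dens (c\<^sup>2 * p) x"
proof -
  have "(c\<^sup>2 * p / (2 * pi)) powr (real DIM('a) / 2) = (c\<^sup>2) powr (real DIM('a) / 2) * (p / (2 * pi)) powr (real DIM('a) / 2)"
    using assms by (subst powr_mult[symmetric]) auto
  also have "(c\<^sup>2) powr (real DIM('a) / 2) = c ^ DIM('a)"
    using assms by (simp add: powr_realpow[symmetric] powr_powr flip: powr_numeral)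
  finally show ?thesis
    by (simp add: normal_dens_def power_mult_distrib mult_ac)
qed

lemma normal_dens_Pair:
  fixes x :: "'a::euclidean_space" and y :: "'b::euclidean_space"
  assumes "p > 0"
  shows "normal_dens p (x, y) = normal_dens p x * normal_dens p y"
proof -
  have "exp (- (p * (norm (x, y))\<^sup>2 / 2)) = exp (- (p * (norm x)\<^sup>2 / 2)) * exp (- (p * (norm y)\<^sup>2 / 2))"
    by (simp add: norm_Pair exp_add[symmetric] field_simps)
  moreover have "(p / (2 * pi)) powr (real DIM('a \<times> 'b) / 2) =
    (p / (2 * pi)) powr (real DIM('a) / 2) * (p / (2 * pi)) powr (real DIM('b) / 2)"
    by (simp add: add_divide_distrib powr_add)
  ultimately show ?thesis
    by (simp only: normal_dens_def mult_ac)
qed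

lemma nn_integral_normal_dens:
  assumes "p > 0"
  shows "(\<integral>\<^sup>+x. ennreal (normal_dens p (x::'a::euclidean_space)) \<partial>lborel) = 1"
proof -
  define s where "s = 1 / sqrt p"
  have s: "s > 0" "s\<^sup>2 = 1 / p" using assms by (auto simp: s_def power_divide)
  have 1: "sqrt (p / (2 * pi)) * exp (- (p * t\<^sup>2 / 2)) = normal_density 0 s t" for t
  proof -
    have "p = 1 / s\<^sup>2" using s assms by simp
    thus ?thesis by (simp add: normal_density_def real_sqrt_divide mult.commute)
  qed
  have "normal_dens p x = (\<Prod>b\<in>Basis. normal_density 0 s (x \<bullet> b))" for x :: 'a
  proof -
    have "(\<Prod>b\<in>Basis. normal_density 0 s (x \<bullet> b)) =
      (\<Prod>b\<in>(Basis::'a set). sqrt (p / (2 * pi))) * (\<Prod>b\<in>Basis. exp (- (p * (x \<bullet> b)\<^sup>2 / 2)))"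
      unfolding 1[symmetric] by (simp add: prod.distrib)
    also have "(\<Prod>b\<in>Basis. exp (- (p * (x \<bullet> b)\<^sup>2 / 2))) = exp (- (p * (norm x)\<^sup>2 / 2))"
      by (simp add: exp_sum[symmetric] sum_negf sum_divide_distrib[symmetric] sum_distrib_left[symmetric]
          power2_norm_eq_inner power2_eq_square[of "_ \<bullet> _"] euclidean_inner[of x x, symmetric])
    also have "(\<Prod>b\<in>(Basis::'a set). sqrt (p / (2 * pi))) = (p / (2 * pi)) powr (real DIM('a) / 2)"
      using assms by (simp add: powr_half_sqrt[symmetric] powr_powr powr_realpow[symmetric])
    finally show ?thesis by (simp add: normal_dens_def)
  qed
  hence "(\<integral>\<^sup>+x. ennreal (normal_dens p (x::'a)) \<partial>lborel)
      = (\<integral>\<^sup>+x. (\<Prod>b\<in>Basis. ennreal (normal_density 0 s ((x::'a) \<bullet> b))) \<partial>lborel)"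
    by (simp add: prod_ennreal)
  also have "\<dots> = (\<Prod>b\<in>(Basis::'a set). \<integral>\<^sup>+x. ennreal (normal_density 0 s x) \<partial>lborel)"
    by (subst nn_integral_lborel_prod) auto
  also have "\<dots> = 1"
    using s by (simp add: nn_integral_eq_integral)
  finally show ?thesis .
qed

text \<open>Completing the square in \<open>z\<close>. The first factor is free of \<open>z\<close>
  and the second has mass one in \<open>z\<close>, so integration yields a normal convolution in
  which variances add: the resulting precision is \<open>p * q / (p + q)\<close>.\<close>

lemma normal_dens_mult:
  fixes x y z :: "'a::euclidean_space"
  assumes "p > 0" "q > 0"
  shows "normal_dens p (z - x) * normal_dens q (z - y) = normal_dens (p * q / (p + q)) (y - x) * normal_dens (p + q) (z - (1 / (p + q)) *\<^sub>R (p *\<^sub>R x + q *\<^sub>R y))"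
proof -
  have "p * (norm (z - x))\<^sup>2 + q * (norm (z - y))\<^sup>2 =
    p * q / (p + q) * (norm (y - x))\<^sup>2 + (p + q) * (norm (z - (1 / (p + q)) *\<^sub>R (p *\<^sub>R x + q *\<^sub>R y)))\<^sup>2"
  proof -
    \<comment> \<open>Naming the six inner products reduces the vector identity to a rational
      identity in scalars.\<close>
    define X Y Z U V W where "X = x \<bullet> x" "Y = y \<bullet> y" "Z = z \<bullet> z" "U = z \<bullet> x" "V = z \<bullet> y" "W = y \<bullet> x"
    have 1: "(norm (z - x))\<^sup>2 = Z - 2 * U + X" "(norm (z - y))\<^sup>2 = Z - 2 * V + Y" "(norm (y - x))\<^sup>2 = Y - 2 * W + X"
      by (simp_all add: power2_norm_eq_inner inner_diff_left inner_diff_right inner_commute X_Y_Z_U_V_W_def)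
    have 2: "(norm (z - (1 / (p + q)) *\<^sub>R (p *\<^sub>R x + q *\<^sub>R y)))\<^sup>2 =
      Z - 2 * ((p * U + q * V) / (p + q)) + (p * p * X + 2 * p * q * W + q * q * Y) / ((p + q) * (p + q))"
      by (simp add: power2_norm_eq_inner inner_diff_left inner_diff_right inner_add_left inner_add_right
         inner_commute X_Y_Z_U_V_W_def) (simp add: add_divide_distrib diff_divide_distrib ring_distribs mult_ac)
    have "p + q > 0" using assms by simp
    thus ?thesis unfolding 1 2 by (simp add: divide_simps) (simp add: algebra_simps)
  qed
  moreover have "(p / (2 * pi)) powr (real DIM('a) / 2) * (q / (2 * pi)) powr (real DIM('a) / 2) =
    (p * q / (p + q) / (2 * pi)) powr (real DIM('a) / 2) * ((p + q) / (2 * pi)) powr (real DIM('a) / 2)"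
  proof -
    have "p / (2 * pi) * (q / (2 * pi)) = p * q / (p + q) / (2 * pi) * ((p + q) / (2 * pi))"
      using assms by simp
    thus ?thesis using assms by (metis powr_mult)
  qed
  moreover have "normal_dens r v * normal_dens s w = (r / (2 * pi)) powr (real DIM('a) / 2) * (s / (2 * pi)) powr (real DIM('a) / 2)
      * exp (- ((r * (norm v)\<^sup>2 + s * (norm w)\<^sup>2) / 2))" for r s and v w :: 'a
    by (simp add: normal_dens_def exp_add[symmetric] add_divide_distrib)
  ultimately show ?thesis by simp
qed

lemma nn_integral_normal_dens_conv:
  fixes x y :: "'a::euclidean_space"
  assumes "p > 0" "q > 0"
  shows "(\<integral>\<^sup>+z. ennreal (normal_dens p (z - x)) * ennreal (normal_dens q (z - y)) \<partial>lborel) = ennreal (normal_dens (p * q / (p + q)) (y - x))"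
proof -
  have "(\<integral>\<^sup>+z. ennreal (normal_dens p (z - x)) * ennreal (normal_dens q (z - y)) \<partial>lborel)
    = (\<integral>\<^sup>+z. ennreal (normal_dens (p * q / (p + q)) (y - x)) * ennreal (normal_dens (p + q) (z + - ((1 / (p + q)) *\<^sub>R (p *\<^sub>R x + q *\<^sub>R y)))) \<partial>lborel)"
    using assms by (intro nn_integral_cong) (simp add: ennreal_mult[symmetric] normal_dens_mult)
  also have "\<dots> = ennreal (normal_dens (p * q / (p + q)) (y - x))"
    using assms by (subst nn_integral_cmult) (auto simp: nn_integral_lborel_shift[of "\<lambda>z. ennreal (normal_dens (p + q) z)"] nn_integral_normal_dens
      simp del: add_uminus_conv_diff)
  finally show ?thesis .
qed

section \<open>Gamma and beta laws\<close>

text \<open>Densities are taken with respect to \<open>haar\<close>, which accounts for the exponent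
  \<open>p\<close> where the Lebesgue density has \<open>p - 1\<close>, and likewise for
  \<open>a\<close> in \<open>beta_dens\<close>. In this form rescaling produces no Jacobian.\<close>

definition gamma_dens :: "real \<Rightarrow> real \<Rightarrow> real" where
  "gamma_dens p t = t powr p * exp (- t) / Gamma p"

definition beta_dens :: "real \<Rightarrow> real \<Rightarrow> real \<Rightarrow> real" where
  "beta_dens a b z = (if 0 < z \<and> z < 1 then Gamma (a + b) / (Gamma a * Gamma b) * z powr a * (1 - z) powr (b - 1) else 0)"

lemma Gamma_real_neq_0: "(x::real) > 0 \<Longrightarrow> Gamma x \<noteq> 0"
  by (metis Gamma_real_pos less_irrefl)

lemma gamma_dens_measurable [measurable]: "gamma_dens p \<in> borel_measurable borel"
  unfolding gamma_dens_def by measurable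

lemma beta_dens_measurable [measurable]: "beta_dens a b \<in> borel_measurable borel"
  unfolding beta_dens_def by measurable

lemma gamma_dens_nonneg [simp]: "p > 0 \<Longrightarrow> gamma_dens p t \<ge> 0"
  by (simp add: gamma_dens_def Gamma_real_nonneg)

lemma beta_dens_nonneg [simp]: "a > 0 \<Longrightarrow> b > 0 \<Longrightarrow> beta_dens a b z \<ge> 0"
  by (simp add: beta_dens_def Gamma_real_nonneg)

lemma nn_integral_gamma_dens: "p > 0 \<Longrightarrow> (\<integral>\<^sup>+t. ennreal (gamma_dens p t) \<partial>haar) = 1"
proof -
  assume p: "p > 0"
  have "(\<integral>\<^sup>+t. ennreal (gamma_dens p t) \<partial>haar) = (\<integral>\<^sup>+t. ennreal (1 / Gamma p) * ennreal (t powr p * exp (- (1 * t))) \<partial>haar)"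
    using p by (intro nn_integral_haar_cong) (simp add: gamma_dens_def ennreal_mult[symmetric])
  also have "\<dots> = 1"
    using p nn_integral_haar_Gamma[of p 1]
    by (subst nn_integral_cmult) (auto simp: ennreal_mult[symmetric] Gamma_real_neq_0)
  finally show ?thesis .
qed

text \<open>The classical substitution \<open>s = v + p\<close>, \<open>z = v / s\<close>: in the
  new variables the joint gamma density is a product of a gamma density in the sum and a beta
  density in the share. The gamma factor then integrates to one.\<close>

lemma nn_integral_gamma_dens_gamma_dens:
  assumes "a > 0" "b > 0" and [measurable]: "g \<in> borel_measurable borel"
  shows "(\<integral>\<^sup>+v. \<integral>\<^sup>+p. ennreal (gamma_dens a v) * ennreal (gamma_dens b p) * g (v / (v + p)) \<partial>haar \<partial>haar)
    = (\<integral>\<^sup>+z. ennreal (beta_dens a b z) * g z \<partial>haar)"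
proof -
  define C where "C = 1 / (Gamma a * Gamma b)"
  have C: "C > 0" using assms by (simp add: C_def Gamma_real_pos)
  \<comment> \<open>The joint density of \<open>v\<close> and \<open>s = v + p\<close>, with respect
    to \<open>haar\<close> in \<open>v\<close> and Lebesgue measure in \<open>s\<close>: the passage
    from \<open>p\<close> to \<open>s\<close> is a translation, under which only the latter is
    invariant.\<close>
  define k where "k v s = (if v < s then C * v powr a * (s - v) powr (b - 1) * exp (- s) else 0)" for v s :: real
  have [measurable]: "case_prod k \<in> borel_measurable (borel \<Otimes>\<^sub>M borel)"
    unfolding k_def by measurable
  have "(\<integral>\<^sup>+v. \<integral>\<^sup>+p. ennreal (gamma_dens a v) * ennreal (gamma_dens b p) * g (v / (v + p)) \<partial>haar \<partial>haar)
    = (\<integral>\<^sup>+v. \<integral>\<^sup>+s. ennreal (k v s) * g (v / s) \<partial>lborel \<partial>haar)"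
  proof (rule nn_integral_haar_cong, goal_cases)
    case v: (1 v)
    have "(\<integral>\<^sup>+p. ennreal (gamma_dens a v) * ennreal (gamma_dens b p) * g (v / (v + p)) \<partial>haar)
      = (\<integral>\<^sup>+p. ennreal (indicator {0<..} p / p) * (ennreal (gamma_dens a v) * ennreal (gamma_dens b p) * g (v / (v + p))) \<partial>lborel)"
      by (rule nn_integral_haar) measurable
    also have "\<dots> = (\<integral>\<^sup>+p. ennreal (k v (p + v)) * g (v / (p + v)) \<partial>lborel)"
    proof (rule nn_integral_cong, goal_cases)
      case _: (1 p)
      show ?case
      proof (cases "p > 0")
        case True
        have "indicator {0<..} p / p * (gamma_dens a v * gamma_dens b p) = k v (p + v)"
          using True v by (simp add: gamma_dens_def k_def C_def powr_diff exp_diff exp_minus) (simp add: field_simps)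
        thus ?thesis using True v assms
          by (simp add: mult.assoc[symmetric] ennreal_mult[symmetric] add.commute)
      qed (auto simp: k_def)
    qed
    also have "\<dots> = (\<integral>\<^sup>+s. ennreal (k v s) * g (v / s) \<partial>lborel)"
      by (rule nn_integral_lborel_shift[of "\<lambda>s. ennreal (k v s) * g (v / s)"]) measurable
    finally show ?case .
  qed
  also have "\<dots> = (\<integral>\<^sup>+s. \<integral>\<^sup>+v. ennreal (k v s) * g (v / s) \<partial>haar \<partial>lborel)"
    by (rule nn_integral_swap_lborel_haar[symmetric]) measurable
  also have "\<dots> = (\<integral>\<^sup>+s. ennreal (indicator {0<..} s / s) *
       (ennreal (s powr (a + b) * exp (- s) / Gamma (a + b)) * (\<integral>\<^sup>+z. ennreal (beta_dens a b z) * g z \<partial>haar)) \<partial>lborel)"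
  proof (rule nn_integral_cong_AE, use AE_lborel_singleton[of "0::real"] in eventually_elim, goal_cases)
    case _: (1 s)
    show ?case
    proof (cases "s > 0")
      case s: True
      have "(\<integral>\<^sup>+v. ennreal (k v s) * g (v / s) \<partial>haar) = (\<integral>\<^sup>+z. ennreal (k (s * z) s) * g z \<partial>haar)"
        using nn_integral_haar_scale[of "\<lambda>v. ennreal (k v s) * g (v / s)" s] s by simp
      also have "\<dots> = (\<integral>\<^sup>+z. ennreal (s powr (a + b) * exp (- s) / Gamma (a + b) / s) * (ennreal (beta_dens a b z) * g z) \<partial>haar)"
      proof (rule nn_integral_haar_cong, goal_cases)
        case z: (1 z)
        have "k (s * z) s = s powr (a + b) * exp (- s) / Gamma (a + b) / s * beta_dens a b z"
        proof (cases "z < 1")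
          case True
          have "s - s * z = s * (1 - z)" by (simp add: algebra_simps)
          thus ?thesis using True s z assms
            by (simp add: k_def beta_dens_def C_def powr_mult powr_add powr_diff Gamma_real_neq_0 divide_simps)
        qed (use s z in \<open>auto simp: k_def beta_dens_def\<close>)
        thus ?case
          using s assms by (simp add: mult.assoc[symmetric] ennreal_mult[symmetric] Gamma_real_nonneg)
      qed
      also have "\<dots> = ennreal (s powr (a + b) * exp (- s) / Gamma (a + b) / s) * (\<integral>\<^sup>+z. ennreal (beta_dens a b z) * g z \<partial>haar)"
        by (rule nn_integral_cmult) measurable
      finally show ?thesis using s assms
        by (simp add: mult.assoc[symmetric] ennreal_mult[symmetric] Gamma_real_nonneg mult.commute[of s])
    next
      case False
      have "(\<integral>\<^sup>+v. ennreal (k v s) * g (v / s) \<partial>haar) = (\<integral>\<^sup>+v. 0 \<partial>haar)"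
        by (rule nn_integral_haar_cong) (use False in \<open>simp add: k_def\<close>)
      thus ?thesis using False by simp
    qed
  qed
  also have "\<dots> = (\<integral>\<^sup>+s. ennreal (gamma_dens (a + b) s) * (\<integral>\<^sup>+z. ennreal (beta_dens a b z) * g z \<partial>haar) \<partial>haar)"
    unfolding gamma_dens_def by (rule nn_integral_haar[symmetric]) measurable
  also have "\<dots> = (\<integral>\<^sup>+z. ennreal (beta_dens a b z) * g z \<partial>haar)"
    using assms by (subst nn_integral_multc) (auto simp: nn_integral_gamma_dens)
  finally show ?thesis .
qed

text \<open>The case \<open>g = 1\<close> of the gamma-ratio identity: the constant in
  \<open>beta_dens\<close> is inherited from the two gamma normalisations.\<close>

lemma nn_integral_beta_dens:
  assumes "a > 0" "b > 0"
  shows "(\<integral>\<^sup>+z. ennreal (beta_dens a b z) \<partial>haar) = 1"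
proof -
  have "(\<integral>\<^sup>+z. ennreal (beta_dens a b z) \<partial>haar) = (\<integral>\<^sup>+v. \<integral>\<^sup>+p. ennreal (gamma_dens a v) * ennreal (gamma_dens b p) * 1 \<partial>haar \<partial>haar)"
    using nn_integral_gamma_dens_gamma_dens[OF assms, of "\<lambda>_. 1"] by simp
  also have "\<dots> = 1"
    using assms by (simp add: nn_integral_cmult nn_integral_gamma_dens)
  finally show ?thesis .
qed

section \<open>Beta laws and their distribution functions\<close>

definition beta_law :: "real \<Rightarrow> real \<Rightarrow> real measure" where
  "beta_law a b = density haar (\<lambda>z. ennreal (beta_dens a b z))"

lemma sets_beta_law [simp, measurable_cong]: "sets (beta_law a b) = sets borel"
  by (simp add: beta_law_def)

lemma space_beta_law [simp]: "space (beta_law a b) = UNIV"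
  by (simp add: beta_law_def)

lemma real_distribution_beta_law:
  assumes "a > 0" "b > 0"
  shows "real_distribution (beta_law a b)"
proof -
  have "prob_space (beta_law a b)"
    using nn_integral_beta_dens[OF assms] by (intro prob_spaceI) (simp add: beta_law_def emeasure_density)
  thus ?thesis
    unfolding real_distribution_def real_distribution_axioms_def by simp
qed

lemma nn_integral_beta_law:
  assumes [measurable]: "g \<in> borel_measurable borel"
  shows "(\<integral>\<^sup>+z. g z \<partial>beta_law a b) = (\<integral>\<^sup>+z. ennreal (beta_dens a b z) * g z \<partial>haar)"
  by (simp add: beta_law_def nn_integral_density)

lemma AE_beta_law: "AE z in beta_law a b. 0 < z \<and> z < 1"
  unfolding beta_law_def by (subst AE_density) (auto simp: beta_dens_def split: if_splits)

lemma haar_integrable_beta_dens: "a > 0 \<Longrightarrow> b > 0 \<Longrightarrow> integrable haar (beta_dens a b)"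
  by (rule integrableI_nonneg) (auto simp: nn_integral_beta_dens)

lemma emeasure_haar_singleton: "emeasure haar {x} = 0"
  unfolding haar_def 
  by (subst emeasure_density) (auto simp: nn_integral_0_iff_AE intro!: eventually_mono[OF AE_lborel_singleton[of x]])

lemma emeasure_beta_law_singleton: "emeasure (beta_law a b) {x} = 0"
  unfolding beta_law_def by (subst emeasure_density) (auto simp: emeasure_haar_singleton)

lemma cdf_beta_law_eq_integral:
  assumes "a > 0" "b > 0"
  shows "cdf (beta_law a b) x = (\<integral>z. indicator {..x} z * beta_dens a b z \<partial>haar)"
proof -
  have "cdf (beta_law a b) x = (\<integral>z. indicator {..x} z \<partial>beta_law a b)"
    by (simp add: cdf_def)
  also have "\<dots> = (\<integral>z. beta_dens a b z *\<^sub>R indicator {..x} z \<partial>haar)"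
    unfolding beta_law_def by (rule integral_density) (use assms in auto)
  finally show ?thesis by (simp add: mult.commute)
qed

lemma isCont_cdf_beta_law:
  assumes "a > 0" "b > 0"
  shows "isCont (cdf (beta_law a b)) x"
proof -
  interpret real_distribution "beta_law a b" by (rule real_distribution_beta_law[OF assms])
  show ?thesis by (simp add: isCont_cdf measure_def emeasure_beta_law_singleton)
qed

lemma cdf_beta_law_strict_mono:
  assumes "a > 0" "b > 0" "0 \<le> x" "x < y" "y \<le> 1"
  shows "cdf (beta_law a b) x < cdf (beta_law a b) y"
proof -
  interpret real_distribution "beta_law a b" by (rule real_distribution_beta_law[OF assms(1,2)])
  have "measure (beta_law a b) {x<..y} \<noteq> 0"
  proof
    assume "measure (beta_law a b) {x<..y} = 0"
    hence "emeasure (beta_law a b) {x<..y} = 0" by (simp add: emeasure_eq_measure)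
    hence "(\<integral>\<^sup>+z. ennreal (beta_dens a b z) * indicator {x<..y} z \<partial>haar) = 0"
      unfolding beta_law_def by (subst (asm) emeasure_density) auto
    hence "AE z in haar. ennreal (beta_dens a b z) * indicator {x<..y} z = 0"
      by (subst (asm) nn_integral_0_iff_AE) auto
    hence "AE z in lborel. 0 < z \<longrightarrow> ennreal (beta_dens a b z) * indicator {x<..y} z = 0"
      unfolding haar_def by (subst (asm) AE_density) (auto simp: indicator_def elim!: eventually_mono split: if_splits)
    hence "AE z in lborel. z \<notin> {x<..<y}"
      by eventually_elim (use assms in \<open>auto simp: beta_dens_def indicator_def Gamma_real_neq_0 split: if_splits\<close>)
    hence "emeasure lborel {z. z \<in> {x<..<y}} = 0"
      by (subst (asm) AE_iff_measurable[OF _ refl]) auto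
    thus False using assms by (simp del: greaterThanLessThan_iff)
  qed
  moreover have "cdf (beta_law a b) y - cdf (beta_law a b) x = measure (beta_law a b) {x<..y}"
    using assms by (intro cdf_diff_eq)
  ultimately show ?thesis
    using measure_nonneg[of "beta_law a b" "{x<..y}"] by linarith
qed

lemma cdf_beta_law_0: "a > 0 \<Longrightarrow> b > 0 \<Longrightarrow> cdf (beta_law a b) 0 = 0"
  by (subst cdf_beta_law_eq_integral) (auto intro!: integral_eq_zero_AE simp: beta_dens_def indicator_def)

lemma cdf_beta_law_1:
  assumes "a > 0" "b > 0" shows "cdf (beta_law a b) 1 = 1"
proof -
  interpret real_distribution "beta_law a b" by (rule real_distribution_beta_law[OF assms])
  have "prob {..1} = 1"
    by (subst prob_eq_1) (auto intro: eventually_mono[OF AE_beta_law])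
  thus ?thesis by (simp add: cdf_def)
qed

lemma cdf_beta_law_pos:
  assumes "a > 0" "b > 0" "0 < x" "x \<le> 1" shows "0 < cdf (beta_law a b) x"
  using cdf_beta_law_strict_mono[OF assms(1,2), of 0 x] cdf_beta_law_0 assms by simp

lemma cdf_beta_law_less_1:
  assumes "a > 0" "b > 0" "0 \<le> x" "x < 1" shows "cdf (beta_law a b) x < 1"
  using cdf_beta_law_strict_mono[OF assms(1,2), of x 1] cdf_beta_law_1 assms by simp

lemma cdf_beta_law_quantile:
  assumes "a > 0" "b > 0" "0 < t" "t < 1"
  obtains x where "0 < x" "x < 1" "cdf (beta_law a b) x = t"
proof -
  have "\<exists>x. 0 \<le> x \<and> x \<le> 1 \<and> cdf (beta_law a b) x = t"
    using assms by (intro IVT') (auto simp: cdf_beta_law_0 cdf_beta_law_1 intro!: continuous_at_imp_continuous_on isCont_cdf_beta_law)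
  then obtain x where x: "0 \<le> x" "x \<le> 1" "cdf (beta_law a b) x = t" by auto
  moreover have "x \<noteq> 0" "x \<noteq> 1" using x assms by (auto simp: cdf_beta_law_0 cdf_beta_law_1)
  ultimately show ?thesis using that[of x] by auto
qed

section \<open>Comparison of beta laws\<close>

lemma distr_haar_scale:
  fixes c :: real
  assumes "c > 0"
  shows "distr haar borel (\<lambda>t. c * t) = haar"
proof (rule measure_eqI)
  fix A assume "A \<in> sets (distr haar borel (\<lambda>t. c * t))"
  hence [measurable]: "A \<in> sets borel" by simp
  have "emeasure (distr haar borel (\<lambda>t. c * t)) A = (\<integral>\<^sup>+t. indicator A (c * t) \<partial>haar)"
    using nn_integral_distr[of "\<lambda>t. c * t" haar borel "indicator A"] by simp
  also have "\<dots> = emeasure haar A"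
    using assms nn_integral_haar_scale[of "indicator A" c] by simp
  finally show "emeasure (distr haar borel (\<lambda>t. c * t)) A = emeasure haar A" .
qed simp

lemma integral_haar_scale:
  fixes c :: real and f :: "real \<Rightarrow> real"
  assumes "c > 0" and [measurable]: "f \<in> borel_measurable borel"
  shows "(\<integral>t. f (c * t) \<partial>haar) = (\<integral>t. f t \<partial>haar)"
  using integral_distr[of "\<lambda>t. c * t" haar borel f] distr_haar_scale[OF assms(1)] by simp

lemma integrable_haar_scale:
  fixes c :: real and f :: "real \<Rightarrow> real"
  assumes "c > 0" "integrable haar f"
  shows "integrable haar (\<lambda>t. f (c * t))"
  using integrable_distr[of "\<lambda>t. c * t" haar borel f] distr_haar_scale[OF assms(1)] assms(2) by simp

lemma not_AE_haar_notin:
  assumes "0 \<le> x" "x < y"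
  shows "\<not> (AE z in haar. z \<notin> {x<..<y})"
proof
  assume "AE z in haar. z \<notin> {x<..<y}"
  hence "AE z in lborel. 0 < z \<longrightarrow> z \<notin> {x<..<y}"
    unfolding haar_def by (subst (asm) AE_density) (auto simp: indicator_def elim!: eventually_mono split: if_splits)
  hence "AE z in lborel. z \<notin> {x<..<y}"
    by eventually_elim (use assms in auto)
  hence "emeasure lborel {z. z \<in> {x<..<y}} = 0"
    by (subst (asm) AE_iff_measurable[OF _ refl]) auto
  thus False using assms by (simp del: greaterThanLessThan_iff)
qed

text \<open>The one-crossing argument: as \<open>f\<close> and \<open>g\<close> have equal mass,
  \<open>K\<close> may be subtracted from \<phi> at no cost, and the integrand then has a constant
  sign when \<open>g - f\<close> changes sign where \<phi> passes \<open>K\<close>.\<close>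

lemma integral_single_crossing:
  fixes f g \<phi> :: "'a \<Rightarrow> real"
  assumes int: "integrable M f" "integrable M g" "integrable M (\<lambda>x. \<phi> x * f x)" "integrable M (\<lambda>x. \<phi> x * g x)"
    and eq: "(\<integral>x. f x \<partial>M) = (\<integral>x. g x \<partial>M)"
    and le: "AE x in M. (\<phi> x - K) * (g x - f x) \<le> 0"
  shows "(\<integral>x. \<phi> x * g x \<partial>M) \<le> (\<integral>x. \<phi> x * f x \<partial>M)"
proof -
  have "(\<integral>x. \<phi> x * g x \<partial>M) - (\<integral>x. \<phi> x * f x \<partial>M) = (\<integral>x. \<phi> x * g x - \<phi> x * f x - K * (g x - f x) \<partial>M)"
    using int eq by simp
  also have "\<dots> \<le> (\<integral>x. 0 \<partial>M)"
    using int le by (intro integral_mono_AE) (auto elim!: eventually_mono simp: algebra_simps)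
  finally show ?thesis by simp
qed

text \<open>Likelihood ratio ordering: the ratio \<open>r\<close> of the two densities decreases on
  the unit interval, so the law with the larger second parameter has its mass further to the
  left.\<close>

lemma cdf_beta_law_mono_param:
  assumes a: "a > 0" and b: "0 < b" "b \<le> b'" and x: "0 < x" "x < 1"
  shows "cdf (beta_law a b) x \<le> cdf (beta_law a b') x"
proof -
  have b': "b' > 0" using b by simp
  define c where "c = (Gamma (a + b') / (Gamma a * Gamma b')) / (Gamma (a + b) / (Gamma a * Gamma b))"
  define r where "r z = c * (1 - z) powr (b' - b)" for z
  have c: "c > 0" using assms by (simp add: c_def Gamma_real_pos Gamma_real_neq_0)
  have ratio: "beta_dens a b' z = beta_dens a b z * r z" if "0 < z" "z < 1" for z
    using that assms b' Gamma_real_neq_0[OF a] Gamma_real_neq_0[OF b(1)] Gamma_real_neq_0[of "a + b"]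
    by (simp add: beta_dens_def r_def c_def powr_diff mult_ac)
  have r_mono: "r z' \<le> r z" if "0 < z" "z \<le> z'" "z' < 1" for z z'
    using that b c by (auto simp: r_def intro!: mult_left_mono powr_mono2)
  \<comment> \<open>For the indicator of a half-line the comparison constant depends on the position
    of \<open>x\<close>: it is 0 if \<open>x\<close> lies on the left of the crossing of
    \<open>r\<close> with 1, and 1 if it lies on the right.\<close>
  have sgn: "(indicator {..x} z - (if r x \<ge> 1 then 0 else 1)) * (beta_dens a b z - beta_dens a b' z) \<le> 0" for z
  proof (cases "0 < z \<and> z < 1")
    case True
    have *: "beta_dens a b z - beta_dens a b' z = beta_dens a b z * (1 - r z)"
      using ratio[of z] True by (simp add: algebra_simps)
    show ?thesis
    proof (cases "r x \<ge> 1")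
      case rx: True
      show ?thesis
      proof (cases "z \<le> x")
        case zx: True
        have "1 - r z \<le> 0" using r_mono[of z x] True x rx zx by simp
        thus ?thesis using * zx rx a b by (simp add: mult_nonneg_nonpos)
      qed (use rx in simp)
    next
      case rx: False
      show ?thesis
      proof (cases "z \<le> x")
        case False
        have "1 - r z \<ge> 0" using r_mono[of x z] True x rx False by simp
        thus ?thesis using * False rx a b by (simp add: mult_nonneg_nonneg)
      qed (use rx in simp)
    qed
  next
    case False
    hence "beta_dens a b z = 0" "beta_dens a b' z = 0" by (auto simp: beta_dens_def)
    thus ?thesis by simp
  qed
  have int: "integrable haar (\<lambda>z. indicator {..x} z * beta_dens a \<beta> z)" if "\<beta> > 0" for \<beta>
    using haar_integrable_beta_dens[OF a that] by (rule Bochner_Integration.integrable_bound) (auto simp: indicator_def)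
  have one: "(\<integral>z. beta_dens a \<beta> z \<partial>haar) = 1" if "\<beta> > 0" for \<beta>
    using nn_integral_beta_dens[OF a that] a that by (simp add: integral_eq_nn_integral)
  show ?thesis
    unfolding cdf_beta_law_eq_integral[OF a b(1)] cdf_beta_law_eq_integral[OF a b']
    by (rule integral_single_crossing[where K = "if r x \<ge> 1 then 0 else 1"])
       (use a b b' int one sgn in \<open>auto intro: haar_integrable_beta_dens\<close>)
qed

text \<open>
  After rescaling the second density so that both quantiles agree, the logarithmic derivative of the
  ratio of the two densities has an increasing affine numerator, so this ratio is quasiconvex. As
  the densities have equal mass on both sides of the quantile, they cross exactly once on each side.
\<close>

lemma cdf_beta_law_matched_quantiles:
  assumes a: "a > 0" and q: "q > 0" and b: "0 < b" "b \<le> b'"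
    and x: "0 < x" "x < 1" and x': "0 < x'" "x' < 1"
    and eq: "cdf (beta_law a b) x = cdf (beta_law a b') x'"
  shows "cdf (beta_law (a + q) b') x' \<le> cdf (beta_law (a + q) b) x"
proof -
  have b': "b' > 0" using b by simp
  \<comment> \<open>This bounds the scale \<open>l\<close> by 1, which keeps
    \<open>1 - l * z\<close> positive on the unit interval.\<close>
  have x'x: "x' \<le> x"
  proof (rule ccontr)
    assume "\<not> x' \<le> x"
    hence "cdf (beta_law a b') x < cdf (beta_law a b') x'"
      using a b' x x' by (intro cdf_beta_law_strict_mono) auto
    thus False using cdf_beta_law_mono_param[OF a b x] eq by simp
  qed
  define l where "l = x' / x"
  have l: "0 < l" "l \<le> 1" "l * x = x'" using x x' x'x by (auto simp: l_def)
  define f1 where "f1 = beta_dens a b"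
  \<comment> \<open>The rescaling moves the quantile \<open>x'\<close> of the second law to
    \<open>x\<close>. By scale invariance of \<open>haar\<close>, \<open>f2\<close> still has mass
    one; its support reaches up to \<open>1 / l\<close>, possibly beyond that of
    \<open>f1\<close>.\<close>
  define f2 where "f2 z = beta_dens a b' (l * z)" for z
  have [measurable]: "f1 \<in> borel_measurable borel" "f2 \<in> borel_measurable borel"
    unfolding f1_def f2_def by measurable
  \<comment> \<open>The logarithm of the quotient of the normalising constants, with
    \<open>l powr a\<close> from the rescaling, so that \<open>f2\<close> is
    \<open>f1 * exp L\<close> on the unit interval.\<close>
  define c0 where "c0 = ln (Gamma (a + b') / (Gamma a * Gamma b') * l powr a / (Gamma (a + b) / (Gamma a * Gamma b)))"
  define L where "L z = (b' - 1) * ln (1 - l * z) - (b - 1) * ln (1 - z) + c0" for z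
  have lz: "l * z < 1" if "0 < z" "z < 1" for z
    using l that by (smt (verit) mult_left_le_one_le)
  have f1_pos: "f1 z > 0" if "0 < z" "z < 1" for z
    using that a b by (simp add: f1_def beta_dens_def Gamma_real_pos)
  have f12: "f2 z = f1 z * exp (L z)" if "0 < z" "z < 1" for z
  proof -
    have "exp (L z) = (1 - l * z) powr (b' - 1) / (1 - z) powr (b - 1) *
       (Gamma (a + b') / (Gamma a * Gamma b') * l powr a / (Gamma (a + b) / (Gamma a * Gamma b)))"
      using that lz[OF that] a b b' l
      by (simp add: L_def c0_def exp_add exp_diff powr_def Gamma_real_pos Gamma_real_neq_0)
    thus ?thesis
      using that lz[OF that] a b b' l Gamma_real_neq_0[OF a] Gamma_real_neq_0[OF b(1)] Gamma_real_neq_0[of "a + b"]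
      by (simp add: f1_def f2_def beta_dens_def powr_mult)
  qed
  have f12_le: "f2 z \<le> f1 z" if "0 < z" "z < 1" "L z \<le> 0" for z
    using f12[OF that(1,2)] f1_pos[OF that(1,2)] that(3) by (simp add: mult_le_cancel_left1)
  have f12_less: "f1 z < f2 z" if "0 < z" "z < 1" "L z > 0" for z
    using f12[OF that(1,2)] f1_pos[OF that(1,2)] that(3) by simp
  define N where "N z = (b - 1) - l * (b' - 1) + l * z * (b' - b)" for z
  have N_mono: "N z \<le> N z'" if "z \<le> z'" for z z'
    using that l b by (auto simp: N_def intro!: mult_right_mono mult_left_mono)
  have deriv: "(L has_real_derivative (N z / ((1 - z) * (1 - l * z)))) (at z)" if "0 < z" "z < 1" for z
    unfolding L_def using that lz[OF that]
    by (auto intro!: derivative_eq_intros simp: N_def divide_simps) (simp add: algebra_simps)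
  have quasi: "L z2 \<le> max (L z1) (L z3)" if z: "0 < z1" "z1 \<le> z2" "z2 \<le> z3" "z3 < 1" for z1 z2 z3
  proof (cases "N z2 \<ge> 0")
    case True
    have "L z2 \<le> L z3"
    proof (rule DERIV_nonneg_imp_nondecreasing[OF z(3)])
      fix y assume y: "z2 \<le> y" "y \<le> z3"
      have "N y / ((1 - y) * (1 - l * y)) \<ge> 0"
        using N_mono[OF y(1)] True y z lz[of y] by auto
      thus "\<exists>d. (L has_real_derivative d) (at y) \<and> 0 \<le> d"
        using deriv[of y] y z by auto
    qed
    thus ?thesis by simp
  next
    case False
    have "L z2 \<le> L z1"
    proof (rule DERIV_nonpos_imp_nonincreasing[OF z(2)])
      fix y assume y: "z1 \<le> y" "y \<le> z2"
      have "N y / ((1 - y) * (1 - l * y)) \<le> 0"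
        using N_mono[OF y(2)] False y z lz[of y] by (intro divide_nonpos_nonneg) auto
      thus "\<exists>d. (L has_real_derivative d) (at y) \<and> d \<le> 0"
        using deriv[of y] y z by auto
    qed
    thus ?thesis by simp
  qed
  have int1: "integrable haar f1" unfolding f1_def using a b by (intro haar_integrable_beta_dens)
  have int2: "integrable haar f2"
    unfolding f2_def using a b' l by (intro integrable_haar_scale haar_integrable_beta_dens)
  have one1: "(\<integral>z. f1 z \<partial>haar) = 1"
    unfolding f1_def using nn_integral_beta_dens[OF a b(1)] a b by (simp add: integral_eq_nn_integral)
  have one2: "(\<integral>z. f2 z \<partial>haar) = 1"
    unfolding f2_def using nn_integral_beta_dens[OF a b'] a b' l
    by (subst integral_haar_scale) (simp_all add: integral_eq_nn_integral)
  have ind: "indicator {..x'} (l * z) = (indicator {..x} z :: real)" for z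
    using l by (auto simp: indicator_def mult_le_cancel_left_pos simp flip: l(3))
  have t1: "(\<integral>z. indicator {..x} z * f1 z \<partial>haar) = cdf (beta_law a b) x"
    unfolding f1_def using a b by (simp add: cdf_beta_law_eq_integral)
  have t2: "(\<integral>z. indicator {..x} z * f2 z \<partial>haar) = cdf (beta_law a b) x"
    unfolding eq cdf_beta_law_eq_integral[OF a b'] f2_def ind[symmetric]
    by (rule integral_haar_scale) (use l in auto)
  have ii: "integrable haar (\<lambda>z. indicator A z * f z)" if "integrable haar f" "A \<in> sets borel" for A and f :: "real \<Rightarrow> real"
    using integrable_mult_indicator[of A haar f] that by simp
  have comp: "(\<integral>z. indicator {x<..} z * f z \<partial>haar) = (\<integral>z. f z \<partial>haar) - (\<integral>z. indicator {..x} z * f z \<partial>haar)"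
    if "integrable haar f" for f :: "real \<Rightarrow> real"
  proof -
    have "(\<integral>z. indicator {x<..} z * f z \<partial>haar) = (\<integral>z. f z - indicator {..x} z * f z \<partial>haar)"
      by (rule Bochner_Integration.integral_cong) (auto simp: indicator_def)
    also have "\<dots> = (\<integral>z. f z \<partial>haar) - (\<integral>z. indicator {..x} z * f z \<partial>haar)"
      by (intro Bochner_Integration.integral_diff that ii) simp
    finally show ?thesis .
  qed
  have u12: "(\<integral>z. indicator {x<..} z * f1 z \<partial>haar) = (\<integral>z. indicator {x<..} z * f2 z \<partial>haar)"
    using comp[OF int1] comp[OF int2] one1 one2 t1 t2 by simp
  have f2_nonneg: "f2 z \<ge> 0" for z unfolding f2_def using a b' by simp
  have strict: False
    if A: "A \<in> sets borel" "(\<integral>z. indicator A z * f1 z \<partial>haar) = (\<integral>z. indicator A z * f2 z \<partial>haar)"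
      and ge: "\<And>z. z \<in> A \<Longrightarrow> z > 0 \<Longrightarrow> f1 z \<le> f2 z"
      and gt: "0 \<le> u" "u < v" "\<And>z. z \<in> {u<..<v} \<Longrightarrow> z \<in> A \<and> f1 z < f2 z" for A u v
  proof -
    have "(\<integral>z. indicator A z * f2 z - indicator A z * f1 z \<partial>haar) = 0"
      using A(2) by (subst Bochner_Integration.integral_diff) (simp_all only: ii[OF int1 A(1)] ii[OF int2 A(1)] diff_self)
    moreover have "AE z in haar. 0 \<le> indicator A z * f2 z - indicator A z * f1 z"
      using AE_haar_pos by eventually_elim (use ge in \<open>auto simp: indicator_def\<close>)
    ultimately have "AE z in haar. indicator A z * f2 z - indicator A z * f1 z = 0"
      by (subst (asm) integral_nonneg_eq_0_iff_AE)
         (simp_all only: Bochner_Integration.integrable_diff ii[OF int1 A(1)] ii[OF int2 A(1)])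
    hence "AE z in haar. z \<notin> {u<..<v}"
      by eventually_elim (use gt in fastforce)
    thus False using not_AE_haar_notin[OF gt(1,2)] by simp
  qed
  \<comment> \<open>If \<open>L\<close> were positive at \<open>x\<close>, quasiconvexity would make
    it positive on a whole side of \<open>x\<close>, and the two densities could not have the same
    mass on that side.\<close>
  have Lx: "L x \<le> 0"
  proof (rule ccontr)
    assume Lx: "\<not> L x \<le> 0"
    have "(\<forall>z. 0 < z \<and> z \<le> x \<longrightarrow> L z > 0) \<or> (\<forall>z. x \<le> z \<and> z < 1 \<longrightarrow> L z > 0)"
    proof (rule ccontr)
      assume "\<not> ?thesis"
      then obtain z1 z3 where "0 < z1" "z1 \<le> x" "L z1 \<le> 0" "x \<le> z3" "z3 < 1" "L z3 \<le> 0"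
        by (auto simp: not_less)
      thus False using quasi[of z1 x z3] Lx by simp
    qed
    thus False
    proof
      assume *: "\<forall>z. 0 < z \<and> z \<le> x \<longrightarrow> L z > 0"
      show False
      proof (rule strict[of "{..x}" 0 x])
        show "\<And>z. z \<in> {..x} \<Longrightarrow> 0 < z \<Longrightarrow> f1 z \<le> f2 z"
          using * f12_less x by (auto intro!: less_imp_le)
      qed (use * f12_less x t1 t2 in auto)
    next
      assume *: "\<forall>z. x \<le> z \<and> z < 1 \<longrightarrow> L z > 0"
      show False
      proof (rule strict[of "{x<..}" x 1])
        fix z assume "z \<in> {x<..}" "0 < z"
        thus "f1 z \<le> f2 z"
          using * f12_less[of z] f2_nonneg[of z] by (cases "z < 1") (auto simp: f1_def beta_dens_def)
      qed (use * f12_less x u12 in auto)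
    qed
  qed
  \<comment> \<open>The weight \<open>z powr q\<close> raises the first parameter from
    \<open>a\<close> to \<open>a + q\<close>. Normalising constants drop out in the end, because
    each distribution function is the weighted mass on the left of \<open>x\<close> divided by the
    sum of those on the left and on the right.\<close>
  define A1 where "A1 = (\<integral>z. indicator {..x} z * (z powr q * f1 z) \<partial>haar)"
  define A2 where "A2 = (\<integral>z. indicator {..x} z * (z powr q * f2 z) \<partial>haar)"
  define B1 where "B1 = (\<integral>z. indicator {x<..} z * (z powr q * f1 z) \<partial>haar)"
  define B2 where "B2 = (\<integral>z. indicator {x<..} z * (z powr q * f2 z) \<partial>haar)"
  define k1 where "k1 = Gamma (a + q + b) / (Gamma (a + q) * Gamma b) / (Gamma (a + b) / (Gamma a * Gamma b))"
  define k2 where "k2 = Gamma (a + q + b') / (Gamma (a + q) * Gamma b') / (Gamma (a + b') / (Gamma a * Gamma b')) * l powr q"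
  have k: "k1 > 0" "k2 > 0" using a b b' q l by (auto simp: k1_def k2_def Gamma_real_pos Gamma_real_neq_0)
  have g1: "beta_dens (a + q) b z = k1 * (z powr q * f1 z)" if "z > 0" for z
    using that a b q by (auto simp: beta_dens_def f1_def k1_def powr_add Gamma_real_neq_0 mult_ac)
  have g2: "beta_dens (a + q) b' (l * z) = k2 * (z powr q * f2 z)" if "z > 0" for z
    using that a b' q l by (auto simp: beta_dens_def f2_def k2_def powr_add powr_mult Gamma_real_neq_0 mult_ac)
  have aq: "a + q > 0" using a q by simp
  have iq1: "integrable haar (\<lambda>z. z powr q * f1 z)"
  proof -
    have "integrable haar (\<lambda>z. 1 / k1 * beta_dens (a + q) b z)"
      using aq b by (intro integrable_mult_right haar_integrable_beta_dens) auto
    thus ?thesis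
      by (rule integrable_cong_AE_imp) (use AE_haar_pos g1 k in \<open>auto elim!: eventually_mono\<close>)
  qed
  have iq2: "integrable haar (\<lambda>z. z powr q * f2 z)"
  proof -
    have "integrable haar (\<lambda>z. 1 / k2 * beta_dens (a + q) b' (l * z))"
      using aq b' l by (intro integrable_mult_right integrable_haar_scale haar_integrable_beta_dens) auto
    thus ?thesis
      by (rule integrable_cong_AE_imp) (use AE_haar_pos g2 k in \<open>auto elim!: eventually_mono\<close>)
  qed
  have cdf1: "cdf (beta_law (a + q) b) x = k1 * A1" and tot1: "1 = k1 * (A1 + B1)"
  proof -
    have "cdf (beta_law (a + q) b) x = (\<integral>z. k1 * (indicator {..x} z * (z powr q * f1 z)) \<partial>haar)"
      unfolding cdf_beta_law_eq_integral[OF aq b(1)]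
      by (rule integral_cong_AE) (use AE_haar_pos g1 in \<open>auto elim!: eventually_mono\<close>)
    thus "cdf (beta_law (a + q) b) x = k1 * A1" by (simp add: A1_def)
    have "1 = (\<integral>z. beta_dens (a + q) b z \<partial>haar)"
      using nn_integral_beta_dens[OF aq b(1)] aq b by (simp add: integral_eq_nn_integral)
    also have "\<dots> = (\<integral>z. k1 * (z powr q * f1 z) \<partial>haar)"
      by (rule integral_cong_AE) (use AE_haar_pos g1 in \<open>auto elim!: eventually_mono\<close>)
    finally show "1 = k1 * (A1 + B1)"
      unfolding A1_def B1_def comp[OF iq1] by simp
  qed
  have cdf2: "cdf (beta_law (a + q) b') x' = k2 * A2" and tot2: "1 = k2 * (A2 + B2)"
  proof -
    have "cdf (beta_law (a + q) b') x' = (\<integral>z. indicator {..x'} (l * z) * beta_dens (a + q) b' (l * z) \<partial>haar)"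
      unfolding cdf_beta_law_eq_integral[OF aq b'] by (rule integral_haar_scale[symmetric]) (use l in auto)
    also have "\<dots> = (\<integral>z. k2 * (indicator {..x} z * (z powr q * f2 z)) \<partial>haar)"
      unfolding ind by (rule integral_cong_AE) (use AE_haar_pos g2 in \<open>auto elim!: eventually_mono\<close>)
    finally show "cdf (beta_law (a + q) b') x' = k2 * A2" by (simp add: A2_def)
    have "1 = (\<integral>z. beta_dens (a + q) b' (l * z) \<partial>haar)"
      using nn_integral_beta_dens[OF aq b'] aq b' l by (subst integral_haar_scale) (auto simp: integral_eq_nn_integral)
    also have "\<dots> = (\<integral>z. k2 * (z powr q * f2 z) \<partial>haar)"
      by (rule integral_cong_AE) (use AE_haar_pos g2 in \<open>auto elim!: eventually_mono\<close>)
    finally show "1 = k2 * (A2 + B2)"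
      unfolding A2_def B2_def comp[OF iq2] by simp
  qed
  \<comment> \<open>\<open>Inf S\<close> is the crossing on the left of \<open>x\<close>:
    \<open>f1 < f2\<close> below it and \<open>f2 \<le> f1\<close> between it and \<open>x\<close>.
    Without a crossing it is 0, and then the comparison constant \<open>Inf S powr q\<close> is 0 as
    well.\<close>
  define S where "S = {z. 0 < z \<and> z \<le> x \<and> L z \<le> 0}"
  have xS: "x \<in> S" using x Lx by (simp add: S_def)
  have bddS: "bdd_below S" by (rule bdd_belowI[of _ 0]) (simp add: S_def)
  have S0: "Inf S \<ge> 0" using xS by (intro cInf_greatest) (auto simp: S_def)
  have A21: "A2 \<le> A1"
  proof -
    have "AE z in haar. (z powr q - Inf S powr q) * (indicator {..x} z * f2 z - indicator {..x} z * f1 z) \<le> 0"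
      using AE_haar_pos
    proof eventually_elim
      case z: (elim z)
      consider "z > x" | "z \<le> x" "z < Inf S" | "z = Inf S" | "z \<le> x" "z > Inf S" by linarith
      thus ?case
      proof cases
        case 2
        hence "z \<notin> S" using cInf_lower[OF _ bddS, of z] by auto
        hence "f1 z < f2 z" using 2 z x by (intro f12_less) (auto simp: S_def)
        moreover have "z powr q \<le> Inf S powr q" using 2 z q by (intro powr_mono2) auto
        ultimately show ?thesis using 2 by (intro mult_nonpos_nonneg) auto
      next
        case 4
        obtain s where s: "s \<in> S" "s < z" using 4 cInf_less_iff[OF _ bddS, of z] xS by auto
        hence "L z \<le> 0" using quasi[of s z x] 4 x Lx by (auto simp: S_def)
        hence "f2 z \<le> f1 z" using z 4 x by (intro f12_le) auto
        moreover have "Inf S powr q \<le> z powr q" using 4 z q S0 by (intro powr_mono2) auto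
        ultimately show ?thesis using 4 by (intro mult_nonneg_nonpos) auto
      qed auto
    qed
    hence "(\<integral>z. z powr q * (indicator {..x} z * f2 z) \<partial>haar) \<le> (\<integral>z. z powr q * (indicator {..x} z * f1 z) \<partial>haar)"
      using ii[OF int1, of "{..x}"] ii[OF int2, of "{..x}"] ii[OF iq1, of "{..x}"] ii[OF iq2, of "{..x}"] t1 t2
      by (intro integral_single_crossing[where K = "Inf S powr q"]) (simp_all only: mult.left_commute atMost_borel)
    thus ?thesis by (simp add: A1_def A2_def mult.left_commute)
  qed
  \<comment> \<open>The mirror image: \<open>Sup T\<close> is the crossing on the right of
    \<open>x\<close>. From 1 onwards \<open>f1\<close> vanishes, so \<open>f1 \<le> f2\<close>
    persists there.\<close>
  define T where "T = {z. x \<le> z \<and> z < 1 \<and> L z \<le> 0}"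
  have xT: "x \<in> T" using x Lx by (simp add: T_def)
  have bddT: "bdd_above T" by (rule bdd_aboveI[of _ 1]) (simp add: T_def)
  have T1: "x \<le> Sup T" "Sup T \<le> 1" using xT bddT by (auto intro!: cSup_least cSup_upper simp: T_def)
  have B12: "B1 \<le> B2"
  proof -
    have "AE z in haar. (z powr q - Sup T powr q) * (indicator {x<..} z * f1 z - indicator {x<..} z * f2 z) \<le> 0"
      using AE_haar_pos
    proof eventually_elim
      case z: (elim z)
      consider "z \<le> x" | "z > x" "z > Sup T" | "z = Sup T" | "z > x" "z < Sup T" by linarith
      thus ?case
      proof cases
        case 2
        hence "z \<notin> T" using cSup_upper[OF _ bddT, of z] by auto
        hence "f1 z \<le> f2 z" using 2 z x f12_less[of z] f2_nonneg[of z] 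
          by (cases "z < 1") (auto simp: T_def f1_def beta_dens_def)
        moreover have "Sup T powr q \<le> z powr q" using 2 T1 x q by (intro powr_mono2) auto
        ultimately show ?thesis using 2 by (intro mult_nonneg_nonpos) auto
      next
        case 4
        obtain s where s: "s \<in> T" "z < s" using 4 less_cSup_iff[OF _ bddT, of z] xT by auto
        hence "L z \<le> 0" using quasi[of x z s] 4 x Lx by (auto simp: T_def)
        hence "f2 z \<le> f1 z" using z 4 x T1 by (intro f12_le) auto
        moreover have "z powr q \<le> Sup T powr q" using 4 z q by (intro powr_mono2) auto
        ultimately show ?thesis using 4 by (intro mult_nonpos_nonneg) auto
      qed auto
    qed
    hence "(\<integral>z. z powr q * (indicator {x<..} z * f1 z) \<partial>haar) \<le> (\<integral>z. z powr q * (indicator {x<..} z * f2 z) \<partial>haar)"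
      using ii[OF int1, of "{x<..}"] ii[OF int2, of "{x<..}"] ii[OF iq1, of "{x<..}"] ii[OF iq2, of "{x<..}"] u12
      by (intro integral_single_crossing[where K = "Sup T powr q"]) (simp_all only: mult.left_commute greaterThan_borel)
    thus ?thesis by (simp add: B1_def B2_def mult.left_commute)
  qed
  have A2_nonneg: "A2 \<ge> 0" unfolding A2_def
    using f2_nonneg by (intro Bochner_Integration.integral_nonneg) auto
  have B1_nonneg: "B1 \<ge> 0" unfolding B1_def f1_def
    using a b by (intro Bochner_Integration.integral_nonneg) auto
  have 1: "cdf (beta_law (a + q) b') x' = A2 / (A2 + B2)" "cdf (beta_law (a + q) b) x = A1 / (A1 + B1)"
    using cdf1 cdf2 tot1 tot2 by (auto simp: eq_divide_eq)
  \<comment> \<open>Cross-multiplied, the claim \<open>A2 / (A2 + B2) \<le> A1 / (A1 + B1)\<close>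
    is this inequality.\<close>
  have "A2 * B1 \<le> A1 * B2"
    using A21 B12 A2_nonneg B1_nonneg by (intro mult_mono) auto
  moreover have "A1 + B1 > 0" "A2 + B2 > 0"
    using tot1 tot2 k zero_less_mult_pos[of k1 "A1 + B1"] zero_less_mult_pos[of k2 "A2 + B2"] by auto
  ultimately show ?thesis unfolding 1 by (simp add: frac_le_eq divide_le_0_iff) (simp add: algebra_simps)
qed

text \<open>Exhibits \<open>- ln u\<close> as a Haar mass, which is what gives the mean of
  \<open>- ln F\<close> a layer-cake formula with measure dt/t on the unit interval.\<close>

lemma nn_integral_haar_Ico:
  assumes "0 < u" "u \<le> 1"
  shows "(\<integral>\<^sup>+t. indicator {u..<1} t \<partial>haar) = ennreal (- ln u)"
proof -
  have "(\<integral>\<^sup>+t. indicator {u..<1} t \<partial>haar) = (\<integral>\<^sup>+t. ennreal (indicator {0<..} t / t) * indicator {u..<1} t \<partial>lborel)"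
    by (rule nn_integral_haar) measurable
  also have "\<dots> = (\<integral>\<^sup>+t. ennreal (1 / t) * indicator {u..1} t \<partial>lborel)"
    by (rule nn_integral_cong_AE)
       (use AE_lborel_singleton[of "1::real"] assms in \<open>auto elim!: eventually_mono simp: indicator_def\<close>)
  also have "\<dots> = ennreal (ln 1 - ln u)"
    using assms by (intro nn_integral_FTC_Icc) (auto intro!: derivative_eq_intros simp: field_simps)
  finally show ?thesis by simp
qed

lemma cdf_beta_law_measurable [measurable]: "a > 0 \<Longrightarrow> b > 0 \<Longrightarrow> cdf (beta_law a b) \<in> borel_measurable borel"
  by (intro borel_measurable_continuous_onI continuous_at_imp_continuous_on ballI isCont_cdf_beta_law)

text \<open>By the layer-cake formula the mean is the integral over levels \<open>t\<close> in
  (0,1), with respect to dt/t, of the probability that \<open>F(Z) \<le> t\<close>. This event says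
  that \<open>Z\<close> lies below the \<open>t\<close>-quantile of the beta law with parameters
  \<open>a\<close> and \<open>b\<close>, so for each \<open>t\<close> the two integrands are
  compared by the lemma on matched quantiles.\<close>

lemma expected_neg_ln_cdf_beta_law_antimono:
  assumes a: "a > 0" and q: "q > 0" and b: "0 < b" "b \<le> b'"
  shows "(\<integral>\<^sup>+z. ennreal (- ln (cdf (beta_law a b') z)) \<partial>beta_law (a + q) b')
       \<le> (\<integral>\<^sup>+z. ennreal (- ln (cdf (beta_law a b) z)) \<partial>beta_law (a + q) b)"
proof -
  have aq: "a + q > 0" and b': "b' > 0" using assms by auto
  have layer: "(\<integral>\<^sup>+z. ennreal (- ln (cdf (beta_law a \<beta>) z)) \<partial>beta_law (a + q) \<beta>) =
    (\<integral>\<^sup>+t. indicator {0<..<1} t * emeasure (beta_law (a + q) \<beta>) {z\<in>{0<..<1}. cdf (beta_law a \<beta>) z \<le> t} \<partial>haar)"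
    if \<beta>: "\<beta> > 0" for \<beta>
  proof -
    interpret R: real_distribution "beta_law (a + q) \<beta>" using aq \<beta> by (rule real_distribution_beta_law)
    note [measurable] = cdf_beta_law_measurable[OF a \<beta>]
    have "(\<integral>\<^sup>+z. ennreal (- ln (cdf (beta_law a \<beta>) z)) \<partial>beta_law (a + q) \<beta>) =
      (\<integral>\<^sup>+z. \<integral>\<^sup>+t. indicator {z\<in>{0<..<1}. cdf (beta_law a \<beta>) z \<le> t} z * indicator {0<..<1} t \<partial>haar \<partial>beta_law (a + q) \<beta>)"
    proof (rule nn_integral_cong_AE, use AE_beta_law in eventually_elim, goal_cases)
      case z: (1 z)
      have "(\<integral>\<^sup>+t. indicator {z\<in>{0<..<1}. cdf (beta_law a \<beta>) z \<le> t} z * indicator {0<..<1} t \<partial>haar) =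
        (\<integral>\<^sup>+t. indicator {cdf (beta_law a \<beta>) z..<1} t \<partial>haar)"
        using z by (intro nn_integral_haar_cong) (auto simp: indicator_def)
      also have "\<dots> = ennreal (- ln (cdf (beta_law a \<beta>) z))"
        using z a \<beta> cdf_beta_law_less_1[of a \<beta> z]
        by (intro nn_integral_haar_Ico cdf_beta_law_pos) auto
      finally show ?case by simp
    qed
    also have "\<dots> = (\<integral>\<^sup>+t. \<integral>\<^sup>+z. indicator {z\<in>{0<..<1}. cdf (beta_law a \<beta>) z \<le> t} z * indicator {0<..<1} t \<partial>beta_law (a + q) \<beta> \<partial>haar)"
      by (rule nn_integral_swap[OF R.sigma_finite_measure_axioms haar.sigma_finite_measure_axioms]) measurable
    also have "\<dots> = (\<integral>\<^sup>+t. indicator {0<..<1} t * emeasure (beta_law (a + q) \<beta>) {z\<in>{0<..<1}. cdf (beta_law a \<beta>) z \<le> t} \<partial>haar)"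
      by (intro nn_integral_cong, subst nn_integral_multc) (simp_all add: mult.commute)
    finally show ?thesis .
  qed
  have quant: "emeasure (beta_law (a + q) \<beta>) {z\<in>{0<..<1}. cdf (beta_law a \<beta>) z \<le> cdf (beta_law a \<beta>) x} = ennreal (cdf (beta_law (a + q) \<beta>) x)"
    if \<beta>: "\<beta> > 0" and x: "0 < x" "x < 1" for \<beta> x
  proof -
    interpret R: real_distribution "beta_law (a + q) \<beta>" using aq \<beta> by (rule real_distribution_beta_law)
    note [measurable] = cdf_beta_law_measurable[OF a \<beta>]
    have "emeasure (beta_law (a + q) \<beta>) {z\<in>{0<..<1}. cdf (beta_law a \<beta>) z \<le> cdf (beta_law a \<beta>) x} = emeasure (beta_law (a + q) \<beta>) {..x}"
    proof (rule emeasure_eq_AE)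
      show "AE z in beta_law (a + q) \<beta>. z \<in> {z \<in> {0<..<1}. cdf (beta_law a \<beta>) z \<le> cdf (beta_law a \<beta>) x} \<longleftrightarrow> z \<in> {..x}"
        using AE_beta_law
      proof eventually_elim
        case z: (elim z)
        show ?case
          using z x a \<beta> cdf_beta_law_strict_mono[of a \<beta> z x] cdf_beta_law_strict_mono[of a \<beta> x z] by force
      qed
    qed auto
    thus ?thesis by (simp add: cdf_def R.emeasure_eq_measure)
  qed
  show ?thesis
    unfolding layer[OF b(1)] layer[OF b']
  proof (rule nn_integral_haar_mono, goal_cases)
    case _: (1 t)
    show ?case
    proof (cases "t < 1")
      case True
      obtain x where x: "0 < x" "x < 1" "cdf (beta_law a b) x = t"
        using cdf_beta_law_quantile[OF a b(1) \<open>t > 0\<close> True] by blast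
      obtain x' where x': "0 < x'" "x' < 1" "cdf (beta_law a b') x' = t"
        using cdf_beta_law_quantile[OF a b' \<open>t > 0\<close> True] by blast
      have "cdf (beta_law (a + q) b') x' \<le> cdf (beta_law (a + q) b) x"
        using a q b x x' by (intro cdf_beta_law_matched_quantiles) auto
      thus ?thesis using quant[OF b(1) x(1,2)] quant[OF b' x'(1,2)] x x' True \<open>t > 0\<close>
        by (simp add: ennreal_leI)
    qed simp
  qed
qed

section \<open>Superharmonicity of the marginal ratio\<close>

text \<open>The heat-kernel representation of the Newtonian kernel: in terms of the variance
  \<open>1 / v\<close>, the weight \<open>inverse v\<close> against \<open>haar\<close> is Lebesgue
  measure. \<open>newton_mix_smooth p\<close> keeps only the variances above
  \<open>1 / p\<close>.\<close>

definition newton_mix :: "'a::euclidean_space \<Rightarrow> ennreal" where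
  "newton_mix x = (\<integral>\<^sup>+v. ennreal (inverse v * normal_dens v x) \<partial>haar)"

definition newton_mix_smooth :: "real \<Rightarrow> 'a::euclidean_space \<Rightarrow> ennreal" where
  "newton_mix_smooth p x = (\<integral>\<^sup>+v. ennreal (inverse v * normal_dens v x) * indicator {..<p} v \<partial>haar)"

lemma newton_mix_measurable [measurable]: "newton_mix \<in> borel_measurable borel"
  unfolding newton_mix_def by measurable

lemma newton_mix_smooth_measurable [measurable]:
  assumes [measurable]: "f \<in> borel_measurable M" "g \<in> borel_measurable M"
  shows "(\<lambda>x. newton_mix_smooth (f x) (g x)) \<in> borel_measurable M"
proof -
  have "(\<lambda>x. \<integral>\<^sup>+v. ennreal (inverse v * normal_dens v (g x)) * (if v < f x then 1 else 0) \<partial>haar) \<in> borel_measurable M"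
    by measurable
  thus ?thesis unfolding newton_mix_smooth_def indicator_def by simp
qed

lemma normal_dens_eq_powr:
  fixes x :: "'a::euclidean_space"
  assumes "v > 0"
  shows "normal_dens v x = (2 * pi) powr (- real DIM('a) / 2) * (v powr (real DIM('a) / 2) * exp (- ((norm x)\<^sup>2 / 2 * v)))"
  using assms by (simp add: normal_dens_def powr_divide powr_minus_divide mult.commute)

text \<open>A gamma integral in the precision with exponent \<open>DIM('a) / 2 - 1\<close>;
  dimension at least three makes this exponent positive.\<close>

lemma newton_mix_eq:
  fixes x :: "'a::euclidean_space"
  assumes "DIM('a) \<ge> 3" "x \<noteq> 0"
  shows "newton_mix x = ennreal ((2 * pi) powr (- real DIM('a) / 2) * Gamma (real DIM('a) / 2 - 1) * 2 powr (real DIM('a) / 2 - 1))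
     * ennreal (norm x powr (2 - real DIM('a)))"
proof -
  define a where "a = real DIM('a) / 2 - 1"
  have a: "a > 0" using assms by (simp add: a_def)
  have d: "real DIM('a) / 2 = a + 1" by (simp add: a_def)
  have "newton_mix x = (\<integral>\<^sup>+v. ennreal ((2 * pi) powr (- real DIM('a) / 2)) * ennreal (v powr a * exp (- ((norm x)\<^sup>2 / 2 * v))) \<partial>haar)"
    unfolding newton_mix_def
    by (rule nn_integral_haar_cong) (simp add: normal_dens_eq_powr d powr_add ennreal_mult[symmetric])
  also have "\<dots> = ennreal ((2 * pi) powr (- real DIM('a) / 2)) * ennreal (Gamma a / ((norm x)\<^sup>2 / 2) powr a)"
    using nn_integral_haar_Gamma[of a "(norm x)\<^sup>2 / 2"] a assms
    by (subst nn_integral_cmult) simp_all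
  also have "Gamma a / ((norm x)\<^sup>2 / 2) powr a = Gamma a * 2 powr a * norm x powr (2 - real DIM('a))"
  proof -
    have "((norm x)\<^sup>2) powr a = norm x powr (2 * a)"
      using assms by (simp add: powr_powr flip: powr_numeral)
    moreover have "norm x powr (2 - real DIM('a)) = 1 / norm x powr (2 * a)"
      by (simp add: a_def powr_minus_divide[symmetric])
    ultimately show ?thesis by (simp add: powr_divide)
  qed
  finally show ?thesis using a by (simp add: ennreal_mult[symmetric] a_def[symmetric] Gamma_real_nonneg mult.assoc)
qed

text \<open>Convolution with precision \<open>p\<close> adds \<open>1 / p\<close> to every variance
  in the mixture. As the mixing measure is Lebesgue measure in the variance, the shift only moves
  its left end point from 0 to \<open>1 / p\<close>.\<close>

lemma nn_integral_newton_mix_normal_dens: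
  fixes x :: "'a::euclidean_space"
  assumes p: "p > 0"
  shows "(\<integral>\<^sup>+\<theta>. newton_mix \<theta> * ennreal (normal_dens p (\<theta> - x)) \<partial>lborel) = newton_mix_smooth p x"
proof -
  have "(\<integral>\<^sup>+\<theta>. newton_mix \<theta> * ennreal (normal_dens p (\<theta> - x)) \<partial>lborel)
    = (\<integral>\<^sup>+\<theta>. \<integral>\<^sup>+v. ennreal (inverse v * normal_dens v \<theta>) * ennreal (normal_dens p (\<theta> - x)) \<partial>haar \<partial>lborel)"
    by (simp add: newton_mix_def nn_integral_multc)
  also have "\<dots> = (\<integral>\<^sup>+v. \<integral>\<^sup>+\<theta>. ennreal (inverse v * normal_dens v \<theta>) * ennreal (normal_dens p (\<theta> - x)) \<partial>lborel \<partial>haar)"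
    by (rule nn_integral_swap_lborel_haar) measurable
  also have "\<dots> = (\<integral>\<^sup>+v. ennreal (inverse v * normal_dens (v * p / (v + p)) x) \<partial>haar)"
  proof (rule nn_integral_haar_cong, goal_cases)
    case v: (1 v)
    have "(\<integral>\<^sup>+\<theta>. ennreal (inverse v * normal_dens v \<theta>) * ennreal (normal_dens p (\<theta> - x)) \<partial>lborel) =
      (\<integral>\<^sup>+\<theta>. ennreal (inverse v) * (ennreal (normal_dens v (\<theta> - 0)) * ennreal (normal_dens p (\<theta> - x))) \<partial>lborel)"
      using v by (intro nn_integral_cong) (simp add: ennreal_mult mult.assoc)
    also have "\<dots> = ennreal (inverse v * normal_dens (v * p / (v + p)) x)"
      using v p nn_integral_normal_dens_conv[OF v p, of 0 x]
      by (subst nn_integral_cmult) (auto simp: ennreal_mult)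
    finally show ?case .
  qed
  \<comment> \<open>Change to the variance \<open>l = 1 / v\<close>, the variable in which the
    convolution acts as a translation.\<close>
  also have "\<dots> = (\<integral>\<^sup>+l. ennreal (inverse (inverse l) * normal_dens (inverse l * p / (inverse l + p)) x) \<partial>haar)"
    by (rule nn_integral_haar_inverse[symmetric]) measurable
  also have "\<dots> = (\<integral>\<^sup>+l. ennreal (l * normal_dens (inverse (l + 1 / p)) x) \<partial>haar)"
    using p by (intro nn_integral_haar_cong arg_cong[of _ _ ennreal] arg_cong2[where f="(*)"] arg_cong2[where f=normal_dens])
       (auto simp: field_simps)
  also have "\<dots> = (\<integral>\<^sup>+l. ennreal (indicator {0<..} l / l) * ennreal (l * normal_dens (inverse (l + 1 / p)) x) \<partial>lborel)"
    by (rule nn_integral_haar) measurable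
  also have "\<dots> = (\<integral>\<^sup>+l. ennreal (normal_dens (inverse (l + 1 / p)) x) * indicator {1/p<..} (l + 1/p) \<partial>lborel)"
    by (intro nn_integral_cong) (auto simp: indicator_def ennreal_mult[symmetric])
  also have "\<dots> = (\<integral>\<^sup>+l. ennreal (normal_dens (inverse l) x) * indicator {1/p<..} l \<partial>lborel)"
    by (rule nn_integral_lborel_shift[of "\<lambda>l. ennreal (normal_dens (inverse l) x) * indicator {1/p<..} l"]) measurable
  also have "\<dots> = (\<integral>\<^sup>+l. ennreal (indicator {0<..} l / l) * (ennreal (inverse (inverse l) * normal_dens (inverse l) x) * indicator {..<p} (inverse l)) \<partial>lborel)"
  proof (intro nn_integral_cong_AE)
    have *: "ennreal (normal_dens (inverse l) x) * indicator {1/p<..} l =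
      ennreal (indicator {0<..} l / l) * (ennreal (inverse (inverse l) * normal_dens (inverse l) x) * indicator {..<p} (inverse l))" for l
    proof (cases "l > 0")
      case True
      hence "1 / p < l \<longleftrightarrow> inverse l < p" using p by (simp add: field_simps)
      thus ?thesis using True by (auto simp: indicator_def ennreal_mult[symmetric])
    next
      case False
      hence "\<not> 1 / p < l" using p by (smt (verit) divide_pos_pos)
      thus ?thesis using False by simp
    qed
    show "AE l in lborel. ennreal (normal_dens (inverse l) x) * indicator {1/p<..} l =
      ennreal (indicator {0<..} l / l) * (ennreal (inverse (inverse l) * normal_dens (inverse l) x) * indicator {..<p} (inverse l))"
      by (rule AE_I2) (rule *)
  qed
  also have "\<dots> = (\<integral>\<^sup>+l. ennreal (inverse (inverse l) * normal_dens (inverse l) x) * indicator {..<p} (inverse l) \<partial>haar)"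
    by (rule nn_integral_haar[symmetric]) measurable
  also have "\<dots> = newton_mix_smooth p x"
    unfolding newton_mix_smooth_def
    by (rule nn_integral_haar_inverse[of "\<lambda>v. ennreal (inverse v * normal_dens v x) * indicator {..<p} v"]) measurable
  finally show ?thesis .
qed

lemma newton_mix_smooth_mono: "p \<le> p' \<Longrightarrow> newton_mix_smooth p x \<le> newton_mix_smooth p' x"
  unfolding newton_mix_smooth_def by (intro nn_integral_mono mult_left_mono) (auto simp: indicator_def)

text \<open>Smoothing with precisions \<open>p\<close> and \<open>r\<close> in succession is
  smoothing once with the smaller precision \<open>r * p / (r + p)\<close>, which removes more of
  the mixture. Superharmonicity is used throughout in this form, as a bound on normal averages; no
  derivatives occur.\<close>

lemma newton_mix_smooth_superharmonic:
  fixes x :: "'a::euclidean_space"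
  assumes p: "p > 0" and r: "r > 0"
  shows "(\<integral>\<^sup>+z. ennreal (normal_dens r (z - x)) * newton_mix_smooth p z \<partial>lborel) \<le> newton_mix_smooth p x"
proof -
  have "(\<integral>\<^sup>+z. ennreal (normal_dens r (z - x)) * newton_mix_smooth p z \<partial>lborel)
    = (\<integral>\<^sup>+z. \<integral>\<^sup>+\<theta>. ennreal (normal_dens r (z - x)) * (newton_mix \<theta> * ennreal (normal_dens p (\<theta> - z))) \<partial>lborel \<partial>lborel)"
    using p by (simp add: nn_integral_newton_mix_normal_dens[symmetric] nn_integral_cmult)
  also have "\<dots> = (\<integral>\<^sup>+\<theta>. \<integral>\<^sup>+z. ennreal (normal_dens r (z - x)) * (newton_mix \<theta> * ennreal (normal_dens p (\<theta> - z))) \<partial>lborel \<partial>lborel)"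
    by (rule nn_integral_swap_lborel) measurable
  also have "\<dots> = (\<integral>\<^sup>+\<theta>. \<integral>\<^sup>+z. newton_mix \<theta> * (ennreal (normal_dens r (z - x)) * ennreal (normal_dens p (z - \<theta>))) \<partial>lborel \<partial>lborel)"
    by (simp add: mult_ac normal_dens_minus_commute)
  also have "\<dots> = (\<integral>\<^sup>+\<theta>. newton_mix \<theta> * ennreal (normal_dens (r * p / (r + p)) (\<theta> - x)) \<partial>lborel)"
    using p r by (simp add: nn_integral_cmult nn_integral_normal_dens_conv)
  also have "\<dots> = newton_mix_smooth (r * p / (r + p)) x"
    using p r by (intro nn_integral_newton_mix_normal_dens) auto
  also have "\<dots> \<le> newton_mix_smooth p x"
    using p r by (intro newton_mix_smooth_mono) (simp add: field_simps)
  finally show ?thesis .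
qed

text \<open>The ratio \<psi> of the overview in terms of squared norms \<open>w\<close> and
  \<open>s\<close>: \<open>a\<close> is d/2 - 1, \<open>b\<close> is m/2, and
  \<open>w powr (- a)\<close> is the harmonic kernel.\<close>

definition psi :: "real \<Rightarrow> real \<Rightarrow> real \<Rightarrow> real \<Rightarrow> real" where
  "psi a b w s = w powr (- a) * cdf (beta_law a b) (w / (w + s))"

text \<open>Read as a function of the precision, a normal density at a fixed point \<open>v\<close>
  is, up to a constant, a gamma density in \<open>p * (norm v)\<^sup>2 / 2\<close>. The substitution
  is a dilation, so \<open>haar\<close> is preserved.\<close>

lemma nn_integral_normal_dens_haar_eq:
  fixes v :: "'b::euclidean_space"
  assumes v: "v \<noteq> 0" and [measurable]: "F \<in> borel_measurable borel"
  defines "b \<equiv> real DIM('b) / 2"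
  shows "(\<integral>\<^sup>+p. ennreal (normal_dens p v) * F p \<partial>haar) =
    ennreal ((pi * (norm v)\<^sup>2) powr (- b) * Gamma b) * (\<integral>\<^sup>+t. ennreal (gamma_dens b t) * F (2 / (norm v)\<^sup>2 * t) \<partial>haar)"
proof -
  define s where "s = (norm v)\<^sup>2"
  have s: "s > 0" using v by (simp add: s_def)
  have b: "b > 0" by (simp add: b_def)
  have "(\<integral>\<^sup>+p. ennreal (normal_dens p v) * F p \<partial>haar) = (\<integral>\<^sup>+t. ennreal (normal_dens (2 / s * t) v) * F (2 / s * t) \<partial>haar)"
    using s by (intro nn_integral_haar_scale[symmetric]) auto
  also have "\<dots> = (\<integral>\<^sup>+t. ennreal ((pi * s) powr (- b) * Gamma b) * (ennreal (gamma_dens b t) * F (2 / s * t)) \<partial>haar)"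
  proof (rule nn_integral_haar_cong, goal_cases)
    case t: (1 t)
    have "normal_dens (2 / s * t) v = (pi * s) powr (- b) * t powr b * exp (- t)"
      using s t by (simp add: normal_dens_def s_def[symmetric] b_def[symmetric] powr_divide powr_mult powr_minus_divide)
    hence "normal_dens (2 / s * t) v = (pi * s) powr (- b) * Gamma b * gamma_dens b t"
      using b by (simp add: gamma_dens_def Gamma_real_neq_0)
    thus ?case
      using b by (simp add: ennreal_mult mult.assoc Gamma_real_nonneg)
  qed
  also have "\<dots> = ennreal ((pi * s) powr (- b) * Gamma b) * (\<integral>\<^sup>+t. ennreal (gamma_dens b t) * F (2 / s * t) \<partial>haar)"
    by (rule nn_integral_cmult) measurable
  finally show ?thesis by (simp add: s_def)
qed

lemma nn_integral_normal_dens_haar: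
  fixes v :: "'b::euclidean_space"
  assumes v: "v \<noteq> 0"
  shows "(\<integral>\<^sup>+p. ennreal (normal_dens p v) \<partial>haar) = ennreal ((pi * (norm v)\<^sup>2) powr (- (real DIM('b) / 2)) * Gamma (real DIM('b) / 2))"
  using nn_integral_normal_dens_haar_eq[OF v, of "\<lambda>_. 1"] by (simp add: nn_integral_gamma_dens)

definition newton_mix_const :: "nat \<Rightarrow> real" where
  "newton_mix_const d = (2 * pi) powr (- real d / 2) * 2 powr (real d / 2 - 1) * Gamma (real d / 2 - 1)"

lemma newton_mix_const_pos: "d \<ge> 3 \<Longrightarrow> newton_mix_const d > 0"
  by (simp add: newton_mix_const_def Gamma_real_pos)

text \<open>Both precisions turn into gamma variables: the mixing precision into \<open>u\<close> of
  shape \<open>a\<close>, the model precision into \<open>t\<close> of shape \<open>b\<close>. The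
  truncation of the former at the latter becomes \<open>u / (u + t) < w / (w + s)\<close>, an event
  for a beta variable.\<close>

lemma nn_integral_normal_dens_newton_mix_smooth:
  fixes x :: "'a::euclidean_space" and v :: "'b::euclidean_space"
  assumes d: "DIM('a) \<ge> 3" and x: "x \<noteq> 0" and v: "v \<noteq> 0"
  shows "(\<integral>\<^sup>+p. ennreal (normal_dens p v) * newton_mix_smooth p x \<partial>haar) = (\<integral>\<^sup>+p. ennreal (normal_dens p v) \<partial>haar) *
     ennreal (newton_mix_const DIM('a) * psi (real DIM('a) / 2 - 1) (real DIM('b) / 2) ((norm x)\<^sup>2) ((norm v)\<^sup>2))"
proof -
  define a b w s where "a = real DIM('a) / 2 - 1" and "b = real DIM('b) / 2"
    and "w = (norm x)\<^sup>2" and "s = (norm v)\<^sup>2"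
  have pos: "a > 0" "b > 0" "w > 0" "s > 0" using assms by (auto simp: a_def b_def w_def s_def)
  have d2: "real DIM('a) / 2 = a + 1" by (simp add: a_def)
  interpret B: real_distribution "beta_law a b" by (rule real_distribution_beta_law[OF pos(1,2)])
  define K where "K = newton_mix_const DIM('a) * w powr (- a)"
  have K: "K \<ge> 0" using d newton_mix_const_pos[of "DIM('a)"] by (simp add: K_def)
  have H: "newton_mix_smooth (2 / s * t) x = ennreal K * (\<integral>\<^sup>+u. ennreal (gamma_dens a u) * indicator {..<w / (w + s)} (u / (u + t)) \<partial>haar)"
    if t: "t > 0" for t
  proof -
    have "newton_mix_smooth (2 / s * t) x = (\<integral>\<^sup>+u. ennreal (inverse (2 / w * u) * normal_dens (2 / w * u) x) * indicator {..<2 / s * t} (2 / w * u) \<partial>haar)"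
      unfolding newton_mix_smooth_def
      using pos by (intro nn_integral_haar_scale[symmetric]) auto
    also have "\<dots> = (\<integral>\<^sup>+u. ennreal K * (ennreal (gamma_dens a u) * indicator {..<w / (w + s)} (u / (u + t))) \<partial>haar)"
    proof (rule nn_integral_haar_cong, goal_cases)
      case u: (1 u)
      have *: "(2 / w * u < 2 / s * t) = (u / (u + t) < w / (w + s))"
      proof -
        have "u + t > 0" "w + s > 0" using u t pos by auto
        thus ?thesis using u t pos by (simp add: divide_simps) (simp add: algebra_simps)
      qed
      have "inverse (2 / w * u) * normal_dens (2 / w * u) x = (2 * pi) powr (- real DIM('a) / 2) * ((2 / w * u) powr a * exp (- u))"
        using u pos by (simp add: normal_dens_eq_powr d2 powr_add w_def[symmetric])
      also have "\<dots> = K * gamma_dens a u"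
        using u pos by (simp add: K_def newton_mix_const_def a_def[symmetric] gamma_dens_def powr_mult powr_divide powr_minus_divide Gamma_real_neq_0)
      finally show ?case
        using K pos * by (simp add: ennreal_mult mult.assoc indicator_def)
    qed
    also have "\<dots> = ennreal K * (\<integral>\<^sup>+u. ennreal (gamma_dens a u) * indicator {..<w / (w + s)} (u / (u + t)) \<partial>haar)"
      by (rule nn_integral_cmult) measurable
    finally show ?thesis .
  qed
  have "(\<integral>\<^sup>+t. ennreal (gamma_dens b t) * newton_mix_smooth (2 / s * t) x \<partial>haar) =
     (\<integral>\<^sup>+t. \<integral>\<^sup>+u. ennreal K * (ennreal (gamma_dens a u) * ennreal (gamma_dens b t) * indicator {..<w / (w + s)} (u / (u + t))) \<partial>haar \<partial>haar)"
  proof (rule nn_integral_haar_cong, goal_cases)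
    case t: (1 t)
    have "ennreal (gamma_dens b t) * newton_mix_smooth (2 / s * t) x =
      (\<integral>\<^sup>+u. ennreal (gamma_dens b t) * (ennreal K * (ennreal (gamma_dens a u) * indicator {..<w / (w + s)} (u / (u + t)))) \<partial>haar)"
      unfolding H[OF t] by (simp add: nn_integral_cmult)
    thus ?case
      by (simp add: mult_ac)
  qed
  also have "\<dots> = (\<integral>\<^sup>+u. \<integral>\<^sup>+t. ennreal K * (ennreal (gamma_dens a u) * ennreal (gamma_dens b t) * indicator {..<w / (w + s)} (u / (u + t))) \<partial>haar \<partial>haar)"
    by (rule nn_integral_swap_haar) measurable
  also have "\<dots> = ennreal K * (\<integral>\<^sup>+u. \<integral>\<^sup>+t. ennreal (gamma_dens a u) * ennreal (gamma_dens b t) * indicator {..<w / (w + s)} (u / (u + t)) \<partial>haar \<partial>haar)"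
    by (simp add: nn_integral_cmult)
  also have "\<dots> = ennreal K * (\<integral>\<^sup>+z. ennreal (beta_dens a b z) * indicator {..<w / (w + s)} z \<partial>haar)"
    using pos by (simp add: nn_integral_gamma_dens_gamma_dens)
  also have "(\<integral>\<^sup>+z. ennreal (beta_dens a b z) * indicator {..<w / (w + s)} z \<partial>haar) = emeasure (beta_law a b) {..<w / (w + s)}"
    unfolding beta_law_def by (simp add: emeasure_density)
  \<comment> \<open>Closing the interval is harmless because beta laws have no atoms.\<close>
  also have "\<dots> = emeasure (beta_law a b) {..w / (w + s)}"
    by (rule emeasure_eq_AE)
       (auto intro!: AE_I[where N = "{w / (w + s)}"] simp: emeasure_beta_law_singleton)
  also have "\<dots> = ennreal (cdf (beta_law a b) (w / (w + s)))"
    by (simp add: cdf_def B.emeasure_eq_measure)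
  finally have 1: "(\<integral>\<^sup>+t. ennreal (gamma_dens b t) * newton_mix_smooth (2 / s * t) x \<partial>haar) = ennreal (newton_mix_const DIM('a) * psi a b w s)"
    using K B.cdf_nonneg by (simp add: ennreal_mult[symmetric] K_def psi_def mult.assoc)
  show ?thesis
    unfolding nn_integral_normal_dens_haar[OF v] using v 1
    by (simp add: nn_integral_normal_dens_haar_eq a_def b_def w_def s_def)
qed

lemma psi_pos: "a > 0 \<Longrightarrow> b > 0 \<Longrightarrow> w > 0 \<Longrightarrow> s \<ge> 0 \<Longrightarrow> psi a b w s > 0"
  unfolding psi_def by (intro mult_pos_pos cdf_beta_law_pos) auto

lemma psi_strict_antimono:
  assumes "a > 0" "b > 0" "w > 0" "0 < s" "s < s'"
  shows "psi a b w s' < psi a b w s"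
  unfolding psi_def using assms
  by (intro mult_strict_left_mono cdf_beta_law_strict_mono) (auto simp: field_simps)

text \<open>Up to the positive finite factor \<open>c\<close>, \<psi> is an average of
  \<open>newton_mix_smooth p\<close> over \<open>p\<close> whose weights do not involve the
  location. The bound on normal averages survives this averaging by Tonelli.\<close>

lemma psi_superharmonic:
  fixes x :: "'a::euclidean_space" and v :: "'b::euclidean_space"
  assumes d: "DIM('a) \<ge> 3" and x: "x \<noteq> 0" and v: "v \<noteq> 0" and r: "r > 0"
  shows "(\<integral>\<^sup>+z. ennreal (normal_dens r (z - x)) * ennreal (psi (real DIM('a) / 2 - 1) (real DIM('b) / 2) ((norm z)\<^sup>2) ((norm v)\<^sup>2)) \<partial>lborel)
    \<le> ennreal (psi (real DIM('a) / 2 - 1) (real DIM('b) / 2) ((norm x)\<^sup>2) ((norm v)\<^sup>2))"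
proof -
  define a b s where "a = real DIM('a) / 2 - 1" and "b = real DIM('b) / 2" and "s = (norm v)\<^sup>2"
  have pos: "a > 0" "b > 0" using d by (auto simp: a_def b_def)
  note [measurable] = cdf_beta_law_measurable[OF pos]
  define c where "c = (\<integral>\<^sup>+p. ennreal (normal_dens p v) \<partial>haar) * ennreal (newton_mix_const DIM('a))"
  have c: "c \<noteq> 0" "c \<noteq> \<top>"
    using v d newton_mix_const_pos[of "DIM('a)"]
    by (auto simp: c_def nn_integral_normal_dens_haar ennreal_mult_eq_top_iff ennreal_eq_0_iff mult_le_0_iff not_le Gamma_real_pos)
  have eq: "(\<integral>\<^sup>+p. ennreal (normal_dens p v) * newton_mix_smooth p z \<partial>haar) = c * ennreal (psi a b ((norm z)\<^sup>2) s)" if "z \<noteq> 0" for z :: 'a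
    using nn_integral_normal_dens_newton_mix_smooth[OF d that v] newton_mix_const_pos[OF d] pos
    by (simp add: ennreal_mult' c_def a_def b_def s_def mult.assoc)
  have "c * (\<integral>\<^sup>+z. ennreal (normal_dens r (z - x)) * ennreal (psi a b ((norm z)\<^sup>2) s) \<partial>lborel)
    = (\<integral>\<^sup>+z. c * (ennreal (normal_dens r (z - x)) * ennreal (psi a b ((norm z)\<^sup>2) s)) \<partial>lborel)"
    unfolding psi_def by (subst nn_integral_cmult) auto
  also have "\<dots> = (\<integral>\<^sup>+z. \<integral>\<^sup>+p. ennreal (normal_dens r (z - x)) * (ennreal (normal_dens p v) * newton_mix_smooth p z) \<partial>haar \<partial>lborel)"
  proof (rule nn_integral_cong_AE, use AE_lborel_singleton[of "0::'a"] in eventually_elim, goal_cases)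
    case _: (1 z)
    have "(\<integral>\<^sup>+p. ennreal (normal_dens r (z - x)) * (ennreal (normal_dens p v) * newton_mix_smooth p z) \<partial>haar)
      = ennreal (normal_dens r (z - x)) * (\<integral>\<^sup>+p. ennreal (normal_dens p v) * newton_mix_smooth p z \<partial>haar)"
      by (rule nn_integral_cmult) measurable
    thus ?case
      unfolding eq[OF \<open>z \<noteq> 0\<close>] by (simp add: mult.left_commute)
  qed
  also have "\<dots> = (\<integral>\<^sup>+p. \<integral>\<^sup>+z. ennreal (normal_dens r (z - x)) * (ennreal (normal_dens p v) * newton_mix_smooth p z) \<partial>lborel \<partial>haar)"
    by (rule nn_integral_swap_lborel_haar) measurable
  also have "\<dots> = (\<integral>\<^sup>+p. ennreal (normal_dens p v) * (\<integral>\<^sup>+z. ennreal (normal_dens r (z - x)) * newton_mix_smooth p z \<partial>lborel) \<partial>haar)"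
    by (simp add: nn_integral_cmult[symmetric] mult_ac)
  also have "\<dots> \<le> (\<integral>\<^sup>+p. ennreal (normal_dens p v) * newton_mix_smooth p x \<partial>haar)"
    using r by (intro nn_integral_haar_mono mult_left_mono newton_mix_smooth_superharmonic) auto
  also have "\<dots> = c * ennreal (psi a b ((norm x)\<^sup>2) s)" by (rule eq[OF x])
  finally show ?thesis
    using c by (simp add: ennreal_mult_le_mult_iff a_def b_def s_def)
qed

section \<open>Radial laws\<close>

text \<open>Inserting \<open>1 = \<integral> s \<parallel>x\<parallel>\<^sup>2 exp(-s \<parallel>x\<parallel>\<^sup>2) ds/s\<close> and rescaling \<open>x\<close> by \<open>s powr (-1/2)\<close> replaces polar coordinates.\<close>

lemma nn_integral_radial_homogeneous:
  fixes m :: "'a::euclidean_space \<Rightarrow> real"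
  assumes [measurable]: "m \<in> borel_measurable borel"
    and nonneg: "\<And>x. m x \<ge> 0" and hom: "\<And>c x. c > 0 \<Longrightarrow> m (c *\<^sub>R x) = c ^ n * m x"
  shows "\<exists>C. \<forall>g\<in>borel_measurable borel.
    (\<integral>\<^sup>+x. g ((norm x)\<^sup>2) * ennreal (m x) \<partial>lborel) = C * (\<integral>\<^sup>+t. ennreal (t powr ((real n + real DIM('a)) / 2)) * g t \<partial>haar)"
proof -
  define q where "q = (real n + real DIM('a)) / 2"
  define e where "e x = m x * (norm x)\<^sup>2 * exp (- (norm x)\<^sup>2)" for x
  have [measurable]: "e \<in> borel_measurable borel" unfolding e_def by measurable
  have e_nonneg: "e x \<ge> 0" for x using nonneg by (simp add: e_def)
  define C where "C = (\<integral>\<^sup>+y. ennreal (e y * ((norm y)\<^sup>2) powr (- q)) \<partial>lborel)"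
  have "(\<integral>\<^sup>+x. g ((norm x)\<^sup>2) * ennreal (m x) \<partial>lborel) = C * (\<integral>\<^sup>+t. ennreal (t powr q) * g t \<partial>haar)"
    if [measurable]: "g \<in> borel_measurable borel" for g
  proof -
    have "(\<integral>\<^sup>+x. g ((norm x)\<^sup>2) * ennreal (m x) \<partial>lborel) =
      (\<integral>\<^sup>+x. \<integral>\<^sup>+s. g ((norm x)\<^sup>2) * ennreal (m x * (s * (norm x)\<^sup>2 * exp (- (s * (norm x)\<^sup>2)))) \<partial>haar \<partial>lborel)"
    proof (rule nn_integral_cong_AE, use AE_lborel_singleton[of "0::'a"] in eventually_elim, goal_cases)
      case x: (1 x)
      define w where "w = (norm x)\<^sup>2"
      have w: "w > 0" using x by (simp add: w_def)
      have "(\<integral>\<^sup>+s. g w * ennreal (m x * (s * w * exp (- (s * w)))) \<partial>haar)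
        = (\<integral>\<^sup>+s. g w * ennreal (m x * w) * ennreal (s powr 1 * exp (- (w * s))) \<partial>haar)"
        using nonneg[of x] w by (intro nn_integral_haar_cong) (simp add: ennreal_mult[symmetric] mult_ac)
      also have "\<dots> = g w * ennreal (m x * w) * ennreal (1 / w)"
        using nn_integral_haar_Gamma[of 1 w] w by (subst nn_integral_cmult) simp_all
      also have "\<dots> = g w * ennreal (m x)"
        using w nonneg[of x] by (simp add: mult.assoc ennreal_mult[symmetric])
      finally show ?case
        by (simp add: w_def)
    qed
    also have "\<dots> = (\<integral>\<^sup>+s. \<integral>\<^sup>+x. g ((norm x)\<^sup>2) * ennreal (m x * (s * (norm x)\<^sup>2 * exp (- (s * (norm x)\<^sup>2)))) \<partial>lborel \<partial>haar)"
      by (rule nn_integral_swap_lborel_haar) measurable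
    also have "\<dots> = (\<integral>\<^sup>+s. \<integral>\<^sup>+y. ennreal (e y) * (ennreal (inverse s powr q) * g ((norm y)\<^sup>2 * inverse s)) \<partial>lborel \<partial>haar)"
    proof (rule nn_integral_haar_cong, goal_cases)
      case s: (1 s)
      define c where "c = 1 / sqrt s"
      have c: "c > 0" "c\<^sup>2 = inverse s" using s by (auto simp: c_def power_divide field_simps)
      have cn: "(norm (c *\<^sub>R y))\<^sup>2 = (norm y)\<^sup>2 * inverse s" for y :: 'a
        using c by (simp add: power_mult_distrib mult.commute)
      have cq: "c ^ DIM('a) * c ^ n = inverse s powr q"
      proof -
        have "inverse s powr q = (c powr 2) powr q" using c by simp
        also have "\<dots> = c powr (real (DIM('a) + n))" 
          by (simp add: powr_powr q_def add_divide_distrib distrib_left add.commute)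
        also have "\<dots> = c ^ (DIM('a) + n)" using c by (subst powr_realpow) auto
        finally show ?thesis by (simp add: power_add)
      qed
      have "(\<integral>\<^sup>+x. g ((norm x)\<^sup>2) * ennreal (m x * (s * (norm x)\<^sup>2 * exp (- (s * (norm x)\<^sup>2)))) \<partial>lborel)
        = ennreal (c ^ DIM('a)) * (\<integral>\<^sup>+y. g ((norm (c *\<^sub>R y))\<^sup>2) *
            ennreal (m (c *\<^sub>R y) * (s * (norm (c *\<^sub>R y))\<^sup>2 * exp (- (s * (norm (c *\<^sub>R y))\<^sup>2)))) \<partial>lborel)"
        using c by (intro nn_integral_lborel_scale) auto
      also have "\<dots> = (\<integral>\<^sup>+y. ennreal (c ^ DIM('a)) * (g ((norm (c *\<^sub>R y))\<^sup>2) *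
            ennreal (m (c *\<^sub>R y) * (s * (norm (c *\<^sub>R y))\<^sup>2 * exp (- (s * (norm (c *\<^sub>R y))\<^sup>2))))) \<partial>lborel)"
        by (rule nn_integral_cmult[symmetric]) measurable
      also have "\<dots> = (\<integral>\<^sup>+y. ennreal (e y) * (ennreal (inverse s powr q) * g ((norm y)\<^sup>2 * inverse s)) \<partial>lborel)"
      proof (rule nn_integral_cong, goal_cases)
        case _: (1 y)
        have "m (c *\<^sub>R y) * (s * (norm (c *\<^sub>R y))\<^sup>2 * exp (- (s * (norm (c *\<^sub>R y))\<^sup>2))) = c ^ n * e y"
        proof -
          have "s * (norm (c *\<^sub>R y))\<^sup>2 = (norm y)\<^sup>2" unfolding cn using s by simp
          thus ?thesis by (simp add: hom[OF c(1)] e_def)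
        qed
        moreover have "ennreal (c ^ DIM('a)) * (g t * ennreal (c ^ n * e y)) = ennreal (e y) * (ennreal (c ^ DIM('a) * c ^ n) * g t)" for t
          using c e_nonneg[of y] by (simp add: ennreal_mult mult_ac)
        ultimately show ?case
          unfolding cq cn by simp
      qed
      finally show ?case .
    qed
    also have "\<dots> = (\<integral>\<^sup>+y. \<integral>\<^sup>+s. ennreal (e y) * (ennreal (inverse s powr q) * g ((norm y)\<^sup>2 * inverse s)) \<partial>haar \<partial>lborel)"
      by (rule nn_integral_swap_lborel_haar[symmetric]) measurable
    also have "\<dots> = (\<integral>\<^sup>+y. ennreal (e y * ((norm y)\<^sup>2) powr (- q)) * (\<integral>\<^sup>+t. ennreal (t powr q) * g t \<partial>haar) \<partial>lborel)"
    proof (rule nn_integral_cong_AE, use AE_lborel_singleton[of "0::'a"] in eventually_elim, goal_cases)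
      case y: (1 y)
      define w where "w = (norm y)\<^sup>2"
      have w: "w > 0" using y by (simp add: w_def)
      have "(\<integral>\<^sup>+s. ennreal (e y) * (ennreal (inverse s powr q) * g (w * inverse s)) \<partial>haar)
        = (\<integral>\<^sup>+s. ennreal (e y) * (ennreal (s powr q) * g (w * s)) \<partial>haar)"
        by (rule nn_integral_haar_inverse[of "\<lambda>s. ennreal (e y) * (ennreal (s powr q) * g (w * s))"]) measurable
      also have "\<dots> = (\<integral>\<^sup>+s. ennreal (e y * w powr (- q)) * (ennreal ((w * s) powr q) * g (w * s)) \<partial>haar)"
        using w e_nonneg[of y]
        by (intro nn_integral_haar_cong)
          (simp add: mult.assoc[symmetric] ennreal_mult[symmetric] powr_mult powr_minus_divide)
      also have "\<dots> = (\<integral>\<^sup>+s. ennreal (e y * w powr (- q)) * (ennreal (s powr q) * g s) \<partial>haar)"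
        using w by (intro nn_integral_haar_scale[of "\<lambda>s. ennreal (e y * w powr (- q)) * (ennreal (s powr q) * g s)"]) auto
      also have "\<dots> = ennreal (e y * w powr (- q)) * (\<integral>\<^sup>+s. ennreal (s powr q) * g s \<partial>haar)"
        by (rule nn_integral_cmult) measurable
      finally show ?case
        by (simp add: w_def)
    qed
    also have "\<dots> = C * (\<integral>\<^sup>+t. ennreal (t powr q) * g t \<partial>haar)"
      unfolding C_def by (rule nn_integral_multc) measurable
    finally show ?thesis .
  qed
  thus ?thesis unfolding q_def by blast
qed

text \<open>The weights \<open>P\<close> are in fact Poisson weights on the even \<open>n\<close>, but only their independence of \<open>g\<close> matters.\<close>

lemma nn_integral_normal_dens_radial:
  fixes \<theta> :: "'a::euclidean_space"
  assumes p: "p > 0"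
  shows "\<exists>P :: nat \<Rightarrow> ennreal. \<forall>g\<in>borel_measurable borel.
    (\<integral>\<^sup>+x. g (p * (norm x)\<^sup>2 / 2) * ennreal (normal_dens p (x - \<theta>)) \<partial>lborel)
    = (\<Sum>n. P n * (\<integral>\<^sup>+t. ennreal (gamma_dens ((real n + real DIM('a)) / 2) t) * g t \<partial>haar))"
proof -
  \<comment> \<open>The Taylor terms of cosh: they are nonnegative, and \<open>m n\<close> is
    homogeneous of degree \<open>n\<close> in \<open>x\<close>, so the lemma on homogeneous weights
    applies to each of them. The Taylor terms of exp would change sign.\<close>
  define k where "k n y = (if even n then y ^ n /\<^sub>R fact n else 0)" for n and y :: real
  define m where "m n x = k n (p * (x \<bullet> \<theta>))" for n and x :: 'a
  have k_nonneg: "k n y \<ge> 0" for n y by (simp add: k_def zero_le_even_power)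
  have [measurable]: "k n \<in> borel_measurable borel" for n unfolding k_def by measurable
  have [measurable]: "m n \<in> borel_measurable borel" for n unfolding m_def by measurable
  have m_hom: "m n (c *\<^sub>R x) = c ^ n * m n x" for n c x
    by (simp add: m_def k_def power_mult_distrib mult.left_commute)
  have ex: "\<forall>n. \<exists>C. \<forall>g\<in>borel_measurable borel. (\<integral>\<^sup>+x. g ((norm x)\<^sup>2) * ennreal (m n x) \<partial>lborel)
     = C * (\<integral>\<^sup>+t. ennreal (t powr ((real n + real DIM('a)) / 2)) * g t \<partial>haar)"
    by (intro allI nn_integral_radial_homogeneous) (use k_nonneg m_hom in \<open>auto simp: m_def\<close>)
  from choice[OF ex] obtain C where C: "\<forall>n. \<forall>g\<in>borel_measurable borel. (\<integral>\<^sup>+x. g ((norm x)\<^sup>2) * ennreal (m n x) \<partial>lborel)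
     = C n * (\<integral>\<^sup>+t. ennreal (t powr ((real n + real DIM('a)) / 2)) * g t \<partial>haar)"
    by (elim exE)
  define A where "A = (p / (2 * pi)) powr (real DIM('a) / 2) * exp (- (p * (norm \<theta>)\<^sup>2 / 2))"
  have A: "A > 0" using p by (simp add: A_def)
  have normal_dens_exp: "normal_dens p (x - \<theta>) = A * exp (- (p * (norm x)\<^sup>2 / 2)) * exp (p * (x \<bullet> \<theta>))" for x
  proof -
    have "(norm (x - \<theta>))\<^sup>2 = (norm x)\<^sup>2 - 2 * (x \<bullet> \<theta>) + (norm \<theta>)\<^sup>2"
      by (simp add: power2_norm_eq_inner inner_diff_left inner_diff_right inner_commute)
    thus ?thesis
      by (simp add: normal_dens_def A_def exp_add[symmetric] right_diff_distrib distrib_left add_divide_distrib diff_divide_distrib)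
  qed
  define P where "P n = C n * ennreal (A * (2 / p) powr ((real n + real DIM('a)) / 2) * Gamma ((real n + real DIM('a)) / 2))" for n
  have "(\<integral>\<^sup>+x. g (p * (norm x)\<^sup>2 / 2) * ennreal (normal_dens p (x - \<theta>)) \<partial>lborel)
    = (\<Sum>n. P n * (\<integral>\<^sup>+t. ennreal (gamma_dens ((real n + real DIM('a)) / 2) t) * g t \<partial>haar))"
    if [measurable]: "g \<in> borel_measurable borel" for g
  proof -
    define F where "F x = g (p * x / 2) * ennreal (A * exp (- (p * x / 2)))" for x
    have [measurable]: "F \<in> borel_measurable borel" unfolding F_def by measurable
    \<comment> \<open>Reflection of \<open>x\<close> leaves the radial factor unchanged and
      exchanges the two exponentials; half of each together make the cosh.\<close>
    define J where "J s = (\<integral>\<^sup>+x. F ((norm x)\<^sup>2) * ennreal (exp (s * (p * (x \<bullet> \<theta>))) / 2) \<partial>lborel)" for s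
    have J: "J (- 1) = J 1"
      using nn_integral_lborel_reflect[of "\<lambda>x. F ((norm x)\<^sup>2) * ennreal (exp (p * (x \<bullet> \<theta>)) / 2)"]
      by (simp add: J_def)
    have "(\<integral>\<^sup>+x. g (p * (norm x)\<^sup>2 / 2) * ennreal (normal_dens p (x - \<theta>)) \<partial>lborel)
      = (\<integral>\<^sup>+x. F ((norm x)\<^sup>2) * ennreal (exp (1 * (p * (x \<bullet> \<theta>))) / 2) + F ((norm x)\<^sup>2) * ennreal (exp (1 * (p * (x \<bullet> \<theta>))) / 2) \<partial>lborel)"
      unfolding F_def using A
      by (intro nn_integral_cong) (simp add: normal_dens_exp mult.assoc distrib_left[symmetric] ennreal_mult[symmetric] ennreal_plus[symmetric] del: ennreal_plus, simp add: mult_ac)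
    also have "\<dots> = J 1 + J 1"
      unfolding J_def by (rule nn_integral_add) measurable
    also have "\<dots> = J 1 + J (- 1)" by (simp add: J)
    also have "\<dots> = (\<integral>\<^sup>+x. F ((norm x)\<^sup>2) * ennreal (exp (1 * (p * (x \<bullet> \<theta>))) / 2) + F ((norm x)\<^sup>2) * ennreal (exp (- 1 * (p * (x \<bullet> \<theta>))) / 2) \<partial>lborel)"
      unfolding J_def by (rule nn_integral_add[symmetric]) measurable
    also have "\<dots> = (\<integral>\<^sup>+x. (\<Sum>n. F ((norm x)\<^sup>2) * ennreal (m n x)) \<partial>lborel)"
    proof (rule nn_integral_cong, goal_cases)
      case _: (1 x)
      have "(\<lambda>n. m n x) sums cosh (p * (x \<bullet> \<theta>))"
        unfolding m_def k_def by (rule cosh_converges)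
      hence "(\<Sum>n. ennreal (m n x)) = ennreal (cosh (p * (x \<bullet> \<theta>)))"
        using k_nonneg by (intro suminf_ennreal_eq) (auto simp: m_def)
      thus ?case
        by (simp add: distrib_left[symmetric] ennreal_plus[symmetric] cosh_def add_divide_distrib del: ennreal_plus)
    qed
    also have "\<dots> = (\<Sum>n. \<integral>\<^sup>+x. F ((norm x)\<^sup>2) * ennreal (m n x) \<partial>lborel)"
      by (rule nn_integral_suminf) measurable
    also have "\<dots> = (\<Sum>n. P n * (\<integral>\<^sup>+t. ennreal (gamma_dens ((real n + real DIM('a)) / 2) t) * g t \<partial>haar))"
    proof (rule arg_cong[of _ _ suminf], rule ext)
      fix n
      define q where "q = (real n + real DIM('a)) / 2"
      have q: "q > 0" by (simp add: q_def add_nonneg_pos)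
      have "(\<integral>\<^sup>+x. F ((norm x)\<^sup>2) * ennreal (m n x) \<partial>lborel) = C n * (\<integral>\<^sup>+t. ennreal (t powr q) * F t \<partial>haar)"
        unfolding q_def by (rule C[rule_format]) measurable
      also have "(\<integral>\<^sup>+t. ennreal (t powr q) * F t \<partial>haar) = (\<integral>\<^sup>+t. ennreal ((2 / p * t) powr q) * F (2 / p * t) \<partial>haar)"
        using p by (intro nn_integral_haar_scale[symmetric]) auto
      also have "\<dots> = (\<integral>\<^sup>+t. ennreal (A * (2 / p) powr q * Gamma q) * (ennreal (gamma_dens q t) * g t) \<partial>haar)"
      proof (rule nn_integral_haar_cong, goal_cases)
        case t: (1 t)
        have "(2 / p * t) powr q * (A * exp (- (p * (2 / p * t) / 2))) = A * (2 / p) powr q * Gamma q * gamma_dens q t"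
          using p t q powr_mult[of "2 / p" t q] by (simp add: gamma_dens_def Gamma_real_neq_0)
        note e = this
        have "ennreal (A * (2 / p) powr q * Gamma q) * (ennreal (gamma_dens q t) * g t) = ennreal (A * (2 / p) powr q * Gamma q * gamma_dens q t) * g t"
          using A q by (simp add: ennreal_mult Gamma_real_nonneg mult.assoc)
        also have "\<dots> = ennreal ((2 / p * t) powr q * (A * exp (- (p * (2 / p * t) / 2)))) * g t"
          by (simp only: e)
        also have "\<dots> = ennreal ((2 / p * t) powr q) * F (2 / p * t)"
          using p A by (simp add: F_def ennreal_mult mult_ac)
        finally show ?case
          by simp
      qed
      also have "\<dots> = ennreal (A * (2 / p) powr q * Gamma q) * (\<integral>\<^sup>+t. ennreal (gamma_dens q t) * g t \<partial>haar)"
        by (rule nn_integral_cmult) measurable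
      finally show "(\<integral>\<^sup>+x. F ((norm x)\<^sup>2) * ennreal (m n x) \<partial>lborel)
        = P n * (\<integral>\<^sup>+t. ennreal (gamma_dens ((real n + real DIM('a)) / 2) t) * g t \<partial>haar)"
        by (simp add: P_def q_def mult.assoc)
    qed
    finally show ?thesis .
  qed
  thus ?thesis by blast
qed

text \<open>The homogeneous weight is constant here. The remaining constant is found without any
  computation of sphere areas: testing with \<open>g = 1\<close> shows it to be one, as both sides
  are integrals of probability densities.\<close>

lemma nn_integral_normal_dens_radial_central:
  assumes p: "p > 0" and [measurable]: "g \<in> borel_measurable borel"
  shows "(\<integral>\<^sup>+x. g (p * (norm x)\<^sup>2 / 2) * ennreal (normal_dens p (x::'a::euclidean_space)) \<partial>lborel)
    = (\<integral>\<^sup>+t. ennreal (gamma_dens (real DIM('a) / 2) t) * g t \<partial>haar)"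
proof -
  define q where "q = real DIM('a) / 2"
  have q: "q > 0" by (simp add: q_def)
  obtain C :: ennreal where C: "\<forall>g\<in>borel_measurable borel.
    (\<integral>\<^sup>+x. g ((norm x)\<^sup>2) * ennreal 1 \<partial>(lborel :: 'a measure)) = C * (\<integral>\<^sup>+t. ennreal (t powr ((real 0 + real DIM('a)) / 2)) * g t \<partial>haar)"
    using nn_integral_radial_homogeneous[of "\<lambda>x::'a. 1" 0] by auto
  define B where "B = (p / (2 * pi)) powr q * (2 / p) powr q * Gamma q"
  have *: "(\<integral>\<^sup>+x. g (p * (norm x)\<^sup>2 / 2) * ennreal (normal_dens p (x::'a)) \<partial>lborel)
    = C * ennreal B * (\<integral>\<^sup>+t. ennreal (gamma_dens q t) * g t \<partial>haar)"
    if [measurable]: "g \<in> borel_measurable borel" for g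
  proof -
    define F where "F t = g (p * t / 2) * ennreal ((p / (2 * pi)) powr q * exp (- (p * t / 2)))" for t
    have [measurable]: "F \<in> borel_measurable borel" unfolding F_def by measurable
    have "(\<integral>\<^sup>+x. g (p * (norm x)\<^sup>2 / 2) * ennreal (normal_dens p (x::'a)) \<partial>lborel) = (\<integral>\<^sup>+x. F ((norm x)\<^sup>2) * ennreal 1 \<partial>(lborel :: 'a measure))"
      by (simp add: F_def normal_dens_def q_def)
    also have "\<dots> = C * (\<integral>\<^sup>+t. ennreal (t powr q) * F t \<partial>haar)"
      by (subst C[rule_format]) (auto simp: q_def)
    also have "(\<integral>\<^sup>+t. ennreal (t powr q) * F t \<partial>haar) = (\<integral>\<^sup>+t. ennreal ((2 / p * t) powr q) * F (2 / p * t) \<partial>haar)"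
      using p by (intro nn_integral_haar_scale[symmetric]) auto
    also have "\<dots> = (\<integral>\<^sup>+t. ennreal B * (ennreal (gamma_dens q t) * g t) \<partial>haar)"
    proof (rule nn_integral_haar_cong, goal_cases)
      case t: (1 t)
      have "(2 / p * t) powr q * ((p / (2 * pi)) powr q * exp (- (p * (2 / p * t) / 2))) = B * gamma_dens q t"
        using p t q powr_mult[of "2 / p" t q] by (simp add: gamma_dens_def B_def Gamma_real_neq_0)
      note e = this
      have "ennreal B * (ennreal (gamma_dens q t) * g t) = ennreal (B * gamma_dens q t) * g t"
        using p q by (simp add: B_def ennreal_mult Gamma_real_nonneg mult.assoc)
      also have "\<dots> = ennreal ((2 / p * t) powr q * ((p / (2 * pi)) powr q * exp (- (p * (2 / p * t) / 2)))) * g t"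
        by (simp only: e)
      also have "\<dots> = ennreal ((2 / p * t) powr q) * F (2 / p * t)"
        using p by (simp add: F_def ennreal_mult mult_ac)
      finally show ?case
        by simp
    qed
    also have "\<dots> = ennreal B * (\<integral>\<^sup>+t. ennreal (gamma_dens q t) * g t \<partial>haar)"
      by (rule nn_integral_cmult) measurable
    finally show ?thesis by (simp add: mult.assoc)
  qed
  have "C * ennreal B = 1"
    using *[of "\<lambda>_. 1"] nn_integral_normal_dens[OF p, where 'a='a] nn_integral_gamma_dens[OF q] by simp
  thus ?thesis using *[OF assms(2)] by (simp add: q_def)
qed

text \<open>In the \<open>n\<close>-th component of the mixture,
  \<open>p * (norm x)\<^sup>2 / 2\<close> has a gamma law of shape \<open>a + (1 + n / 2)\<close>,
  and \<open>p * (norm v)\<^sup>2 / 2\<close> one of shape \<open>b\<close>. Hence the argument of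
  the distribution function follows the beta law with parameters \<open>a + q\<close> and
  \<open>b\<close>, where \<open>q = 1 + n / 2\<close>. The weights \<open>P\<close> are the same
  for both residual dimensions, so the comparison is made term by term.\<close>

lemma nn_integral_normal_dens_neg_ln_cdf:
  fixes \<theta> :: "'a::euclidean_space"
  assumes d: "DIM('a) \<ge> 3" and p: "p > 0" and le: "DIM('b::euclidean_space) \<le> DIM('c::euclidean_space)"
  defines "h \<equiv> \<lambda>b w s. ennreal (- ln (cdf (beta_law (real DIM('a) / 2 - 1) b) (w / (w + s))))"
  shows "(\<integral>\<^sup>+x. (\<integral>\<^sup>+v. h (real DIM('c) / 2) ((norm x)\<^sup>2) ((norm v)\<^sup>2) * ennreal (normal_dens p (v::'c)) \<partial>lborel) * ennreal (normal_dens p (x - \<theta>)) \<partial>lborel)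
    \<le> (\<integral>\<^sup>+x. (\<integral>\<^sup>+v. h (real DIM('b) / 2) ((norm x)\<^sup>2) ((norm v)\<^sup>2) * ennreal (normal_dens p (v::'b)) \<partial>lborel) * ennreal (normal_dens p (x - \<theta>)) \<partial>lborel)"
proof -
  define a where "a = real DIM('a) / 2 - 1"
  have a: "a > 0" using d by (simp add: a_def)
  define \<Phi> where "\<Phi> b z = ennreal (- ln (cdf (beta_law a b) z))" for b z
  have \<Phi>_meas: "\<Phi> b \<in> borel_measurable borel" if "b > 0" for b
    unfolding \<Phi>_def using cdf_beta_law_measurable[OF a that] by measurable
  obtain P :: "nat \<Rightarrow> ennreal" where P: "\<forall>g\<in>borel_measurable borel.
    (\<integral>\<^sup>+x. g (p * (norm x)\<^sup>2 / 2) * ennreal (normal_dens p (x - \<theta>)) \<partial>lborel)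
    = (\<Sum>n. P n * (\<integral>\<^sup>+t. ennreal (gamma_dens ((real n + real DIM('a)) / 2) t) * g t \<partial>haar))"
    using nn_integral_normal_dens_radial[OF p, of \<theta>] by blast
  have outer: "(\<integral>\<^sup>+x. (\<integral>\<^sup>+t. ennreal (gamma_dens b t) * \<Phi> b (p * (norm x)\<^sup>2 / 2 / (p * (norm x)\<^sup>2 / 2 + t)) \<partial>haar) * ennreal (normal_dens p (x - \<theta>)) \<partial>lborel)
    = (\<Sum>n. P n * (\<integral>\<^sup>+z. \<Phi> b z \<partial>beta_law (a + (1 + real n / 2)) b))" if b: "b > 0" for b
  proof -
    note [measurable] = \<Phi>_meas[OF b]
    define G where "G u = (\<integral>\<^sup>+t. ennreal (gamma_dens b t) * \<Phi> b (u / (u + t)) \<partial>haar)" for u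
    have [measurable]: "G \<in> borel_measurable borel" unfolding G_def by measurable
    have "(\<integral>\<^sup>+x. G (p * (norm x)\<^sup>2 / 2) * ennreal (normal_dens p (x - \<theta>)) \<partial>lborel)
      = (\<Sum>n. P n * (\<integral>\<^sup>+t. ennreal (gamma_dens ((real n + real DIM('a)) / 2) t) * G t \<partial>haar))"
      by (rule P[rule_format]) measurable
    also have "\<dots> = (\<Sum>n. P n * (\<integral>\<^sup>+z. \<Phi> b z \<partial>beta_law (a + (1 + real n / 2)) b))"
    proof (rule arg_cong[of _ _ suminf], rule ext)
      fix n
      have q: "(real n + real DIM('a)) / 2 = a + (1 + real n / 2)"
        by (simp add: a_def add_divide_distrib)
      have "(\<integral>\<^sup>+t. ennreal (gamma_dens ((real n + real DIM('a)) / 2) t) * G t \<partial>haar)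
        = (\<integral>\<^sup>+u. \<integral>\<^sup>+t. ennreal (gamma_dens (a + (1 + real n / 2)) u) * ennreal (gamma_dens b t) * \<Phi> b (u / (u + t)) \<partial>haar \<partial>haar)"
        unfolding q G_def by (simp add: nn_integral_cmult[symmetric] mult.assoc)
      also have "\<dots> = (\<integral>\<^sup>+z. ennreal (beta_dens (a + (1 + real n / 2)) b z) * \<Phi> b z \<partial>haar)"
        using a b by (intro nn_integral_gamma_dens_gamma_dens) auto
      also have "\<dots> = (\<integral>\<^sup>+z. \<Phi> b z \<partial>beta_law (a + (1 + real n / 2)) b)"
        by (rule nn_integral_beta_law[symmetric]) measurable
      finally show "P n * (\<integral>\<^sup>+t. ennreal (gamma_dens ((real n + real DIM('a)) / 2) t) * G t \<partial>haar)
        = P n * (\<integral>\<^sup>+z. \<Phi> b z \<partial>beta_law (a + (1 + real n / 2)) b)" by simp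
    qed
    finally show ?thesis unfolding G_def .
  qed
  have inner_arg: "w / (w + s) = p * w / 2 / (p * w / 2 + p * s / 2)" for w s
  proof -
    have "p * w / 2 / (p * w / 2 + p * s / 2) = (p / 2 * w) / (p / 2 * (w + s))"
      by (simp add: distrib_left add_divide_distrib)
    thus ?thesis using p by simp
  qed
  have innerc: "(\<integral>\<^sup>+v. h (real DIM('c) / 2) w ((norm v)\<^sup>2) * ennreal (normal_dens p (v::'c)) \<partial>lborel)
     = (\<integral>\<^sup>+t. ennreal (gamma_dens (real DIM('c) / 2) t) * \<Phi> (real DIM('c) / 2) (p * w / 2 / (p * w / 2 + t)) \<partial>haar)" for w
  proof -
    note [measurable] = \<Phi>_meas[of "real DIM('c) / 2", simplified]
    have "(\<integral>\<^sup>+v. h (real DIM('c) / 2) w ((norm v)\<^sup>2) * ennreal (normal_dens p (v::'c)) \<partial>lborel)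
      = (\<integral>\<^sup>+v. \<Phi> (real DIM('c) / 2) (p * w / 2 / (p * w / 2 + p * (norm v)\<^sup>2 / 2)) * ennreal (normal_dens p (v::'c)) \<partial>lborel)"
      unfolding inner_arg[symmetric] h_def \<Phi>_def a_def by (rule refl)
    also have "\<dots> = (\<integral>\<^sup>+t. ennreal (gamma_dens (real DIM('c) / 2) t) * \<Phi> (real DIM('c) / 2) (p * w / 2 / (p * w / 2 + t)) \<partial>haar)"
      by (rule nn_integral_normal_dens_radial_central[OF p, of "\<lambda>t. \<Phi> (real DIM('c) / 2) (p * w / 2 / (p * w / 2 + t))"]) measurable
    finally show ?thesis .
  qed
  have innerb: "(\<integral>\<^sup>+v. h (real DIM('b) / 2) w ((norm v)\<^sup>2) * ennreal (normal_dens p (v::'b)) \<partial>lborel)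
     = (\<integral>\<^sup>+t. ennreal (gamma_dens (real DIM('b) / 2) t) * \<Phi> (real DIM('b) / 2) (p * w / 2 / (p * w / 2 + t)) \<partial>haar)" for w
  proof -
    note [measurable] = \<Phi>_meas[of "real DIM('b) / 2", simplified]
    have "(\<integral>\<^sup>+v. h (real DIM('b) / 2) w ((norm v)\<^sup>2) * ennreal (normal_dens p (v::'b)) \<partial>lborel)
      = (\<integral>\<^sup>+v. \<Phi> (real DIM('b) / 2) (p * w / 2 / (p * w / 2 + p * (norm v)\<^sup>2 / 2)) * ennreal (normal_dens p (v::'b)) \<partial>lborel)"
      unfolding inner_arg[symmetric] h_def \<Phi>_def a_def by (rule refl)
    also have "\<dots> = (\<integral>\<^sup>+t. ennreal (gamma_dens (real DIM('b) / 2) t) * \<Phi> (real DIM('b) / 2) (p * w / 2 / (p * w / 2 + t)) \<partial>haar)"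
      by (rule nn_integral_normal_dens_radial_central[OF p, of "\<lambda>t. \<Phi> (real DIM('b) / 2) (p * w / 2 / (p * w / 2 + t))"]) measurable
    finally show ?thesis .
  qed
  have "(\<Sum>n. P n * (\<integral>\<^sup>+z. \<Phi> (real DIM('c) / 2) z \<partial>beta_law (a + (1 + real n / 2)) (real DIM('c) / 2)))
    \<le> (\<Sum>n. P n * (\<integral>\<^sup>+z. \<Phi> (real DIM('b) / 2) z \<partial>beta_law (a + (1 + real n / 2)) (real DIM('b) / 2)))"
    using a le unfolding \<Phi>_def
    by (intro suminf_le mult_left_mono expected_neg_ln_cdf_beta_law_antimono) auto
  moreover have "real DIM('b) / 2 > 0" "real DIM('c) / 2 > 0" by simp_all
  ultimately show ?thesis unfolding innerc innerb by (simp only: outer)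
qed

section \<open>Logarithmic moments of gamma and normal laws\<close>

lemma nn_integral_gamma_dens_abs_ln_finite:
  assumes q: "q > 0"
  shows "(\<integral>\<^sup>+t. ennreal (gamma_dens q t) * ennreal (\<bar>ln t\<bar> + t) \<partial>haar) < \<infinity>"
proof -
  \<comment> \<open>Near 0 the logarithm is dominated by a negative power; the exponent
    \<open>- q / 2\<close> uses up half of the gamma exponent \<open>q\<close>, which keeps the
    integral convergent.\<close>
  have bound: "\<bar>ln t\<bar> + t \<le> 2 / q * t powr (- q / 2) + 2 * t" if t: "t > 0" for t :: real
  proof (cases "t \<ge> 1")
    case True
    hence "\<bar>ln t\<bar> \<le> t" using ln_le_minus_one[of t] by simp
    thus ?thesis using q t by (simp add: add_increasing)
  next
    case False
    have "ln (t powr (- q / 2)) \<le> t powr (- q / 2)"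
      using t ln_le_minus_one[of "t powr (- q / 2)"] by simp
    hence "- ln t \<le> 2 / q * t powr (- q / 2)"
      using t q by (simp add: ln_powr field_simps)
    thus ?thesis using False t by simp
  qed
  have "(\<integral>\<^sup>+t. ennreal (gamma_dens q t) * ennreal (\<bar>ln t\<bar> + t) \<partial>haar)
    \<le> (\<integral>\<^sup>+t. ennreal (2 / q / Gamma q) * ennreal (t powr (q / 2) * exp (- (1 * t))) + ennreal (2 / Gamma q) * ennreal (t powr (q + 1) * exp (- (1 * t))) \<partial>haar)"
  proof (rule nn_integral_haar_mono, goal_cases)
    case t: (1 t)
    have "gamma_dens q t * (\<bar>ln t\<bar> + t) \<le> gamma_dens q t * (2 / q * t powr (- q / 2) + 2 * t)"
      using bound[OF t] q by (intro mult_left_mono) auto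
    also have "\<dots> = 2 / q / Gamma q * (t powr q * t powr (- q / 2) * exp (- t)) + 2 / Gamma q * (t powr q * t * exp (- t))"
      by (simp add: gamma_dens_def distrib_left add_divide_distrib mult_ac)
    also have "t powr q * t powr (- q / 2) = t powr (q / 2)" by (simp add: powr_add[symmetric])
    also have "t powr q * t = t powr (q + 1)" using t by (simp add: powr_add)
    finally show ?case
      using q t by (simp add: ennreal_mult[symmetric] ennreal_plus[symmetric] Gamma_real_nonneg ennreal_leI del: ennreal_plus)
  qed
  also have "\<dots> = ennreal (2 / q / Gamma q) * (\<integral>\<^sup>+t. ennreal (t powr (q / 2) * exp (- (1 * t))) \<partial>haar) + ennreal (2 / Gamma q) * (\<integral>\<^sup>+t. ennreal (t powr (q + 1) * exp (- (1 * t))) \<partial>haar)"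
    by (subst nn_integral_add) (auto simp: nn_integral_cmult)
  also have "\<dots> < \<infinity>"
    using q by (subst (1 2) nn_integral_haar_Gamma) (auto simp: ennreal_mult_less_top)
  finally show ?thesis .
qed

lemma nn_integral_normal_dens_abs_ln_finite:
  fixes \<theta> :: "'a::euclidean_space"
  assumes p: "p > 0"
  shows "(\<integral>\<^sup>+x. ennreal (normal_dens p (x - \<theta>)) * ennreal (\<bar>ln ((norm x)\<^sup>2)\<bar> + (norm x)\<^sup>2) \<partial>lborel) < \<infinity>"
proof -
  \<comment> \<open>Halving the precision absorbs the shift: \<open>(norm x)\<^sup>2 \<le> 2 * (norm
    (x - \<theta>))\<^sup>2 + 2 * (norm \<theta>)\<^sup>2\<close> bounds the shifted density by a
    multiple of a centred one.\<close>
  define r where "r = p / 2"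
  have r: "r > 0" using p by (simp add: r_def)
  define K where "K = 2 powr (real DIM('a) / 2) * exp (p * (norm \<theta>)\<^sup>2 / 2)"
  define B where "B = 1 + \<bar>ln (2 / r)\<bar> + 2 / r"
  have normal_dens_le: "normal_dens p (x - \<theta>) \<le> K * normal_dens r x" for x
  proof -
    have "(norm x)\<^sup>2 \<le> 2 * (norm (x - \<theta>))\<^sup>2 + 2 * (norm \<theta>)\<^sup>2"
    proof -
      have "norm x \<le> norm (x - \<theta>) + norm \<theta>" by (metis diff_add_cancel norm_triangle_ineq)
      hence "(norm x)\<^sup>2 \<le> (norm (x - \<theta>) + norm \<theta>)\<^sup>2" by (intro power_mono) auto
      also have "\<dots> \<le> 2 * (norm (x - \<theta>))\<^sup>2 + 2 * (norm \<theta>)\<^sup>2"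
        using sum_squares_bound[of "norm (x - \<theta>)" "norm \<theta>"] by (simp add: power2_sum)
      finally show ?thesis .
    qed
    hence "r * (norm x)\<^sup>2 \<le> r * (2 * (norm (x - \<theta>))\<^sup>2 + 2 * (norm \<theta>)\<^sup>2)"
      using r by (intro mult_left_mono) auto
    hence "exp (- (p * (norm (x - \<theta>))\<^sup>2 / 2)) \<le> exp (p * (norm \<theta>)\<^sup>2 / 2 + - (r * (norm x)\<^sup>2 / 2))"
      by (simp add: r_def algebra_simps)
    moreover have "(p / (2 * pi)) powr (real DIM('a) / 2) = 2 powr (real DIM('a) / 2) * (r / (2 * pi)) powr (real DIM('a) / 2)"
      using p by (subst powr_mult[symmetric]) (auto simp: r_def)
    ultimately have "normal_dens p (x - \<theta>) \<le> 2 powr (real DIM('a) / 2) * (r / (2 * pi)) powr (real DIM('a) / 2) *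
        exp (p * (norm \<theta>)\<^sup>2 / 2 + - (r * (norm x)\<^sup>2 / 2))"
      unfolding normal_dens_def by (intro mult_mono) auto
    also have "\<dots> = K * normal_dens r x"
      unfolding K_def normal_dens_def exp_add by (simp only: mult_ac)
    finally show ?thesis .
  qed
  have K: "K \<ge> 0" by (simp add: K_def)
  have le: "\<bar>ln ((norm x)\<^sup>2)\<bar> + (norm x)\<^sup>2 \<le> B * (1 + (\<bar>ln (r * (norm x)\<^sup>2 / 2)\<bar> + r * (norm x)\<^sup>2 / 2))" if "x \<noteq> 0" for x :: 'a
  proof -
    define t where "t = r * (norm x)\<^sup>2 / 2"
    have t: "t > 0" using r that by (simp add: t_def)
    have x: "(norm x)\<^sup>2 = 2 / r * t" using r by (simp add: t_def)
    have "\<bar>ln (2 / r * t)\<bar> \<le> \<bar>ln (2 / r)\<bar> + \<bar>ln t\<bar>"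
      using r t by (simp add: ln_mult del: times_divide_eq_left)
    moreover have "B * (1 + (\<bar>ln t\<bar> + t)) = (1 + \<bar>ln (2 / r)\<bar> + 2 / r) + (1 + \<bar>ln (2 / r)\<bar> + 2 / r) * \<bar>ln t\<bar> + (1 + \<bar>ln (2 / r)\<bar>) * t + 2 / r * t"
      by (simp add: B_def algebra_simps add_divide_distrib)
    moreover have "\<bar>ln t\<bar> \<le> (1 + \<bar>ln (2 / r)\<bar> + 2 / r) * \<bar>ln t\<bar>"
      using r mult_right_mono[of 1 "1 + \<bar>ln (2 / r)\<bar> + 2 / r" "\<bar>ln t\<bar>"] by simp
    moreover have "0 \<le> (1 + \<bar>ln (2 / r)\<bar>) * t" "0 \<le> 2 / r" using t r by auto
    ultimately have "\<bar>ln ((norm x)\<^sup>2)\<bar> + (norm x)\<^sup>2 \<le> B * (1 + (\<bar>ln t\<bar> + t))"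
      unfolding x by linarith
    thus ?thesis by (simp only: t_def)
  qed
  have B: "B \<ge> 0" using r by (simp add: B_def)
  have "(\<integral>\<^sup>+x. ennreal (normal_dens p (x - \<theta>)) * ennreal (\<bar>ln ((norm x)\<^sup>2)\<bar> + (norm x)\<^sup>2) \<partial>lborel)
    \<le> (\<integral>\<^sup>+x. ennreal (K * B) * ((1 + ennreal (\<bar>ln (r * (norm x)\<^sup>2 / 2)\<bar> + r * (norm x)\<^sup>2 / 2)) * ennreal (normal_dens r (x::'a))) \<partial>lborel)"
  proof (rule nn_integral_mono_AE)
    show "AE x in lborel. ennreal (normal_dens p (x - \<theta>)) * ennreal (\<bar>ln ((norm x)\<^sup>2)\<bar> + (norm x)\<^sup>2)
      \<le> ennreal (K * B) * ((1 + ennreal (\<bar>ln (r * (norm x)\<^sup>2 / 2)\<bar> + r * (norm x)\<^sup>2 / 2)) * ennreal (normal_dens r x))"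
      using AE_lborel_singleton[of "0::'a"]
    proof eventually_elim
      case x: (elim x)
      define t where "t = \<bar>ln (r * (norm x)\<^sup>2 / 2)\<bar> + r * (norm x)\<^sup>2 / 2"
      have t: "t \<ge> 0" using r by (simp add: t_def)
      have "normal_dens p (x - \<theta>) * (\<bar>ln ((norm x)\<^sup>2)\<bar> + (norm x)\<^sup>2) \<le> (K * normal_dens r x) * (B * (1 + t))"
        using normal_dens_le[of x] le[OF x] K unfolding t_def by (intro mult_mono) auto
      also have "\<dots> = K * B * ((1 + t) * normal_dens r x)" by simp
      finally have "ennreal (normal_dens p (x - \<theta>) * (\<bar>ln ((norm x)\<^sup>2)\<bar> + (norm x)\<^sup>2)) \<le> ennreal (K * B * ((1 + t) * normal_dens r x))"
        by (rule ennreal_leI)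
      also have "\<dots> = ennreal (K * B) * ((1 + ennreal t) * ennreal (normal_dens r x))"
        using K B t by (simp add: ennreal_mult)
      finally show ?case
        by (simp add: ennreal_mult t_def)
    qed
  qed
  also have "\<dots> = ennreal (K * B) * (\<integral>\<^sup>+x. (1 + ennreal (\<bar>ln (r * (norm x)\<^sup>2 / 2)\<bar> + r * (norm x)\<^sup>2 / 2)) * ennreal (normal_dens r (x::'a)) \<partial>lborel)"
    by (rule nn_integral_cmult) measurable
  also have "(\<integral>\<^sup>+x. (1 + ennreal (\<bar>ln (r * (norm x)\<^sup>2 / 2)\<bar> + r * (norm x)\<^sup>2 / 2)) * ennreal (normal_dens r (x::'a)) \<partial>lborel)
    = (\<integral>\<^sup>+t. ennreal (gamma_dens (real DIM('a) / 2) t) * (1 + ennreal (\<bar>ln t\<bar> + t)) \<partial>haar)"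
    by (rule nn_integral_normal_dens_radial_central[OF r, of "\<lambda>t. 1 + ennreal (\<bar>ln t\<bar> + t)"]) measurable
  also have "\<dots> = 1 + (\<integral>\<^sup>+t. ennreal (gamma_dens (real DIM('a) / 2) t) * ennreal (\<bar>ln t\<bar> + t) \<partial>haar)"
    by (simp add: distrib_left nn_integral_add nn_integral_gamma_dens)
  finally show ?thesis
    using nn_integral_gamma_dens_abs_ln_finite[of "real DIM('a) / 2"]
    by (auto simp: ennreal_mult_less_top elim!: order.strict_trans1)
qed

section \<open>Expected log-ratio of the marginals\<close>

definition normal_law :: "real \<Rightarrow> 'a::euclidean_space \<Rightarrow> 'a measure" where
  "normal_law p \<mu> = density lborel (\<lambda>x. ennreal (normal_dens p (x - \<mu>)))"

lemma sets_normal_law [simp, measurable_cong]: "sets (normal_law p \<mu>) = sets borel"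
  by (simp add: normal_law_def)

lemma space_normal_law [simp]: "space (normal_law p \<mu>) = UNIV"
  by (simp add: normal_law_def)

lemma nn_integral_normal_law:
  assumes [measurable]: "g \<in> borel_measurable borel"
  shows "(\<integral>\<^sup>+x. g x \<partial>normal_law p \<mu>) = (\<integral>\<^sup>+x. ennreal (normal_dens p (x - \<mu>)) * g x \<partial>lborel)"
  by (simp add: normal_law_def nn_integral_density)

lemma integral_normal_law:
  fixes g :: "'a::euclidean_space \<Rightarrow> real"
  assumes [measurable]: "g \<in> borel_measurable borel"
  shows "(\<integral>x. g x \<partial>normal_law p \<mu>) = (\<integral>x. normal_dens p (x - \<mu>) * g x \<partial>lborel)"
  unfolding normal_law_def by (subst integral_density) auto

lemma prob_space_normal_law: "p > 0 \<Longrightarrow> prob_space (normal_law p (\<mu>::'a::euclidean_space))"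
  using nn_integral_lborel_shift[of "\<lambda>x::'a. ennreal (normal_dens p x)" "- \<mu>"] nn_integral_normal_dens[of p, where 'a='a]
  by (intro prob_spaceI) (simp add: normal_law_def emeasure_density)

lemma AE_normal_law_neq: "AE x in normal_law p \<mu>. x \<noteq> c"
  unfolding normal_law_def by (subst AE_density) (auto intro: eventually_mono[OF AE_lborel_singleton[of c]])

lemma distr_normal_law_scale:
  fixes c :: real
  assumes c: "c > 0" and p: "p > 0"
  shows "distr (normal_law (c\<^sup>2 * p) 0) borel (\<lambda>v::'a::euclidean_space. c *\<^sub>R v) = normal_law p 0"
proof (rule measure_eqI)
  fix A :: "'a set" assume "A \<in> sets (distr (normal_law (c\<^sup>2 * p) 0) borel (\<lambda>v. c *\<^sub>R v))"
  hence [measurable]: "A \<in> sets borel" by simp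
  have "emeasure (normal_law p 0) A = (\<integral>\<^sup>+x. ennreal (normal_dens p x) * indicator A x \<partial>lborel)"
    unfolding normal_law_def by (simp add: emeasure_density)
  also have "\<dots> = ennreal (c ^ DIM('a)) * (\<integral>\<^sup>+x. ennreal (normal_dens p (c *\<^sub>R x)) * indicator A (c *\<^sub>R x) \<partial>lborel)"
    using c by (intro nn_integral_lborel_scale) auto
  also have "\<dots> = (\<integral>\<^sup>+x. ennreal (c ^ DIM('a)) * (ennreal (normal_dens p (c *\<^sub>R x)) * indicator A (c *\<^sub>R x)) \<partial>lborel)"
    by (rule nn_integral_cmult[symmetric]) measurable
  also have "\<dots> = (\<integral>\<^sup>+x. ennreal (normal_dens (c\<^sup>2 * p) x) * indicator A (c *\<^sub>R x) \<partial>lborel)"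
    using c p by (intro nn_integral_cong)
      (simp add: mult.assoc[symmetric] ennreal_mult[symmetric] mult.commute[of "c ^ _"] normal_dens_scale)
  also have "\<dots> = (\<integral>\<^sup>+x. indicator A (c *\<^sub>R x) \<partial>normal_law (c\<^sup>2 * p) 0)"
    by (simp add: nn_integral_normal_law)
  also have "\<dots> = emeasure (distr (normal_law (c\<^sup>2 * p) 0) borel (\<lambda>v. c *\<^sub>R v)) A"
    using nn_integral_distr[of "\<lambda>v. c *\<^sub>R v" "normal_law (c\<^sup>2 * p) 0" borel "indicator A"] by simp
  finally show "emeasure (distr (normal_law (c\<^sup>2 * p) 0) borel (\<lambda>v. c *\<^sub>R v)) A = emeasure (normal_law p 0) A" by simp
qed simp

lemma integrable_normal_law_abs_ln:
  fixes \<mu> :: "'a::euclidean_space"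
  assumes p: "p > 0"
  shows "integrable (normal_law p \<mu>) (\<lambda>x. \<bar>ln ((norm x)\<^sup>2)\<bar> + (norm x)\<^sup>2)"
proof (rule integrableI_nonneg)
  show "(\<integral>\<^sup>+x. ennreal (\<bar>ln ((norm x)\<^sup>2)\<bar> + (norm x)\<^sup>2) \<partial>normal_law p \<mu>) < \<infinity>"
    using nn_integral_normal_dens_abs_ln_finite[OF p, of \<mu>] by (subst nn_integral_normal_law) auto
qed auto

section \<open>Growth and integrability of the logarithm of \<psi>\<close>

lemma psi_measurable [measurable]:
  assumes "a > 0" "b > 0" and [measurable]: "f \<in> borel_measurable M" "g \<in> borel_measurable M"
  shows "(\<lambda>x. psi a b (f x) (g x)) \<in> borel_measurable M"
proof -
  note [measurable] = cdf_beta_law_measurable[OF assms(1,2)]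
  show ?thesis unfolding psi_def by measurable
qed

text \<open>On (0, 1/2] the factor with exponent \<open>b - 1\<close> is bounded below, whatever the
  sign of that exponent, so the mass of [y/2, y) is at least a multiple of
  \<open>(y / 2) powr a\<close> times its Haar mass ln 2. Using this at \<open>y = x / 2\<close>
  covers all \<open>x\<close> below 1 and explains the \<open>1 / 4\<close> in
  \<open>m\<close>.\<close>

lemma cdf_beta_law_ge:
  assumes a: "a > 0" and b: "b > 0"
  shows "\<exists>m>0. \<forall>x. 0 < x \<and> x < 1 \<longrightarrow> m * x powr a \<le> cdf (beta_law a b) x"
proof -
  interpret B: real_distribution "beta_law a b" by (rule real_distribution_beta_law[OF a b])
  define k where "k = Gamma (a + b) / (Gamma a * Gamma b) * min 1 ((1 / 2) powr (b - 1))"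
  have k: "k > 0" using a b by (simp add: k_def Gamma_real_pos Gamma_real_neq_0)
  have beta_dens_ge: "k * z powr a \<le> beta_dens a b z" if z: "0 < z" "z \<le> 1 / 2" for z
  proof -
    have "min 1 ((1 / 2) powr (b - 1)) \<le> (1 - z) powr (b - 1)"
    proof (cases "b \<ge> 1")
      case True
      hence "(1 / 2) powr (b - 1) \<le> (1 - z) powr (b - 1)" using z by (intro powr_mono2) auto
      thus ?thesis by simp
    next
      case False
      hence "1 powr (b - 1) \<le> (1 - z) powr (b - 1)" using z by (intro powr_mono2') auto
      thus ?thesis by simp
    qed
    hence "Gamma (a + b) / (Gamma a * Gamma b) * z powr a * min 1 ((1 / 2) powr (b - 1))
      \<le> Gamma (a + b) / (Gamma a * Gamma b) * z powr a * (1 - z) powr (b - 1)"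
      using a b by (intro mult_left_mono) (auto simp: Gamma_real_nonneg)
    thus ?thesis using z by (simp add: beta_dens_def k_def mult_ac)
  qed
  have half: "k * (y / 2) powr a * ln 2 \<le> cdf (beta_law a b) y" if y: "0 < y" "y \<le> 1 / 2" for y
  proof -
    have "ennreal (k * (y / 2) powr a * ln 2) = ennreal (k * (y / 2) powr a) * (\<integral>\<^sup>+t. indicator {1/2..<1} t \<partial>haar)"
      using k by (subst nn_integral_haar_Ico) (auto simp: ennreal_mult ln_div)
    also have "(\<integral>\<^sup>+t. indicator {1/2..<1} t \<partial>haar) = (\<integral>\<^sup>+t. indicator {1/2..<1} (1 / y * t) \<partial>haar)"
      using y by (intro nn_integral_haar_scale[symmetric]) auto
    also have "ennreal (k * (y / 2) powr a) * \<dots> = (\<integral>\<^sup>+t. ennreal (k * (y / 2) powr a) * indicator {1/2..<1} (1 / y * t) \<partial>haar)"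
      by (rule nn_integral_cmult[symmetric]) measurable
    also have "\<dots> \<le> (\<integral>\<^sup>+t. ennreal (beta_dens a b t) * indicator {..y} t \<partial>haar)"
    proof (rule nn_integral_haar_mono, goal_cases)
      case t: (1 t)
      show ?case
      proof (cases "1 / y * t \<in> {1/2..<1}")
        case True
        hence ty: "y / 2 \<le> t" "t < y" using y by (auto simp: field_simps)
        have "k * (y / 2) powr a \<le> k * t powr a"
          using k y ty a by (intro mult_left_mono powr_mono2) auto
        also have "\<dots> \<le> beta_dens a b t" using t ty y by (intro beta_dens_ge) auto
        finally show ?thesis using True ty by (simp add: ennreal_leI)
      qed simp
    qed
    also have "\<dots> = ennreal (cdf (beta_law a b) y)"
      unfolding cdf_def B.emeasure_eq_measure[symmetric] by (simp add: beta_law_def emeasure_density)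
    finally show ?thesis using B.cdf_nonneg by simp
  qed
  define m where "m = k * (1 / 4) powr a * ln 2"
  have "m > 0" using k by (simp add: m_def)
  moreover have "m * x powr a \<le> cdf (beta_law a b) x" if x: "0 < x" "x < 1" for x
  proof -
    have "m * x powr a = k * (x / 2 / 2) powr a * ln 2"
      using x by (simp add: m_def powr_divide mult_ac)
    also have "\<dots> \<le> cdf (beta_law a b) (x / 2)" using x by (intro half) auto
    also have "\<dots> \<le> cdf (beta_law a b) x" using x by (intro B.cdf_nondecreasing) auto
    finally show ?thesis .
  qed
  ultimately show ?thesis by blast
qed

text \<open>From above, the distribution function is at most one. From below, its order
  \<open>x powr a\<close> near 0 cancels the pole of \<open>w powr (- a)\<close> and leaves a
  multiple of \<open>(w + s) powr (- a)\<close>. The right-hand side is integrable under normal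
  laws.\<close>

lemma abs_ln_psi_le:
  assumes a: "a > 0" and b: "b > 0"
  shows "\<exists>C. \<forall>w s. w > 0 \<longrightarrow> s > 0 \<longrightarrow>
    \<bar>ln (psi a b w s)\<bar> \<le> C * (1 + (\<bar>ln w\<bar> + w) + (\<bar>ln s\<bar> + s))"
proof -
  interpret B: real_distribution "beta_law a b" by (rule real_distribution_beta_law[OF a b])
  obtain m where m: "m > 0" "\<And>x. 0 < x \<Longrightarrow> x < 1 \<Longrightarrow> m * x powr a \<le> cdf (beta_law a b) x"
    using cdf_beta_law_ge[OF a b] by blast
  define C where "C = \<bar>ln m\<bar> + a"
  have "\<bar>ln (psi a b w s)\<bar> \<le> C * (1 + (\<bar>ln w\<bar> + w) + (\<bar>ln s\<bar> + s))" if w: "w > 0" and s: "s > 0" for w s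
  proof -
    have pos: "psi a b w s > 0" using psi_pos[OF a b w] s by simp
    have "psi a b w s \<le> w powr (- a) * 1"
      unfolding psi_def by (intro mult_left_mono B.cdf_bounded_prob) simp
    hence up: "ln (psi a b w s) \<le> - a * ln w"
    proof -
      have "ln (psi a b w s) \<le> ln (w powr (- a))"
        using \<open>psi a b w s \<le> w powr (- a) * 1\<close> pos w by (subst ln_le_cancel_iff) auto
      thus ?thesis using w by (simp add: ln_powr)
    qed
    have "m * (w + s) powr (- a) = w powr (- a) * (m * (w / (w + s)) powr a)"
      using w s by (simp add: powr_divide powr_minus_divide)
    also have "\<dots> \<le> psi a b w s"
      unfolding psi_def using w s by (intro mult_left_mono m(2)) auto
    finally have "ln (m * (w + s) powr (- a)) \<le> ln (psi a b w s)"
      using m w s pos by simp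
    hence lo: "ln m - a * ln (w + s) \<le> ln (psi a b w s)"
      using m w s by (simp add: ln_mult ln_powr)
    have "a * ln (w + s) \<le> a * (w + s)"
      using a w s ln_le_minus_one[of "w + s"] by (intro mult_left_mono) auto
    moreover have "a * ln w \<le> a * \<bar>ln w\<bar>" "- (a * ln w) \<le> a * \<bar>ln w\<bar>"
      using a by (auto simp: abs_if mult_le_0_iff zero_le_mult_iff)
    moreover have "C * (1 + (\<bar>ln w\<bar> + w) + (\<bar>ln s\<bar> + s)) =
      \<bar>ln m\<bar> * (1 + (\<bar>ln w\<bar> + w) + (\<bar>ln s\<bar> + s)) + a + a * \<bar>ln w\<bar> + a * (w + s) + a * \<bar>ln s\<bar>"
      by (simp add: C_def algebra_simps)
    moreover have "\<bar>ln m\<bar> * 1 \<le> \<bar>ln m\<bar> * (1 + (\<bar>ln w\<bar> + w) + (\<bar>ln s\<bar> + s))"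
      using w s by (intro mult_left_mono) auto
    moreover have "a * \<bar>ln s\<bar> \<ge> 0" "a * \<bar>ln w\<bar> \<ge> 0" "a * (w + s) \<ge> 0" "\<bar>ln m\<bar> \<ge> 0" using a w s by auto
    ultimately show ?thesis using up lo a unfolding abs_le_iff by linarith
  qed
  thus ?thesis by blast
qed

lemma integrable_ln_psi:
  fixes \<mu> :: "'a::euclidean_space"
  assumes a: "a > 0" and b: "b > 0" and p: "p > 0" and s: "s > 0"
  shows "integrable (normal_law p \<mu>) (\<lambda>x. ln (psi a b ((norm x)\<^sup>2) s))"
proof -
  interpret prob_space "normal_law p \<mu>" by (rule prob_space_normal_law[OF p])
  obtain C where C: "\<And>w s. w > 0 \<Longrightarrow> s > 0 \<Longrightarrow>
    \<bar>ln (psi a b w s)\<bar> \<le> C * (1 + (\<bar>ln w\<bar> + w) + (\<bar>ln s\<bar> + s))"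
    using abs_ln_psi_le[OF a b] by blast
  show ?thesis
  proof (rule Bochner_Integration.integrable_bound)
    show "integrable (normal_law p \<mu>) (\<lambda>x. C * (1 + (\<bar>ln ((norm x)\<^sup>2)\<bar> + (norm x)\<^sup>2) + (\<bar>ln s\<bar> + s)))"
      by (rule integrable_mult_right, rule Bochner_Integration.integrable_add, rule Bochner_Integration.integrable_add)
        (simp, rule integrable_normal_law_abs_ln[OF p], simp)
    show "AE x in normal_law p \<mu>. norm (ln (psi a b ((norm x)\<^sup>2) s))
      \<le> norm (C * (1 + (\<bar>ln ((norm x)\<^sup>2)\<bar> + (norm x)\<^sup>2) + (\<bar>ln s\<bar> + s)))"
      using AE_normal_law_neq[of 0 p \<mu>]
    proof eventually_elim
      case _: (elim x)
      thus ?case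
        unfolding real_norm_def using s by (intro order_trans[OF C abs_ge_self]) simp_all
    qed
  qed (use a b in measurable)
qed

lemma AE_pair_normal_law_neq:
  assumes "p > 0" "r > 0"
  shows "AE z in normal_law p (\<mu>::'a::euclidean_space) \<Otimes>\<^sub>M normal_law r (\<nu>::'b::euclidean_space). fst z \<noteq> 0 \<and> snd z \<noteq> 0"
proof -
  interpret M: prob_space "normal_law p \<mu>" by (rule prob_space_normal_law[OF assms(1)])
  interpret N: prob_space "normal_law r \<nu>" by (rule prob_space_normal_law[OF assms(2)])
  interpret pair_sigma_finite "normal_law p \<mu>" "normal_law r \<nu>" ..
  show ?thesis
  proof (rule AE_pair_measure)
    show "AE x in normal_law p \<mu>. AE y in normal_law r \<nu>. fst (x, y) \<noteq> 0 \<and> snd (x, y) \<noteq> 0"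
      using AE_normal_law_neq[of 0 p \<mu>] by eventually_elim (use AE_normal_law_neq[of 0 r \<nu>] in auto)
  qed measurable
qed

lemma integrable_pair_fst:
  fixes f :: "'a \<Rightarrow> real"
  assumes "prob_space M" "prob_space N" "integrable M f"
  shows "integrable (M \<Otimes>\<^sub>M N) (\<lambda>z. f (fst z))"
proof -
  interpret M: prob_space M by fact
  interpret N: prob_space N by fact
  have "integrable (distr (M \<Otimes>\<^sub>M N) M fst) f"
    using assms(3) by (simp add: N.distr_pair_fst)
  thus ?thesis by (rule integrable_distr[rotated]) simp
qed

lemma integrable_pair_snd:
  fixes f :: "'b \<Rightarrow> real"
  assumes "prob_space M" "prob_space N" "integrable N f"
  shows "integrable (M \<Otimes>\<^sub>M N) (\<lambda>z. f (snd z))"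
proof -
  interpret M: prob_space M by fact
  interpret N: prob_space N by fact
  interpret pair_sigma_finite N M ..
  have "integrable (N \<Otimes>\<^sub>M M) (\<lambda>z. f (fst z))" by (rule integrable_pair_fst) fact+
  from integrable_product_swap[OF this] show ?thesis by (simp add: case_prod_beta')
qed

lemma integrable_pair_ln_psi:
  fixes \<mu> :: "'a::euclidean_space" and \<nu> :: "'b::euclidean_space"
  assumes a: "a > 0" and b: "b > 0" and p: "p > 0" and r: "r > 0"
  shows "integrable (normal_law p \<mu> \<Otimes>\<^sub>M normal_law r \<nu>) (\<lambda>z. ln (psi a b ((norm (fst z))\<^sup>2) ((norm (snd z))\<^sup>2)))"
proof -
  interpret M: prob_space "normal_law p \<mu>" by (rule prob_space_normal_law[OF p])
  interpret N: prob_space "normal_law r \<nu>" by (rule prob_space_normal_law[OF r])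
  interpret P: pair_prob_space "normal_law p \<mu>" "normal_law r \<nu>" ..
  obtain C where C: "\<And>w s. w > 0 \<Longrightarrow> s > 0 \<Longrightarrow>
    \<bar>ln (psi a b w s)\<bar> \<le> C * (1 + (\<bar>ln w\<bar> + w) + (\<bar>ln s\<bar> + s))"
    using abs_ln_psi_le[OF a b] by blast
  have 1: "integrable (normal_law p \<mu> \<Otimes>\<^sub>M normal_law r \<nu>) (\<lambda>z. \<bar>ln ((norm (fst z))\<^sup>2)\<bar> + (norm (fst z))\<^sup>2)"
    by (rule integrable_pair_fst[OF M.prob_space_axioms N.prob_space_axioms integrable_normal_law_abs_ln[OF p]])
  have 2: "integrable (normal_law p \<mu> \<Otimes>\<^sub>M normal_law r \<nu>) (\<lambda>z. \<bar>ln ((norm (snd z))\<^sup>2)\<bar> + (norm (snd z))\<^sup>2)"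
    by (rule integrable_pair_snd[OF M.prob_space_axioms N.prob_space_axioms integrable_normal_law_abs_ln[OF r]])
  show ?thesis
  proof (rule Bochner_Integration.integrable_bound)
    show "integrable (normal_law p \<mu> \<Otimes>\<^sub>M normal_law r \<nu>) (\<lambda>z. C * (1 + (\<bar>ln ((norm (fst z))\<^sup>2)\<bar> + (norm (fst z))\<^sup>2) + (\<bar>ln ((norm (snd z))\<^sup>2)\<bar> + (norm (snd z))\<^sup>2)))"
      by (rule integrable_mult_right, rule Bochner_Integration.integrable_add, rule Bochner_Integration.integrable_add)
        (simp, rule 1, rule 2)
    show "AE z in normal_law p \<mu> \<Otimes>\<^sub>M normal_law r \<nu>. norm (ln (psi a b ((norm (fst z))\<^sup>2) ((norm (snd z))\<^sup>2)))
      \<le> norm (C * (1 + (\<bar>ln ((norm (fst z))\<^sup>2)\<bar> + (norm (fst z))\<^sup>2) + (\<bar>ln ((norm (snd z))\<^sup>2)\<bar> + (norm (snd z))\<^sup>2)))"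
      using AE_pair_normal_law_neq[OF p r, of \<mu> \<nu>]
    proof eventually_elim
      case _: (elim z)
      thus ?case
        unfolding real_norm_def by (intro order_trans[OF C abs_ge_self]) simp_all
    qed
  qed (use a b in measurable)
qed

text \<open>Jensen's inequality in the form \<open>ln t \<le> t - 1\<close>, applied to the superharmonic function \<open>psi\<close>.\<close>

lemma expected_ln_psi_le:
  fixes y :: "'a::euclidean_space" and v :: "'b::euclidean_space"
  assumes d: "DIM('a) \<ge> 3" and y: "y \<noteq> 0" and v: "v \<noteq> 0" and r: "r > 0"
  defines "a \<equiv> real DIM('a) / 2 - 1" and "b \<equiv> real DIM('b) / 2"
  shows "(\<integral>x. ln (psi a b ((norm x)\<^sup>2) ((norm v)\<^sup>2)) \<partial>normal_law r y) \<le> ln (psi a b ((norm y)\<^sup>2) ((norm v)\<^sup>2))"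
proof -
  interpret prob_space "normal_law r y" by (rule prob_space_normal_law[OF r])
  have ab: "a > 0" "b > 0" using d by (auto simp: a_def b_def)
  define f where "f x = psi a b ((norm x)\<^sup>2) ((norm v)\<^sup>2)" for x :: 'a
  have [measurable]: "f \<in> borel_measurable borel" unfolding f_def using ab by measurable
  have f_pos: "f x > 0" if "x \<noteq> 0" for x using psi_pos[OF ab] that by (simp add: f_def)
  have f_nonneg: "f x \<ge> 0" for x
  proof -
    interpret B: real_distribution "beta_law a b" by (rule real_distribution_beta_law[OF ab])
    show ?thesis using B.cdf_nonneg by (simp add: f_def psi_def)
  qed
  have sup: "(\<integral>\<^sup>+x. ennreal (f x) \<partial>normal_law r y) \<le> ennreal (f y)"
  proof -
    have "(\<integral>\<^sup>+x. ennreal (f x) \<partial>normal_law r y) = (\<integral>\<^sup>+x. ennreal (normal_dens r (x - y)) * ennreal (f x) \<partial>lborel)"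
      by (rule nn_integral_normal_law) measurable
    thus ?thesis using psi_superharmonic[OF d y v r] by (simp add: f_def a_def b_def)
  qed
  have int: "integrable (normal_law r y) f"
    by (rule integrableI_nonneg) (use sup f_nonneg in \<open>auto simp: order.strict_trans1\<close>)
  have "ennreal (\<integral>x. f x \<partial>normal_law r y) \<le> ennreal (f y)"
    using sup int f_nonneg by (subst nn_integral_eq_integral[symmetric]) auto
  hence le: "(\<integral>x. f x \<partial>normal_law r y) \<le> f y" using f_nonneg by simp
  have "(\<integral>x. ln (f x) \<partial>normal_law r y) \<le> (\<integral>x. ln (f y) + f x / f y - 1 \<partial>normal_law r y)"
  proof (rule integral_mono_AE)
    show "integrable (normal_law r y) (\<lambda>x. ln (f x))"
      unfolding f_def by (rule integrable_ln_psi[OF ab r]) (use v in simp)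
    show "integrable (normal_law r y) (\<lambda>x. ln (f y) + f x / f y - 1)" using int by simp
    show "AE x in normal_law r y. ln (f x) \<le> ln (f y) + f x / f y - 1"
      using AE_normal_law_neq[of 0 r y]
    proof eventually_elim
      case _: (elim x)
      hence "f x > 0" "f y > 0" using f_pos y by auto
      thus ?case
        using ln_le_minus_one[of "f x / f y"] by (simp add: ln_div)
    qed
  qed
  also have "\<dots> = ln (f y) + (\<integral>x. f x \<partial>normal_law r y) / f y - 1"
    using int prob_space by simp
  also have "\<dots> \<le> ln (f y)" using le f_pos[OF y] by (simp add: field_simps)
  finally show ?thesis by (simp add: f_def)
qed

text \<open>The normal law of precision \<open>p\<close> is the one of the larger precision
  \<open>p'\<close> blurred by independent normal noise of precision \<open>r\<close>, where
  \<open>1 / p = 1 / p' + 1 / r\<close>. Jensen's inequality at each point \<open>y\<close> is then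
  averaged over \<open>y\<close>.\<close>

lemma expected_ln_psi_mono_precision:
  fixes \<theta> :: "'a::euclidean_space" and v :: "'b::euclidean_space"
  assumes d: "DIM('a) \<ge> 3" and v: "v \<noteq> 0" and p: "0 < p" "p < p'"
  defines "a \<equiv> real DIM('a) / 2 - 1" and "b \<equiv> real DIM('b) / 2"
  shows "(\<integral>x. ln (psi a b ((norm x)\<^sup>2) ((norm v)\<^sup>2)) \<partial>normal_law p \<theta>) \<le> (\<integral>x. ln (psi a b ((norm x)\<^sup>2) ((norm v)\<^sup>2)) \<partial>normal_law p' \<theta>)"
proof -
  have ab: "a > 0" "b > 0" using d by (auto simp: a_def b_def)
  have p': "p' > 0" using p by simp
  define r where "r = p * p' / (p' - p)"
  have r: "r > 0" using p by (simp add: r_def)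
  have pr: "p' * r / (p' + r) = p"
  proof -
    have "p' + r = p' * p' / (p' - p)" using p by (simp add: r_def field_simps)
    thus ?thesis using p by (simp add: r_def)
  qed
  define h where "h x = ln (psi a b ((norm x)\<^sup>2) ((norm v)\<^sup>2))" for x :: 'a
  have [measurable]: "h \<in> borel_measurable borel" unfolding h_def using ab by measurable
  have int_h: "integrable (normal_law q \<mu>) h" if "q > 0" for q \<mu>
    unfolding h_def by (rule integrable_ln_psi[OF ab that]) (use v in simp)
  define k where "k y x = normal_dens p' (y - \<theta>) * normal_dens r (x - y) * h x" for y x :: 'a
  have [measurable]: "case_prod k \<in> borel_measurable (borel \<Otimes>\<^sub>M borel)" unfolding k_def by measurable
  have conv: "(\<integral>\<^sup>+y. ennreal (normal_dens p' (y - \<theta>) * normal_dens r (x - y)) \<partial>lborel) = ennreal (normal_dens p (x - \<theta>))" for x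
    using nn_integral_normal_dens_conv[OF p' r, of \<theta> x] unfolding pr
    by (simp add: ennreal_mult normal_dens_minus_commute[of r x])
  have int_k: "integrable (lborel \<Otimes>\<^sub>M lborel) (case_prod k)"
  proof (rule integrableI_bounded)
    have "(\<integral>\<^sup>+z. ennreal (norm (case_prod k z)) \<partial>(lborel \<Otimes>\<^sub>M lborel)) = (\<integral>\<^sup>+x. \<integral>\<^sup>+y. ennreal (norm (k y x)) \<partial>lborel \<partial>lborel)"
      by (subst lborel_pair.nn_integral_snd[symmetric]) auto
    also have "\<dots> = (\<integral>\<^sup>+x. \<integral>\<^sup>+y. ennreal (normal_dens p' (y - \<theta>) * normal_dens r (x - y)) * ennreal (norm (h x)) \<partial>lborel \<partial>lborel)"
      by (simp add: k_def abs_mult ennreal_mult)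
    also have "\<dots> = (\<integral>\<^sup>+x. ennreal (normal_dens p (x - \<theta>)) * ennreal (norm (h x)) \<partial>lborel)"
      by (subst nn_integral_multc) (auto simp: conv)
    also have "\<dots> = (\<integral>\<^sup>+x. ennreal (norm (h x)) \<partial>normal_law p \<theta>)"
      by (subst nn_integral_normal_law) auto
    also have "\<dots> < \<infinity>" using int_h[OF p(1), of \<theta>] by (simp add: integrable_iff_bounded)
    finally show "(\<integral>\<^sup>+z. ennreal (norm (case_prod k z)) \<partial>(lborel \<Otimes>\<^sub>M lborel)) < \<infinity>" .
  qed measurable
  have inner: "(\<integral>x. k y x \<partial>lborel) = normal_dens p' (y - \<theta>) * (\<integral>x. h x \<partial>normal_law r y)" for y
    by (simp add: k_def integral_normal_law mult.assoc)
  have "(\<integral>x. h x \<partial>normal_law p \<theta>) = (\<integral>x. normal_dens p (x - \<theta>) * h x \<partial>lborel)" by (rule integral_normal_law) measurable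
  also have "\<dots> = (\<integral>x. \<integral>y. k y x \<partial>lborel \<partial>lborel)"
  proof (rule Bochner_Integration.integral_cong[OF refl], goal_cases)
    case _: (1 x)
    have "(\<integral>y. normal_dens p' (y - \<theta>) * normal_dens r (x - y) \<partial>lborel) = normal_dens p (x - \<theta>)"
      by (subst integral_eq_nn_integral) (auto simp: conv)
    thus ?case by (simp add: k_def)
  qed
  also have "\<dots> = (\<integral>y. \<integral>x. k y x \<partial>lborel \<partial>lborel)"
    by (rule lborel_pair.Fubini_integral[OF int_k])
  also have "\<dots> \<le> (\<integral>y. normal_dens p' (y - \<theta>) * h y \<partial>lborel)"
  proof (rule integral_mono_AE)
    show "integrable lborel (\<lambda>y. \<integral>x. k y x \<partial>lborel)"
      using lborel_pair.integrable_fst[OF int_k] .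
    show "integrable lborel (\<lambda>y. normal_dens p' (y - \<theta>) * h y)"
      using int_h[OF p', of \<theta>] unfolding normal_law_def by (subst (asm) integrable_density) auto
    show "AE y in lborel. (\<integral>x. k y x \<partial>lborel) \<le> normal_dens p' (y - \<theta>) * h y"
      using AE_lborel_singleton[of "0::'a"]
    proof eventually_elim
      case y: (elim y)
      show ?case
        unfolding inner h_def a_def b_def using expected_ln_psi_le[OF d y v r]
        by (intro mult_left_mono) auto
    qed
  qed
  also have "\<dots> = (\<integral>x. h x \<partial>normal_law p' \<theta>)" by (rule integral_normal_law[symmetric]) measurable
  finally show ?thesis by (simp add: h_def)
qed

text \<open>Separate precisions for location and residual allow them to be varied one at a time. The
  dimension \<open>m\<close> of the overview enters as the type of the residual.\<close>

definition mean_ln_psi :: "'a::euclidean_space \<Rightarrow> 'b::euclidean_space itself \<Rightarrow> real \<Rightarrow> real \<Rightarrow> real" where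
  "mean_ln_psi \<theta> _ p r = (\<integral>z. ln (psi (real DIM('a) / 2 - 1) (real DIM('b) / 2) ((norm (fst z))\<^sup>2) ((norm (snd z))\<^sup>2))
     \<partial>(normal_law p \<theta> \<Otimes>\<^sub>M normal_law r (0::'b)))"

lemma mean_ln_psi_mono_precision:
  fixes \<theta> :: "'a::euclidean_space"
  assumes d: "DIM('a) \<ge> 3" and p: "0 < p" "p < p'" and r: "r > 0"
  shows "mean_ln_psi \<theta> TYPE('b::euclidean_space) p r \<le> mean_ln_psi \<theta> TYPE('b) p' r"
proof -
  define a b where "a = real DIM('a) / 2 - 1" and "b = real DIM('b) / 2"
  have ab: "a > 0" "b > 0" using d by (auto simp: a_def b_def)
  have p': "p' > 0" using p by simp
  interpret M: prob_space "normal_law p \<theta>" by (rule prob_space_normal_law[OF p(1)])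
  interpret M': prob_space "normal_law p' \<theta>" by (rule prob_space_normal_law[OF p'])
  interpret N: prob_space "normal_law r (0::'b)" by (rule prob_space_normal_law[OF r])
  interpret P: pair_sigma_finite "normal_law p \<theta>" "normal_law r (0::'b)" ..
  interpret P': pair_sigma_finite "normal_law p' \<theta>" "normal_law r (0::'b)" ..
  define l where "l x v = ln (psi a b ((norm (x::'a))\<^sup>2) ((norm (v::'b))\<^sup>2))" for x v
  have i: "integrable (normal_law p \<theta> \<Otimes>\<^sub>M normal_law r 0) (case_prod l)" "integrable (normal_law p' \<theta> \<Otimes>\<^sub>M normal_law r 0) (case_prod l)"
    using integrable_pair_ln_psi[OF ab p(1) r, of \<theta> "0::'b"] integrable_pair_ln_psi[OF ab p' r, of \<theta> "0::'b"]
    by (simp_all add: l_def case_prod_beta')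
  have "(\<integral>z. case_prod l z \<partial>(normal_law p \<theta> \<Otimes>\<^sub>M normal_law r 0)) = (\<integral>v. \<integral>x. l x v \<partial>normal_law p \<theta> \<partial>normal_law r 0)"
    using P.integral_snd[OF i(1)] by simp
  also have "\<dots> \<le> (\<integral>v. \<integral>x. l x v \<partial>normal_law p' \<theta> \<partial>normal_law r 0)"
  proof (rule integral_mono_AE)
    show "AE v in normal_law r 0. (\<integral>x. l x v \<partial>normal_law p \<theta>) \<le> (\<integral>x. l x v \<partial>normal_law p' \<theta>)"
      using AE_normal_law_neq[of 0 r "0::'b"]
      by eventually_elim (unfold l_def a_def b_def, rule expected_ln_psi_mono_precision[OF d _ p])
  qed (use P.integrable_snd[OF i(1)] P'.integrable_snd[OF i(2)] in auto)
  also have "\<dots> = (\<integral>z. case_prod l z \<partial>(normal_law p' \<theta> \<Otimes>\<^sub>M normal_law r 0))"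
    using P'.integral_snd[OF i(2)] by simp
  finally show ?thesis by (simp add: mean_ln_psi_def l_def case_prod_beta' a_def b_def)
qed

text \<open>A coupling by dilation: \<open>sqrt k\<close> times a residual of precision
  \<open>k * r\<close> is a residual of precision \<open>r\<close>. Under this coupling the norm is
  strictly larger almost surely, and \<psi> strictly decreases in it.\<close>

lemma mean_ln_psi_strict_mono:
  fixes \<theta> :: "'a::euclidean_space"
  assumes d: "DIM('a) \<ge> 3" and p: "p > 0" and r: "r > 0" and k: "k > 1"
  shows "mean_ln_psi \<theta> TYPE('b::euclidean_space) p r < mean_ln_psi \<theta> TYPE('b) p (k * r)"
proof -
  define a b where "a = real DIM('a) / 2 - 1" and "b = real DIM('b) / 2"
  have ab: "a > 0" "b > 0" using d by (auto simp: a_def b_def)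
  have kr: "k * r > 0" using k r by simp
  interpret M: prob_space "normal_law p \<theta>" by (rule prob_space_normal_law[OF p])
  interpret N: prob_space "normal_law r (0::'b)" by (rule prob_space_normal_law[OF r])
  interpret N': prob_space "normal_law (k * r) (0::'b)" by (rule prob_space_normal_law[OF kr])
  interpret P: pair_prob_space "normal_law p \<theta>" "normal_law r (0::'b)" ..
  interpret P': pair_prob_space "normal_law p \<theta>" "normal_law (k * r) (0::'b)" ..
  define l where "l x v = ln (psi a b ((norm (x::'a))\<^sup>2) ((norm (v::'b))\<^sup>2))" for x v
  have [measurable]: "case_prod l \<in> borel_measurable (borel \<Otimes>\<^sub>M borel)"
    unfolding l_def using ab by measurable
  have i: "integrable (normal_law p \<theta> \<Otimes>\<^sub>M normal_law r 0) (case_prod l)" "integrable (normal_law p \<theta> \<Otimes>\<^sub>M normal_law (k * r) 0) (case_prod l)"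
    using integrable_pair_ln_psi[OF ab p r, of \<theta> "0::'b"] integrable_pair_ln_psi[OF ab p kr, of \<theta> "0::'b"]
    by (simp_all add: l_def case_prod_beta')
  have dist: "distr (normal_law p \<theta> \<Otimes>\<^sub>M normal_law (k * r) (0::'b)) (borel \<Otimes>\<^sub>M borel) (\<lambda>(x, v). (x, sqrt k *\<^sub>R v)) = normal_law p \<theta> \<Otimes>\<^sub>M normal_law r 0"
  proof -
    have 1: "distr (normal_law p \<theta>) borel (\<lambda>x. x) = normal_law p \<theta>" by (rule distr_id2) simp
    have 2: "distr (normal_law (k * r) (0::'b)) borel (\<lambda>v. sqrt k *\<^sub>R v) = normal_law r 0"
      using distr_normal_law_scale[of "sqrt k" r, where 'a='b] k r by simp
    have "distr (normal_law p \<theta>) borel (\<lambda>x. x) \<Otimes>\<^sub>M distr (normal_law (k * r) (0::'b)) borel (\<lambda>v. sqrt k *\<^sub>R v)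
      = distr (normal_law p \<theta> \<Otimes>\<^sub>M normal_law (k * r) (0::'b)) (borel \<Otimes>\<^sub>M borel) (\<lambda>(x, v). (x, sqrt k *\<^sub>R v))"
      by (rule pair_measure_distr) (auto simp: 2 N.sigma_finite_measure_axioms)
    thus ?thesis unfolding 1 2 by simp
  qed
  have i': "integrable (normal_law p \<theta> \<Otimes>\<^sub>M normal_law (k * r) (0::'b)) (\<lambda>(x, v). l x (sqrt k *\<^sub>R v))"
    using i(1) unfolding dist[symmetric] by (subst (asm) integrable_distr_eq) (auto simp: case_prod_beta')
  have "(\<integral>z. case_prod l z \<partial>(normal_law p \<theta> \<Otimes>\<^sub>M normal_law r 0)) = (\<integral>(x, v). l x (sqrt k *\<^sub>R v) \<partial>(normal_law p \<theta> \<Otimes>\<^sub>M normal_law (k * r) (0::'b)))"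
    unfolding dist[symmetric] by (subst integral_distr) (auto simp: case_prod_beta')
  also have "\<dots> < (\<integral>z. case_prod l z \<partial>(normal_law p \<theta> \<Otimes>\<^sub>M normal_law (k * r) 0))"
  proof (rule P'.integral_less_AE_space[OF i' i(2)])
    show "AE z in normal_law p \<theta> \<Otimes>\<^sub>M normal_law (k * r) (0::'b). (case z of (x, v) \<Rightarrow> l x (sqrt k *\<^sub>R v)) < case_prod l z"
      using AE_pair_normal_law_neq[OF p kr, of \<theta> "0::'b"]
    proof eventually_elim
      case z: (elim z)
      have "psi a b ((norm (fst z))\<^sup>2) ((norm (sqrt k *\<^sub>R snd z))\<^sup>2) < psi a b ((norm (fst z))\<^sup>2) ((norm (snd z))\<^sup>2)"
        using z k ab by (intro psi_strict_antimono) (auto simp: power_mult_distrib)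
      thus ?case
        using z k ab by (auto simp: l_def case_prod_beta' psi_pos)
    qed
    show "emeasure (normal_law p \<theta> \<Otimes>\<^sub>M normal_law (k * r) (0::'b)) (space (normal_law p \<theta> \<Otimes>\<^sub>M normal_law (k * r) (0::'b))) \<noteq> 0"
      using P'.emeasure_space_1 by simp
  qed
  finally show ?thesis by (simp add: mean_ln_psi_def l_def case_prod_beta' a_def b_def)
qed

text \<open>The logarithm of \<psi> is a multiple of \<open>ln ((norm x)\<^sup>2)\<close> plus the
  logarithm of the distribution function, and only the second term sees the residual. That term has
  constant sign, so its mean can be written as a nonnegative integral, the form in which different
  residual dimensions are compared.\<close>

lemma mean_ln_psi_eq:
  fixes \<theta> :: "'a::euclidean_space"
  assumes d: "DIM('a) \<ge> 3" and p: "p > 0"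
  defines "a \<equiv> real DIM('a) / 2 - 1"
  shows "\<exists>J\<ge>0. mean_ln_psi \<theta> TYPE('e::euclidean_space) p p = - a * (\<integral>x. ln ((norm x)\<^sup>2) \<partial>normal_law p \<theta>) - J
      \<and> ennreal J = (\<integral>\<^sup>+x. (\<integral>\<^sup>+v. ennreal (- ln (cdf (beta_law a (real DIM('e) / 2)) ((norm x)\<^sup>2 / ((norm x)\<^sup>2 + (norm v)\<^sup>2)))) * ennreal (normal_dens p (v::'e)) \<partial>lborel) * ennreal (normal_dens p (x - \<theta>)) \<partial>lborel)"
proof -
  have a: "a > 0" using d by (simp add: a_def)
  interpret M: prob_space "normal_law p \<theta>" by (rule prob_space_normal_law[OF p])
  define A where "A = (\<integral>x. ln ((norm x)\<^sup>2) \<partial>normal_law p \<theta>)"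
  have int_ln: "integrable (normal_law p \<theta>) (\<lambda>x. ln ((norm x)\<^sup>2))"
    by (rule Bochner_Integration.integrable_bound[OF integrable_normal_law_abs_ln[OF p, of \<theta>]]) auto
  define b where "b = real DIM('e) / 2"
  have b: "b > 0" by (simp add: b_def)
  note [measurable] = cdf_beta_law_measurable[OF a b]
  interpret N: prob_space "normal_law p (0::'e)" by (rule prob_space_normal_law[OF p])
  interpret P: pair_prob_space "normal_law p \<theta>" "normal_law p (0::'e)" ..
  define c where "c x v = cdf (beta_law a b) ((norm (x::'a))\<^sup>2 / ((norm x)\<^sup>2 + (norm (v::'e))\<^sup>2))" for x v
  have [measurable]: "case_prod c \<in> borel_measurable (borel \<Otimes>\<^sub>M borel)" unfolding c_def by measurable
  have c01: "0 < c x v \<and> c x v \<le> 1" if "x \<noteq> 0" "v \<noteq> 0" for x v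
  proof -
    interpret B: real_distribution "beta_law a b" by (rule real_distribution_beta_law[OF a b])
    have "(norm x)\<^sup>2 / ((norm x)\<^sup>2 + (norm v)\<^sup>2) > 0" using that by (simp add: add_pos_pos)
    moreover have "(norm x)\<^sup>2 / ((norm x)\<^sup>2 + (norm v)\<^sup>2) \<le> 1" using that by (simp add: add_pos_pos)
    ultimately show ?thesis unfolding c_def using a b B.cdf_bounded_prob by (auto intro: cdf_beta_law_pos)
  qed
  define l where "l z = ln (psi a b ((norm (fst z))\<^sup>2) ((norm (snd z))\<^sup>2))" for z :: "'a \<times> 'e"
  have il: "integrable (normal_law p \<theta> \<Otimes>\<^sub>M normal_law p (0::'e)) l"
    unfolding l_def by (rule integrable_pair_ln_psi[OF a b p p])
  have iw: "integrable (normal_law p \<theta> \<Otimes>\<^sub>M normal_law p (0::'e)) (\<lambda>z. ln ((norm (fst z))\<^sup>2))"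
    by (rule integrable_pair_fst[OF M.prob_space_axioms N.prob_space_axioms int_ln])
  have eq: "AE z in normal_law p \<theta> \<Otimes>\<^sub>M normal_law p (0::'e). - ln (case_prod c z) = - a * ln ((norm (fst z))\<^sup>2) - l z"
    using AE_pair_normal_law_neq[OF p p, of \<theta> "0::'e"]
  proof eventually_elim
    case z: (elim z)
    have "l z = ln (((norm (fst z))\<^sup>2) powr (- a)) + ln (c (fst z) (snd z))"
      unfolding l_def psi_def c_def[symmetric] using z c01[of "fst z" "snd z"] by (subst ln_mult) auto
    thus ?case
      using z by (simp add: ln_powr case_prod_beta')
  qed
  have ic: "integrable (normal_law p \<theta> \<Otimes>\<^sub>M normal_law p (0::'e)) (\<lambda>z. - ln (case_prod c z))"
  proof (rule integrable_cong_AE_imp)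
    show "integrable (normal_law p \<theta> \<Otimes>\<^sub>M normal_law p (0::'e)) (\<lambda>z. - a * ln ((norm (fst z))\<^sup>2) - l z)"
      using il iw by (intro Bochner_Integration.integrable_diff integrable_mult_right)
    show "AE z in normal_law p \<theta> \<Otimes>\<^sub>M normal_law p (0::'e). - a * ln ((norm (fst z))\<^sup>2) - l z = - ln (case_prod c z)"
      using eq by eventually_elim simp
  qed measurable
  define J where "J = (\<integral>z. - ln (case_prod c z) \<partial>(normal_law p \<theta> \<Otimes>\<^sub>M normal_law p (0::'e)))"
  have "J = (\<integral>z. - a * ln ((norm (fst z))\<^sup>2) - l z \<partial>(normal_law p \<theta> \<Otimes>\<^sub>M normal_law p (0::'e)))"
    unfolding J_def using eq borel_measurable_integrable[OF il] borel_measurable_integrable[OF iw] borel_measurable_integrable[OF ic]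
    by (intro integral_cong_AE) auto
  also have "\<dots> = - a * (\<integral>z. ln ((norm (fst z))\<^sup>2) \<partial>(normal_law p \<theta> \<Otimes>\<^sub>M normal_law p (0::'e))) - (\<integral>z. l z \<partial>(normal_law p \<theta> \<Otimes>\<^sub>M normal_law p (0::'e)))"
    using il iw by simp
  also have "(\<integral>z. ln ((norm (fst z))\<^sup>2) \<partial>(normal_law p \<theta> \<Otimes>\<^sub>M normal_law p (0::'e))) = A"
  proof -
    have "(\<integral>z. ln ((norm (fst z))\<^sup>2) \<partial>(normal_law p \<theta> \<Otimes>\<^sub>M normal_law p (0::'e))) = (\<integral>x. ln ((norm x)\<^sup>2) \<partial>distr (normal_law p \<theta> \<Otimes>\<^sub>M normal_law p (0::'e)) (normal_law p \<theta>) fst)"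
      by (rule integral_distr[symmetric]) auto
    thus ?thesis by (simp add: A_def N.distr_pair_fst)
  qed
  also have "(\<integral>z. l z \<partial>(normal_law p \<theta> \<Otimes>\<^sub>M normal_law p (0::'e))) = mean_ln_psi \<theta> TYPE('e) p p"
    unfolding mean_ln_psi_def l_def a_def b_def by (rule refl)
  finally have 1: "J = - a * A - mean_ln_psi \<theta> TYPE('e) p p" .
  have nonneg: "AE z in normal_law p \<theta> \<Otimes>\<^sub>M normal_law p (0::'e). 0 \<le> - ln (case_prod c z)"
    using AE_pair_normal_law_neq[OF p p, of \<theta> "0::'e"]
    by eventually_elim (use c01 in \<open>auto simp: case_prod_beta'\<close>)
  with ic have "ennreal J = (\<integral>\<^sup>+z. ennreal (- ln (case_prod c z)) \<partial>(normal_law p \<theta> \<Otimes>\<^sub>M normal_law p (0::'e)))"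
    unfolding J_def by (subst nn_integral_eq_integral) auto
  also have "\<dots> = (\<integral>\<^sup>+x. \<integral>\<^sup>+v. ennreal (- ln (c x v)) \<partial>normal_law p 0 \<partial>normal_law p \<theta>)"
    by (subst N.nn_integral_fst[symmetric]) auto
  also have "\<dots> = (\<integral>\<^sup>+x. (\<integral>\<^sup>+v. ennreal (- ln (c x v)) * ennreal (normal_dens p v) \<partial>lborel) * ennreal (normal_dens p (x - \<theta>)) \<partial>lborel)"
    by (subst nn_integral_normal_law, measurable, subst nn_integral_normal_law) (auto simp: mult.commute)
  finally have 2: "ennreal J = (\<integral>\<^sup>+x. (\<integral>\<^sup>+v. ennreal (- ln (c x v)) * ennreal (normal_dens p v) \<partial>lborel) * ennreal (normal_dens p (x - \<theta>)) \<partial>lborel)" .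
  have "J \<ge> 0" unfolding J_def using nonneg by (rule integral_nonneg_AE)
  thus ?thesis using 1 2 unfolding c_def b_def A_def by (intro exI[of _ J]) simp
qed

lemma mean_ln_psi_mono_dimension:
  fixes \<theta> :: "'a::euclidean_space"
  assumes d: "DIM('a) \<ge> 3" and p: "p > 0" and le: "DIM('b::euclidean_space) \<le> DIM('c::euclidean_space)"
  shows "mean_ln_psi \<theta> TYPE('b) p p \<le> mean_ln_psi \<theta> TYPE('c) p p"
proof -
  obtain J where J: "J \<ge> 0" "mean_ln_psi \<theta> TYPE('b) p p = - (real DIM('a) / 2 - 1) * (\<integral>x. ln ((norm x)\<^sup>2) \<partial>normal_law p \<theta>) - J"
    "ennreal J = (\<integral>\<^sup>+x. (\<integral>\<^sup>+v. ennreal (- ln (cdf (beta_law (real DIM('a) / 2 - 1) (real DIM('b) / 2)) ((norm x)\<^sup>2 / ((norm x)\<^sup>2 + (norm v)\<^sup>2)))) * ennreal (normal_dens p (v::'b)) \<partial>lborel) * ennreal (normal_dens p (x - \<theta>)) \<partial>lborel)"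
    using mean_ln_psi_eq[where 'e='b, OF d p, of \<theta>] by blast
  obtain K where K: "K \<ge> 0" "mean_ln_psi \<theta> TYPE('c) p p = - (real DIM('a) / 2 - 1) * (\<integral>x. ln ((norm x)\<^sup>2) \<partial>normal_law p \<theta>) - K"
    "ennreal K = (\<integral>\<^sup>+x. (\<integral>\<^sup>+v. ennreal (- ln (cdf (beta_law (real DIM('a) / 2 - 1) (real DIM('c) / 2)) ((norm x)\<^sup>2 / ((norm x)\<^sup>2 + (norm v)\<^sup>2)))) * ennreal (normal_dens p (v::'c)) \<partial>lborel) * ennreal (normal_dens p (x - \<theta>)) \<partial>lborel)"
    using mean_ln_psi_eq[where 'e='c, OF d p, of \<theta>] by blast
  have "ennreal K \<le> ennreal J"
    unfolding J(3) K(3) by (rule nn_integral_normal_dens_neg_ln_cdf[OF d p le])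
  hence "K \<le> J" using J(1) by (simp only: ennreal_le_iff)
  thus ?thesis unfolding J(2) K(2) by linarith
qed

text \<open>The chain raises the precision of the residual, which is the strict step, then that of
  the location, and then the dimension. The last step comes where both precisions agree, since the
  beta comparison behind it requires this.\<close>

lemma mean_ln_psi_less:
  fixes \<theta> :: "'a::euclidean_space"
  assumes d: "DIM('a) \<ge> 3" and p: "p > 0" and k: "k > 1"
    and le: "DIM('b::euclidean_space) \<le> DIM('c::euclidean_space)"
  shows "mean_ln_psi \<theta> TYPE('b) p p < mean_ln_psi \<theta> TYPE('c) (k * p) (k * p)"
proof -
  have "mean_ln_psi \<theta> TYPE('b) p p < mean_ln_psi \<theta> TYPE('b) p (k * p)"
    by (rule mean_ln_psi_strict_mono[OF d p p k])
  also have "\<dots> \<le> mean_ln_psi \<theta> TYPE('b) (k * p) (k * p)"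
    using p k by (intro mean_ln_psi_mono_precision[OF d]) auto
  also have "\<dots> \<le> mean_ln_psi \<theta> TYPE('c) (k * p) (k * p)"
    using p k by (intro mean_ln_psi_mono_dimension[OF d _ le]) auto
  finally show ?thesis .
qed

section \<open>Predictive densities in the normal model\<close>

definition model_dens :: "real \<Rightarrow> real \<Rightarrow> 'a::euclidean_space \<Rightarrow> 'a \<Rightarrow> 'b::euclidean_space \<Rightarrow> 'a \<Rightarrow> real" where
  "model_dens p c \<theta> x u y = normal_dens p (x - \<theta>) * normal_dens p u * normal_dens p (y - c *\<^sub>R \<theta>)"

text \<open>Under the prior \<open>g\<close> times \<open>haar\<close>, the predictive density is
  the marginal density of \<open>(x, u, y)\<close> divided by that of \<open>(x, u)\<close>. This
  form involves no conditional or posterior density and no \<open>f\<close>.\<close>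

definition bayes_num :: "real \<Rightarrow> ('a::euclidean_space \<Rightarrow> real) \<Rightarrow> 'a \<Rightarrow> 'b::euclidean_space \<Rightarrow> 'a \<Rightarrow> ennreal" where
  "bayes_num c g x u y = (\<integral>\<^sup>+\<theta>. ennreal (g \<theta>) * (\<integral>\<^sup>+p. ennreal (model_dens p c \<theta> x u y) \<partial>haar) \<partial>lborel)"

definition bayes_pred :: "real \<Rightarrow> ('a::euclidean_space \<Rightarrow> real) \<Rightarrow> 'a \<Rightarrow> 'b::euclidean_space \<Rightarrow> 'a \<Rightarrow> ennreal" where
  "bayes_pred c g x u y = bayes_num c g x u y / (\<integral>\<^sup>+y'. bayes_num c g x u y' \<partial>lborel)"

lemma model_dens_nonneg [simp]: "model_dens p c \<theta> x u y \<ge> 0"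
  by (simp add: model_dens_def)

lemma model_dens_measurable [measurable]:
  assumes [measurable]: "p \<in> borel_measurable M" "\<theta> \<in> borel_measurable M" "x \<in> borel_measurable M"
    "u \<in> borel_measurable M" "y \<in> borel_measurable M"
  shows "(\<lambda>z. model_dens (p z) c (\<theta> z) (x z) (u z) (y z)) \<in> borel_measurable M"
  unfolding model_dens_def by measurable

lemma bayes_num_measurable [measurable]:
  assumes [measurable]: "g \<in> borel_measurable borel" "x \<in> borel_measurable M"
    "u \<in> borel_measurable M" "y \<in> borel_measurable M"
  shows "(\<lambda>z. bayes_num c g (x z) (u z) (y z)) \<in> borel_measurable M"
  unfolding bayes_num_def by measurable

lemma bayes_pred_measurable [measurable]:
  assumes [measurable]: "g \<in> borel_measurable borel" "x \<in> borel_measurable M"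
    "u \<in> borel_measurable M" "y \<in> borel_measurable M"
  shows "(\<lambda>z. bayes_pred c g (x z) (u z) (y z)) \<in> borel_measurable M"
  unfolding bayes_pred_def by measurable

text \<open>
  Rotation of \<open>(x, y)\<close>: the observation \<open>(x, u, y)\<close> with mean \<open>(\<theta>, 0, c \<theta>)\<close> is equivalent to
  \<open>w = (x + c y) / (1 + c\<^sup>2)\<close> with mean \<open>\<theta>\<close> and precision multiplied by \<open>1 + c\<^sup>2\<close>, together with a
  residual \<open>v\<close> of mean zero.
\<close>

definition pooled :: "real \<Rightarrow> 'a::euclidean_space \<Rightarrow> 'a \<Rightarrow> 'a" where
  "pooled c x y = (1 / (1 + c\<^sup>2)) *\<^sub>R (x + c *\<^sub>R y)"

text \<open>The two components are scaled so that the residual has the same precision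
  \<open>(1 + c\<^sup>2) * p\<close> as the pooled location, and the rotated observation is again an
  instance of the same model.\<close>

definition residual :: "real \<Rightarrow> 'a::euclidean_space \<Rightarrow> 'b::euclidean_space \<Rightarrow> 'a \<Rightarrow> 'b \<times> 'a" where
  "residual c x u y = ((1 / sqrt (1 + c\<^sup>2)) *\<^sub>R u, (1 / (1 + c\<^sup>2)) *\<^sub>R (y - c *\<^sub>R x))"

text \<open>The Jacobian of the inverse of the passage from \<open>(x, u, y)\<close> to pooled
  location and residual: \<open>sqrt (1 + c\<^sup>2)\<close> for each coordinate of \<open>u\<close>
  and \<open>1 + c\<^sup>2\<close> for each coordinate of the pair \<open>(x, y)\<close>.\<close>

definition rotation_jac :: "real \<Rightarrow> nat \<Rightarrow> nat \<Rightarrow> real" where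
  "rotation_jac c d k = sqrt (1 + c\<^sup>2) ^ k * (1 + c\<^sup>2) ^ d"

lemma one_plus_square_pos: "1 + c\<^sup>2 > (0::real)"
  by (simp add: add_pos_nonneg)

lemma rotation_jac_pos: "rotation_jac c d k > 0"
  using one_plus_square_pos[of c] by (simp add: rotation_jac_def)

lemma model_dens_rotate:
  fixes \<theta> x y :: "'a::euclidean_space" and u :: "'b::euclidean_space"
  assumes p: "p > 0"
  shows "rotation_jac c DIM('a) DIM('b) * model_dens p c \<theta> x u y =
    normal_dens ((1 + c\<^sup>2) * p) (\<theta> - pooled c x y) * normal_dens ((1 + c\<^sup>2) * p) (residual c x u y)"
proof -
  define k where "k = 1 + c\<^sup>2"
  have k: "k > 0" unfolding k_def by (rule one_plus_square_pos)
  have kp: "k * p > 0" using k p by simp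
  have u: "normal_dens p u * sqrt k ^ DIM('b) = normal_dens (k * p) ((1 / sqrt k) *\<^sub>R u)"
    using normal_dens_scale[of "sqrt k" p "(1 / sqrt k) *\<^sub>R u"] k p by simp
  define z where "z = (1 / k) *\<^sub>R (y - c *\<^sub>R x)"
  define w where "w = (1 / k) *\<^sub>R (x + c *\<^sub>R y)"
  have x: "x = w - c *\<^sub>R z"
  proof -
    have "k *\<^sub>R (w - c *\<^sub>R z) = (x + c *\<^sub>R y) - c *\<^sub>R (y - c *\<^sub>R x)"
      using k by (simp add: w_def z_def scaleR_diff_right)
    also have "\<dots> = k *\<^sub>R x" by (simp add: k_def scaleR_diff_right scaleR_add_left power2_eq_square)
    finally show ?thesis using k by simp
  qed
  have y: "y = c *\<^sub>R w + z"
  proof -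
    have "k *\<^sub>R (c *\<^sub>R w + z) = c *\<^sub>R (x + c *\<^sub>R y) + (y - c *\<^sub>R x)"
      using k by (simp add: w_def z_def scaleR_add_right)
    also have "\<dots> = k *\<^sub>R y" by (simp add: k_def scaleR_add_right scaleR_add_left power2_eq_square)
    finally show ?thesis using k by simp
  qed
  \<comment> \<open>Pythagoras for the decomposition of \<open>(x, y)\<close> along the direction
    \<open>(1, c)\<close> of the mean and its orthogonal complement: the cross terms cancel.\<close>
  have norms: "(norm (x - \<theta>))\<^sup>2 + (norm (y - c *\<^sub>R \<theta>))\<^sup>2 = k * (norm (\<theta> - w))\<^sup>2 + k * (norm z)\<^sup>2"
  proof -
    define e where "e = w - \<theta>"
    have 1: "x - \<theta> = e - c *\<^sub>R z" "y - c *\<^sub>R \<theta> = c *\<^sub>R e + z"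
      using x y by (simp_all add: e_def scaleR_diff_right)
    have 2: "norm (\<theta> - w) = norm e" by (simp add: e_def norm_minus_commute)
    have "(norm (e - c *\<^sub>R z))\<^sup>2 + (norm (c *\<^sub>R e + z))\<^sup>2 = k * (norm e)\<^sup>2 + k * (norm z)\<^sup>2"
      by (simp add: power2_norm_eq_inner inner_diff_left inner_diff_right inner_add_left inner_add_right
          inner_commute[of z e] k_def) (simp add: algebra_simps power2_eq_square)
    thus ?thesis using 1 2 by simp
  qed
  have xy: "k ^ DIM('a) * (normal_dens p (x - \<theta>) * normal_dens p (y - c *\<^sub>R \<theta>)) = normal_dens (k * p) (\<theta> - w) * normal_dens (k * p) z"
  proof -
    have e: "exp (- (p * (norm (x - \<theta>))\<^sup>2 / 2)) * exp (- (p * (norm (y - c *\<^sub>R \<theta>))\<^sup>2 / 2))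
      = exp (- (k * p * (norm (\<theta> - w))\<^sup>2 / 2)) * exp (- (k * p * (norm z)\<^sup>2 / 2))"
    proof -
      have "p * (norm (x - \<theta>))\<^sup>2 / 2 + p * (norm (y - c *\<^sub>R \<theta>))\<^sup>2 / 2
        = p / 2 * ((norm (x - \<theta>))\<^sup>2 + (norm (y - c *\<^sub>R \<theta>))\<^sup>2)" by (simp add: algebra_simps)
      also have "\<dots> = k * p * (norm (\<theta> - w))\<^sup>2 / 2 + k * p * (norm z)\<^sup>2 / 2"
        unfolding norms by (simp add: algebra_simps)
      finally show ?thesis by (simp add: exp_add[symmetric])
    qed
    define q where "q = real DIM('a) / 2"
    have kd: "k ^ DIM('a) = k powr q * k powr q"
      using k by (simp add: q_def powr_add[symmetric] powr_realpow)
    have kq: "(k * p / (2 * pi)) powr q = k powr q * (p / (2 * pi)) powr q"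
      using k p powr_mult[of k "p / (2 * pi)" q] by simp
    have "k ^ DIM('a) * (normal_dens p (x - \<theta>) * normal_dens p (y - c *\<^sub>R \<theta>)) =
      (k * p / (2 * pi)) powr q * (k * p / (2 * pi)) powr q *
      (exp (- (p * (norm (x - \<theta>))\<^sup>2 / 2)) * exp (- (p * (norm (y - c *\<^sub>R \<theta>))\<^sup>2 / 2)))"
      unfolding kd kq normal_dens_def q_def[symmetric] by (simp only: mult_ac)
    also have "\<dots> = normal_dens (k * p) (\<theta> - w) * normal_dens (k * p) z"
      unfolding e normal_dens_def q_def[symmetric] by (simp only: mult_ac)
    finally show ?thesis .
  qed
  have "rotation_jac c DIM('a) DIM('b) * model_dens p c \<theta> x u y =
    (normal_dens p u * sqrt k ^ DIM('b)) * (k ^ DIM('a) * (normal_dens p (x - \<theta>) * normal_dens p (y - c *\<^sub>R \<theta>)))"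
    by (simp add: rotation_jac_def model_dens_def k_def[symmetric])
  also have "\<dots> = normal_dens (k * p) (\<theta> - w) * normal_dens (k * p) ((1 / sqrt k) *\<^sub>R u, z)"
    unfolding u xy normal_dens_Pair[OF kp] by (simp only: mult_ac)
  finally show ?thesis
    by (simp add: w_def z_def k_def pooled_def residual_def)
qed

text \<open>The marginal density of a location \<open>x\<close> and a centred residual
  \<open>v\<close> under the prior \<open>g\<close> times \<open>haar\<close>. It occurs twice: at
  \<open>(x, u)\<close> in the denominator of the predictive density and at the rotated observation
  in the numerator.\<close>

definition prior_form :: "('a::euclidean_space \<Rightarrow> real) \<Rightarrow> 'a \<Rightarrow> 'b::euclidean_space \<Rightarrow> ennreal" where
  "prior_form g x v = (\<integral>\<^sup>+p. ennreal (normal_dens p v) * (\<integral>\<^sup>+\<theta>. ennreal (g \<theta>) * ennreal (normal_dens p (\<theta> - x)) \<partial>lborel) \<partial>haar)"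

text \<open>The factor \<open>1 + c\<^sup>2\<close> that the rotation puts on the precision
  disappears by scale invariance of \<open>haar\<close>; only the Jacobian remains.\<close>

lemma bayes_num_eq_prior_form:
  fixes x y :: "'a::euclidean_space" and u :: "'b::euclidean_space"
  assumes [measurable]: "g \<in> borel_measurable borel"
  shows "bayes_num c g x u y = ennreal (1 / rotation_jac c DIM('a) DIM('b)) * prior_form g (pooled c x y) (residual c x u y)"
proof -
  define k where "k = 1 + c\<^sup>2"
  have k: "k > 0" unfolding k_def by (rule one_plus_square_pos)
  define C where "C = 1 / rotation_jac c DIM('a) DIM('b)"
  have C: "C \<ge> 0" using rotation_jac_pos[of c "DIM('a)" "DIM('b)"] by (simp add: C_def)
  define w v where "w = pooled c x y" and "v = residual c x u y"
  have model_dens: "model_dens p c \<theta> x u y = C * (normal_dens (k * p) (\<theta> - w) * normal_dens (k * p) v)" if "p > 0" for p \<theta>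
    using model_dens_rotate[OF that, of c \<theta> x u y] rotation_jac_pos[of c "DIM('a)" "DIM('b)"]
    by (simp add: C_def k_def w_def v_def field_simps)
  have "bayes_num c g x u y = (\<integral>\<^sup>+\<theta>. \<integral>\<^sup>+p. ennreal C * (ennreal (normal_dens p v) * (ennreal (g \<theta>) * ennreal (normal_dens p (\<theta> - w)))) \<partial>haar \<partial>lborel)"
    unfolding bayes_num_def
  proof (rule nn_integral_cong)
    fix \<theta>
    have "(\<integral>\<^sup>+p. ennreal (model_dens p c \<theta> x u y) \<partial>haar)
      = (\<integral>\<^sup>+p. ennreal C * (ennreal (normal_dens (k * p) (\<theta> - w)) * ennreal (normal_dens (k * p) v)) \<partial>haar)"
      using C by (intro nn_integral_haar_cong) (simp add: model_dens ennreal_mult)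
    also have "\<dots> = (\<integral>\<^sup>+p. ennreal C * (ennreal (normal_dens p (\<theta> - w)) * ennreal (normal_dens p v)) \<partial>haar)"
      using k by (intro nn_integral_haar_scale[of "\<lambda>p. ennreal C * (ennreal (normal_dens p (\<theta> - w)) * ennreal (normal_dens p v))"]) auto
    finally show "ennreal (g \<theta>) * (\<integral>\<^sup>+p. ennreal (model_dens p c \<theta> x u y) \<partial>haar) =
      (\<integral>\<^sup>+p. ennreal C * (ennreal (normal_dens p v) * (ennreal (g \<theta>) * ennreal (normal_dens p (\<theta> - w)))) \<partial>haar)"
      by (simp add: nn_integral_cmult[symmetric] mult_ac)
  qed
  also have "\<dots> = (\<integral>\<^sup>+p. \<integral>\<^sup>+\<theta>. ennreal C * (ennreal (normal_dens p v) * (ennreal (g \<theta>) * ennreal (normal_dens p (\<theta> - w)))) \<partial>lborel \<partial>haar)"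
    by (rule nn_integral_swap_lborel_haar) measurable
  also have "\<dots> = ennreal C * prior_form g w v"
    by (simp add: prior_form_def nn_integral_cmult)
  finally show ?thesis by (simp add: C_def w_def v_def)
qed

lemma nn_integral_bayes_num:
  fixes x :: "'a::euclidean_space" and u :: "'b::euclidean_space"
  assumes [measurable]: "g \<in> borel_measurable borel"
  shows "(\<integral>\<^sup>+y. bayes_num c g x u y \<partial>lborel) = prior_form g x u"
proof -
  have "(\<integral>\<^sup>+y. bayes_num c g x u y \<partial>lborel)
    = (\<integral>\<^sup>+\<theta>. \<integral>\<^sup>+y. ennreal (g \<theta>) * (\<integral>\<^sup>+p. ennreal (model_dens p c \<theta> x u y) \<partial>haar) \<partial>lborel \<partial>lborel)"
    unfolding bayes_num_def by (rule nn_integral_swap_lborel) measurable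
  also have "\<dots> = (\<integral>\<^sup>+\<theta>. \<integral>\<^sup>+p. ennreal (normal_dens p u) * (ennreal (g \<theta>) * ennreal (normal_dens p (\<theta> - x))) \<partial>haar \<partial>lborel)"
  proof (rule nn_integral_cong)
    fix \<theta> :: 'a
    have "(\<integral>\<^sup>+y. ennreal (g \<theta>) * (\<integral>\<^sup>+p. ennreal (model_dens p c \<theta> x u y) \<partial>haar) \<partial>lborel)
      = ennreal (g \<theta>) * (\<integral>\<^sup>+y. \<integral>\<^sup>+p. ennreal (model_dens p c \<theta> x u y) \<partial>haar \<partial>lborel)"
      by (rule nn_integral_cmult) measurable
    also have "(\<integral>\<^sup>+y. \<integral>\<^sup>+p. ennreal (model_dens p c \<theta> x u y) \<partial>haar \<partial>lborel) = (\<integral>\<^sup>+p. \<integral>\<^sup>+y. ennreal (model_dens p c \<theta> x u y) \<partial>lborel \<partial>haar)"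
      by (rule nn_integral_swap_lborel_haar) measurable
    also have "\<dots> = (\<integral>\<^sup>+p. ennreal (normal_dens p u) * ennreal (normal_dens p (\<theta> - x)) \<partial>haar)"
    proof (rule nn_integral_haar_cong, goal_cases)
      case p: (1 p)
      have "(\<integral>\<^sup>+y. ennreal (model_dens p c \<theta> x u y) \<partial>lborel)
        = (\<integral>\<^sup>+y. ennreal (normal_dens p u) * ennreal (normal_dens p (\<theta> - x)) * ennreal (normal_dens p (y + - (c *\<^sub>R \<theta>))) \<partial>lborel)"
        by (intro nn_integral_cong) (simp add: model_dens_def ennreal_mult normal_dens_minus_commute[of p x] mult_ac)
      also have "\<dots> = ennreal (normal_dens p u) * ennreal (normal_dens p (\<theta> - x)) * (\<integral>\<^sup>+y. ennreal (normal_dens p (y + - (c *\<^sub>R \<theta>))) \<partial>lborel)"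
        by (rule nn_integral_cmult) measurable
      also have "(\<integral>\<^sup>+y. ennreal (normal_dens p (y + - (c *\<^sub>R \<theta>))) \<partial>lborel) = (\<integral>\<^sup>+y. ennreal (normal_dens p (y::'a)) \<partial>lborel)"
        by (rule nn_integral_lborel_shift) measurable
      finally show ?case
        using p by (simp add: nn_integral_normal_dens)
    qed
    finally show "(\<integral>\<^sup>+y. ennreal (g \<theta>) * (\<integral>\<^sup>+p. ennreal (model_dens p c \<theta> x u y) \<partial>haar) \<partial>lborel) =
      (\<integral>\<^sup>+p. ennreal (normal_dens p u) * (ennreal (g \<theta>) * ennreal (normal_dens p (\<theta> - x))) \<partial>haar)"
      by (simp add: nn_integral_cmult[symmetric] mult_ac)
  qed
  also have "\<dots> = (\<integral>\<^sup>+p. \<integral>\<^sup>+\<theta>. ennreal (normal_dens p u) * (ennreal (g \<theta>) * ennreal (normal_dens p (\<theta> - x))) \<partial>lborel \<partial>haar)"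
    by (rule nn_integral_swap_lborel_haar) measurable
  also have "\<dots> = prior_form g x u"
    by (simp add: prior_form_def nn_integral_cmult)
  finally show ?thesis .
qed

section \<open>Marginal and predictive densities under the flat and the harmonic prior\<close>

definition harmonic :: "'a::euclidean_space \<Rightarrow> real" where
  "harmonic \<theta> = norm \<theta> powr (2 - real DIM('a))"

lemma harmonic_measurable [measurable]: "harmonic \<in> borel_measurable borel"
  unfolding harmonic_def by measurable

lemma harmonic_nonneg [simp]: "harmonic \<theta> \<ge> 0"
  by (simp add: harmonic_def)

definition flat_form :: "'b::euclidean_space \<Rightarrow> real" where
  "flat_form v = (pi * (norm v)\<^sup>2) powr (- (real DIM('b) / 2)) * Gamma (real DIM('b) / 2)"

lemma flat_form_pos: "v \<noteq> 0 \<Longrightarrow> flat_form v > 0"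
  by (simp add: flat_form_def Gamma_real_pos)

lemma prior_form_one:
  fixes x :: "'a::euclidean_space"
  assumes "v \<noteq> 0"
  shows "prior_form (\<lambda>_. 1) x v = ennreal (flat_form v)"
proof -
  have "prior_form (\<lambda>_. 1) x v = (\<integral>\<^sup>+p. ennreal (normal_dens p v) \<partial>haar)"
    unfolding prior_form_def
  proof (rule nn_integral_haar_cong, goal_cases)
    case p: (1 p)
    have "(\<integral>\<^sup>+\<theta>. ennreal (normal_dens p (\<theta> + - x)) \<partial>lborel) = (\<integral>\<^sup>+\<theta>. ennreal (normal_dens p (\<theta>::'a)) \<partial>lborel)"
      by (rule nn_integral_lborel_shift) measurable
    thus ?case
      using p by (simp add: nn_integral_normal_dens)
  qed
  thus ?thesis using nn_integral_normal_dens_haar[OF assms] by (simp add: flat_form_def)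
qed

lemma prior_form_harmonic:
  fixes x :: "'a::euclidean_space" and v :: "'b::euclidean_space"
  assumes d: "DIM('a) \<ge> 3" and x: "x \<noteq> 0" and v: "v \<noteq> 0"
  shows "prior_form harmonic x v = ennreal (flat_form v *
    psi (real DIM('a) / 2 - 1) (real DIM('b) / 2) ((norm x)\<^sup>2) ((norm v)\<^sup>2))"
proof -
  define H where "H = newton_mix_const DIM('a)"
  have H: "H > 0" unfolding H_def by (rule newton_mix_const_pos[OF d])
  define P where "P = psi (real DIM('a) / 2 - 1) (real DIM('b) / 2) ((norm x)\<^sup>2) ((norm v)\<^sup>2)"
  have P: "P > 0" using d x unfolding P_def by (intro psi_pos) auto
  have *: "ennreal (harmonic \<theta>) = ennreal (1 / H) * newton_mix \<theta>" if "\<theta> \<noteq> 0" for \<theta> :: 'a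
  proof -
    have "newton_mix \<theta> = ennreal H * ennreal (harmonic \<theta>)"
      unfolding newton_mix_eq[OF d that] H_def newton_mix_const_def harmonic_def by (simp add: mult_ac)
    thus ?thesis using H by (simp add: mult.assoc[symmetric] ennreal_mult[symmetric])
  qed
  have "prior_form harmonic x v = (\<integral>\<^sup>+p. ennreal (1 / H) * (ennreal (normal_dens p v) * newton_mix_smooth p x) \<partial>haar)"
    unfolding prior_form_def
  proof (rule nn_integral_haar_cong, goal_cases)
    case p: (1 p)
    have "(\<integral>\<^sup>+\<theta>. ennreal (harmonic \<theta>) * ennreal (normal_dens p (\<theta> - x)) \<partial>lborel)
      = (\<integral>\<^sup>+\<theta>. ennreal (1 / H) * (newton_mix \<theta> * ennreal (normal_dens p (\<theta> - x))) \<partial>lborel)"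
      by (rule nn_integral_cong_AE)
        (use AE_lborel_singleton[of "0::'a"] in \<open>eventually_elim, simp add: * mult.assoc\<close>)
    also have "\<dots> = ennreal (1 / H) * newton_mix_smooth p x"
      by (simp add: nn_integral_cmult nn_integral_newton_mix_normal_dens[OF p])
    finally show ?case by (simp add: mult_ac)
  qed
  also have "\<dots> = ennreal (1 / H) * (ennreal (flat_form v) * ennreal (H * P))"
    using nn_integral_normal_dens_newton_mix_smooth[OF d x v] nn_integral_normal_dens_haar[OF v]
    by (simp add: nn_integral_cmult flat_form_def H_def P_def)
  also have "\<dots> = ennreal (flat_form v * P)"
    using H P flat_form_pos[OF v] by (simp add: ennreal_mult[symmetric])
  finally show ?thesis by (simp add: P_def)
qed

lemma residual_nonzero: "u \<noteq> 0 \<Longrightarrow> residual c x u y \<noteq> 0"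
  using one_plus_square_pos[of c] by (auto simp: residual_def zero_prod_def)

text \<open>This is the multivariate Student density: \<open>flat_form\<close> is a multiple of the
  norm to the power minus the dimension, and \<open>(norm (residual c x u y))\<^sup>2\<close> is
  \<open>(norm u)\<^sup>2 / (1 + c\<^sup>2)\<close> times \<open>1 + (norm (y - c *\<^sub>R
  x))\<^sup>2 / ((1 + c\<^sup>2) * (norm u)\<^sup>2)\<close>.\<close>

lemma bayes_pred_one:
  fixes x y :: "'a::euclidean_space" and u :: "'b::euclidean_space"
  assumes "u \<noteq> 0"
  shows "bayes_pred c (\<lambda>_. 1) x u y = ennreal (flat_form (residual c x u y) / rotation_jac c DIM('a) DIM('b) / flat_form u)"
  using rotation_jac_pos[of c "DIM('a)" "DIM('b)"] flat_form_pos[OF assms] flat_form_pos[OF residual_nonzero[OF assms, of c x y]]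
  unfolding bayes_pred_def
  by (simp add: nn_integral_bayes_num bayes_num_eq_prior_form prior_form_one residual_nonzero assms ennreal_mult[symmetric] divide_ennreal)

text \<open>Compared with the flat prior, numerator and denominator each acquire a factor \<psi>, at
  the rotated and at the original observation. Hence the form as the flat predictive density times a
  quotient of two values of \<psi>.\<close>

lemma bayes_pred_harmonic:
  fixes x y :: "'a::euclidean_space" and u :: "'b::euclidean_space"
  assumes d: "DIM('a) \<ge> 3" and u: "u \<noteq> 0" and x: "x \<noteq> 0" and w: "pooled c x y \<noteq> 0"
  shows "bayes_pred c harmonic x u y = ennreal (flat_form (residual c x u y) / rotation_jac c DIM('a) DIM('b) / flat_form u *
    (psi (real DIM('a) / 2 - 1) (real DIM('b \<times> 'a) / 2) ((norm (pooled c x y))\<^sup>2) ((norm (residual c x u y))\<^sup>2)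
     / psi (real DIM('a) / 2 - 1) (real DIM('b) / 2) ((norm x)\<^sup>2) ((norm u)\<^sup>2)))"
proof -
  define P where "P = psi (real DIM('a) / 2 - 1) (real DIM('b) / 2) ((norm x)\<^sup>2) ((norm u)\<^sup>2)"
  define P' where "P' = psi (real DIM('a) / 2 - 1) (real DIM('b \<times> 'a) / 2) ((norm (pooled c x y))\<^sup>2) ((norm (residual c x u y))\<^sup>2)"
  have P: "P > 0" "P' > 0" using d x w unfolding P_def P'_def by (auto intro!: psi_pos)
  have 1: "prior_form harmonic x u = ennreal (flat_form u * P)"
    unfolding P_def by (rule prior_form_harmonic[OF d x u])
  have 2: "prior_form harmonic (pooled c x y) (residual c x u y) = ennreal (flat_form (residual c x u y) * P')"
    unfolding P'_def by (rule prior_form_harmonic[OF d w residual_nonzero[OF u]])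
  show ?thesis
    using rotation_jac_pos[of c "DIM('a)" "DIM('b)"] flat_form_pos[OF u] flat_form_pos[OF residual_nonzero[OF u, of c x y]] P
    unfolding bayes_pred_def P_def[symmetric] P'_def[symmetric]
    by (simp add: nn_integral_bayes_num bayes_num_eq_prior_form 1 2 ennreal_mult[symmetric] divide_ennreal mult_ac)
qed

section \<open>Distribution of the rotated observation\<close>

definition model_law :: "real \<Rightarrow> real \<Rightarrow> 'a::euclidean_space \<Rightarrow> ('a \<times> 'b::euclidean_space \<times> 'a) measure" where
  "model_law p c \<theta> = density lborel (\<lambda>(x, u, y). ennreal (model_dens p c \<theta> x u y))"

lemma sets_model_law [simp, measurable_cong]: "sets (model_law p c \<theta>) = sets borel"
  by (simp add: model_law_def)

lemma nn_integral_lborel_triple: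
  fixes g :: "'a::euclidean_space \<times> 'b::euclidean_space \<times> 'c::euclidean_space \<Rightarrow> ennreal"
  assumes g: "g \<in> borel_measurable borel"
  shows "(\<integral>\<^sup>+t. g t \<partial>lborel) = (\<integral>\<^sup>+x. \<integral>\<^sup>+u. \<integral>\<^sup>+y. g (x, u, y) \<partial>lborel \<partial>lborel \<partial>lborel)"
proof -
  have [measurable]: "g \<in> borel_measurable (borel \<Otimes>\<^sub>M borel \<Otimes>\<^sub>M borel)"
    using g by (simp add: borel_prod)
  have "(\<integral>\<^sup>+t. g t \<partial>lborel) = (\<integral>\<^sup>+x. \<integral>\<^sup>+v. g (x, v) \<partial>(lborel \<Otimes>\<^sub>M lborel) \<partial>lborel)"
    unfolding lborel_prod
    by (subst lborel.nn_integral_fst) (auto simp: lborel_prod g)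
  also have "\<dots> = (\<integral>\<^sup>+x. \<integral>\<^sup>+u. \<integral>\<^sup>+y. g (x, u, y) \<partial>lborel \<partial>lborel \<partial>lborel)"
    by (subst lborel.nn_integral_fst[symmetric]) auto
  finally show ?thesis .
qed

lemma nn_integral_model_law:
  fixes \<theta> :: "'a::euclidean_space" and g :: "'a \<times> 'b::euclidean_space \<times> 'a \<Rightarrow> ennreal"
  assumes g: "g \<in> borel_measurable borel"
  shows "(\<integral>\<^sup>+t. g t \<partial>model_law p c \<theta>) = (\<integral>\<^sup>+x. \<integral>\<^sup>+u. \<integral>\<^sup>+y. ennreal (model_dens p c \<theta> x u y) * g (x, u, y) \<partial>lborel \<partial>lborel \<partial>lborel)"
proof -
  have [measurable]: "(\<lambda>(x, u, y). ennreal (model_dens p c \<theta> x u y)) \<in> borel_measurable (borel :: ('a \<times> 'b \<times> 'a) measure)"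
    unfolding borel_prod[symmetric] by measurable
  note [measurable] = g
  show ?thesis unfolding model_law_def
    by (subst nn_integral_density, measurable, subst nn_integral_lborel_triple) auto
qed

lemma nn_integral_pair_normal_law:
  assumes "p > 0" "r > 0" and [measurable]: "g \<in> borel_measurable (borel \<Otimes>\<^sub>M borel)"
  shows "(\<integral>\<^sup>+z. g z \<partial>(normal_law p \<mu> \<Otimes>\<^sub>M normal_law r \<nu>))
    = (\<integral>\<^sup>+x. \<integral>\<^sup>+v. ennreal (normal_dens p (x - \<mu>)) * ennreal (normal_dens r (v - \<nu>)) * g (x, v) \<partial>lborel \<partial>lborel)"
proof -
  interpret N: prob_space "normal_law r \<nu>" by (rule prob_space_normal_law) fact
  have "(\<integral>\<^sup>+z. g z \<partial>(normal_law p \<mu> \<Otimes>\<^sub>M normal_law r \<nu>)) = (\<integral>\<^sup>+x. \<integral>\<^sup>+v. g (x, v) \<partial>normal_law r \<nu> \<partial>normal_law p \<mu>)"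
    by (subst N.nn_integral_fst[symmetric]) auto
  also have "\<dots> = (\<integral>\<^sup>+x. ennreal (normal_dens p (x - \<mu>)) * (\<integral>\<^sup>+v. g (x, v) \<partial>normal_law r \<nu>) \<partial>lborel)"
    by (rule nn_integral_normal_law) measurable
  also have "\<dots> = (\<integral>\<^sup>+x. \<integral>\<^sup>+v. ennreal (normal_dens p (x - \<mu>)) * ennreal (normal_dens r (v - \<nu>)) * g (x, v) \<partial>lborel \<partial>lborel)"
    by (simp add: nn_integral_normal_law nn_integral_cmult mult.assoc)
  finally show ?thesis .
qed

lemma distr_model_law_xu:
  fixes \<theta> :: "'a::euclidean_space"
  assumes p: "p > 0"
  shows "distr (model_law p c \<theta>) (borel \<Otimes>\<^sub>M borel) (\<lambda>(x, u, y). (x, u)) = normal_law p \<theta> \<Otimes>\<^sub>M normal_law p (0::'b::euclidean_space)"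
proof (rule measure_eqI)
  have T: "(\<lambda>(x, u, y). (x, u)) \<in> measurable (model_law p c \<theta>) (borel \<Otimes>\<^sub>M (borel :: 'b measure))"
    unfolding measurable_cong_sets[OF sets_model_law refl] borel_prod[symmetric] by measurable
  show "sets (distr (model_law p c \<theta>) (borel \<Otimes>\<^sub>M borel) (\<lambda>(x, u, y). (x, u))) = sets (normal_law p \<theta> \<Otimes>\<^sub>M normal_law p (0::'b))"
    by (simp cong: sets_pair_measure_cong)
  fix A assume "A \<in> sets (distr (model_law p c \<theta>) (borel \<Otimes>\<^sub>M borel) (\<lambda>(x, u, y). (x, u :: 'b)))"
  hence A [measurable]: "A \<in> sets (borel \<Otimes>\<^sub>M borel)" by simp
  have A': "A \<in> sets (normal_law p \<theta> \<Otimes>\<^sub>M normal_law p (0::'b))"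
    using A by (simp cong: sets_pair_measure_cong)
  have "emeasure (distr (model_law p c \<theta>) (borel \<Otimes>\<^sub>M borel) (\<lambda>(x, u, y). (x, u))) A = (\<integral>\<^sup>+t. indicator A (case t of (x, u, y) \<Rightarrow> (x, u)) \<partial>model_law p c \<theta>)"
    using nn_integral_distr[OF T, of "indicator A"] by simp
  also have "\<dots> = (\<integral>\<^sup>+x. \<integral>\<^sup>+u. \<integral>\<^sup>+y. ennreal (model_dens p c \<theta> x u y) * indicator A (x, u) \<partial>lborel \<partial>lborel \<partial>lborel)"
    by (subst nn_integral_model_law) (auto simp: borel_prod[symmetric])
  also have "\<dots> = (\<integral>\<^sup>+x. \<integral>\<^sup>+u. ennreal (normal_dens p (x - \<theta>)) * ennreal (normal_dens p (u - 0)) * indicator A (x, u) \<partial>lborel \<partial>lborel)"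
  proof (intro nn_integral_cong)
    fix x :: 'a and u :: 'b
    have "(\<integral>\<^sup>+y. ennreal (model_dens p c \<theta> x u y) * indicator A (x, u) \<partial>lborel)
      = (\<integral>\<^sup>+y. ennreal (normal_dens p (x - \<theta>)) * ennreal (normal_dens p (u - 0)) * indicator A (x, u) * ennreal (normal_dens p (y + - (c *\<^sub>R \<theta>))) \<partial>lborel)"
      by (intro nn_integral_cong) (simp add: model_dens_def ennreal_mult mult_ac)
    also have "\<dots> = ennreal (normal_dens p (x - \<theta>)) * ennreal (normal_dens p (u - 0)) * indicator A (x, u) * (\<integral>\<^sup>+y. ennreal (normal_dens p (y + - (c *\<^sub>R \<theta>))) \<partial>lborel)"
      by (rule nn_integral_cmult) measurable
    also have "(\<integral>\<^sup>+y. ennreal (normal_dens p (y + - (c *\<^sub>R \<theta>))) \<partial>lborel) = (\<integral>\<^sup>+y. ennreal (normal_dens p (y::'a)) \<partial>lborel)"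
      by (rule nn_integral_lborel_shift) measurable
    finally show "(\<integral>\<^sup>+y. ennreal (model_dens p c \<theta> x u y) * indicator A (x, u) \<partial>lborel)
      = ennreal (normal_dens p (x - \<theta>)) * ennreal (normal_dens p (u - 0)) * indicator A (x, u)"
      using p by (simp add: nn_integral_normal_dens)
  qed
  also have "\<dots> = (\<integral>\<^sup>+z. indicator A z \<partial>(normal_law p \<theta> \<Otimes>\<^sub>M normal_law p (0::'b)))"
    by (rule nn_integral_pair_normal_law[symmetric, OF p p]) measurable
  also have "\<dots> = emeasure (normal_law p \<theta> \<Otimes>\<^sub>M normal_law p (0::'b)) A"
    by (rule nn_integral_indicator[OF A'])
  finally show "emeasure (distr (model_law p c \<theta>) (borel \<Otimes>\<^sub>M borel) (\<lambda>(x, u, y). (x, u))) A = \<dots>" .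
qed

lemma nn_integral_affine_euclidean:
  fixes h :: "'a::euclidean_space \<Rightarrow> ennreal"
  assumes [measurable]: "h \<in> borel_measurable borel" and k: "k > 0"
  shows "(\<integral>\<^sup>+y. h y \<partial>lborel) = ennreal (k ^ DIM('a)) * (\<integral>\<^sup>+z. h (k *\<^sub>R z + a) \<partial>lborel)"
  using nn_integral_lborel_shift[of h a] nn_integral_lborel_scale[of "\<lambda>y. h (y + a)" k] k by simp

text \<open>The densities correspond pointwise by \<open>model_dens_rotate\<close>. The linear
  change of variables is split into the affine substitution \<open>y = k z + c x\<close>, a
  rescaling of \<open>u\<close>, and a shear of \<open>x\<close> by \<open>c z\<close>.\<close>

lemma distr_model_law_rotate:
  fixes \<theta> :: "'a::euclidean_space"
  assumes p: "p > 0"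
  shows "distr (model_law p c \<theta>) (borel \<Otimes>\<^sub>M borel) (\<lambda>(x, u, y). (pooled c x y, residual c x u y))
    = normal_law ((1 + c\<^sup>2) * p) \<theta> \<Otimes>\<^sub>M normal_law ((1 + c\<^sup>2) * p) (0::'b::euclidean_space \<times> 'a)"
proof (rule measure_eqI)
  define k where "k = 1 + c\<^sup>2"
  have k: "k > 0" unfolding k_def by (rule one_plus_square_pos)
  have kp: "k * p > 0" using k p by simp
  let ?T = "\<lambda>(x, u, y). (pooled c x y, residual c x (u::'b) y)"
  let ?N = "normal_law (k * p) \<theta> \<Otimes>\<^sub>M normal_law (k * p) (0::'b \<times> 'a)"
  have T: "?T \<in> measurable (model_law p c \<theta>) (borel \<Otimes>\<^sub>M borel)"
    unfolding measurable_cong_sets[OF sets_model_law refl] borel_prod[symmetric] pooled_def residual_def by measurable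
  show "sets (distr (model_law p c \<theta>) (borel \<Otimes>\<^sub>M borel) ?T) = sets (normal_law ((1 + c\<^sup>2) * p) \<theta> \<Otimes>\<^sub>M normal_law ((1 + c\<^sup>2) * p) (0::'b \<times> 'a))"
    by (simp cong: sets_pair_measure_cong)
  fix A assume "A \<in> sets (distr (model_law p c \<theta>) (borel \<Otimes>\<^sub>M borel) ?T)"
  hence A [measurable]: "A \<in> sets (borel \<Otimes>\<^sub>M borel)" by simp
  hence A3 [measurable]: "A \<in> sets (borel \<Otimes>\<^sub>M borel \<Otimes>\<^sub>M borel)" by (simp only: borel_prod)
  have A': "A \<in> sets ?N"
    using A by (simp cong: sets_pair_measure_cong)
  define \<Phi> where "\<Phi> w u z = ennreal (normal_dens (k * p) (w - \<theta>)) * ennreal (normal_dens (k * p) u) * ennreal (normal_dens (k * p) z) * indicator A (w, u, z)"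
    for w z :: 'a and u :: 'b
  have model_dens: "ennreal (k ^ DIM('a)) * (ennreal (sqrt k ^ DIM('b)) * (ennreal (model_dens p c \<theta> x u y) * indicator A (pooled c x y, residual c x u y)))
    = \<Phi> (pooled c x y) ((1 / sqrt k) *\<^sub>R u) ((1 / k) *\<^sub>R (y - c *\<^sub>R x))" for x u y
  proof -
    have "rotation_jac c DIM('a) DIM('b) * model_dens p c \<theta> x u y =
      normal_dens (k * p) (pooled c x y - \<theta>) * normal_dens (k * p) ((1 / sqrt k) *\<^sub>R u) * normal_dens (k * p) ((1 / k) *\<^sub>R (y - c *\<^sub>R x))"
      using model_dens_rotate[OF p, of c \<theta> x u y]
      by (simp add: residual_def normal_dens_Pair kp[unfolded k_def] normal_dens_minus_commute[of _ \<theta>] k_def mult.assoc)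
    hence "ennreal (k ^ DIM('a) * (sqrt k ^ DIM('b) * model_dens p c \<theta> x u y)) =
      ennreal (normal_dens (k * p) (pooled c x y - \<theta>) * normal_dens (k * p) ((1 / sqrt k) *\<^sub>R u) * normal_dens (k * p) ((1 / k) *\<^sub>R (y - c *\<^sub>R x)))"
      by (simp add: rotation_jac_def k_def mult_ac)
    thus ?thesis using k
      by (simp add: \<Phi>_def residual_def k_def[symmetric] ennreal_mult mult.assoc[symmetric])
  qed
  have "emeasure (distr (model_law p c \<theta>) (borel \<Otimes>\<^sub>M borel) ?T) A = (\<integral>\<^sup>+t. indicator A (?T t) \<partial>model_law p c \<theta>)"
    using nn_integral_distr[OF T, of "indicator A"] by simp
  also have "\<dots> = (\<integral>\<^sup>+x. \<integral>\<^sup>+u. \<integral>\<^sup>+y. ennreal (model_dens p c \<theta> x u y) * indicator A (pooled c x y, residual c x u y) \<partial>lborel \<partial>lborel \<partial>lborel)"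
  proof (subst nn_integral_model_law)
    have "(\<lambda>t. indicator A (?T t) :: ennreal) \<in> borel_measurable (model_law p c \<theta>)"
      using measurable_comp[OF T borel_measurable_indicator[OF A]] by (simp add: comp_def)
    thus "(\<lambda>t. indicator A (?T t) :: ennreal) \<in> borel_measurable borel"
      by (simp add: measurable_cong_sets[OF sets_model_law refl])
  qed simp
  also have "\<dots> = (\<integral>\<^sup>+x. \<integral>\<^sup>+u. \<integral>\<^sup>+z. \<Phi> (x + c *\<^sub>R z) u z \<partial>lborel \<partial>lborel \<partial>lborel)"
  proof (rule nn_integral_cong, goal_cases)
    case _: (1 x)
    have 1: "(\<integral>\<^sup>+y. ennreal (model_dens p c \<theta> x u y) * indicator A (pooled c x y, residual c x u y) \<partial>lborel)
      = (\<integral>\<^sup>+z. ennreal (k ^ DIM('a)) * (ennreal (model_dens p c \<theta> x u (k *\<^sub>R z + c *\<^sub>R x)) * indicator A (pooled c x (k *\<^sub>R z + c *\<^sub>R x), residual c x u (k *\<^sub>R z + c *\<^sub>R x))) \<partial>lborel)" for u :: 'b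
    proof -
      have [measurable]: "(\<lambda>y. ennreal (model_dens p c \<theta> x u y) * indicator A (pooled c x y, residual c x u y)) \<in> borel_measurable borel"
        unfolding pooled_def residual_def by measurable
      show ?thesis
        by (subst nn_integral_affine_euclidean[OF _ k, of _ "c *\<^sub>R x"], measurable, rule nn_integral_cmult[symmetric])
          (unfold pooled_def residual_def, measurable)
    qed
    have arg: "pooled c x (k *\<^sub>R z + c *\<^sub>R x) = x + c *\<^sub>R z" "(1 / k) *\<^sub>R (k *\<^sub>R z + c *\<^sub>R x - c *\<^sub>R x) = z" for z
    proof -
      have "x + c *\<^sub>R (k *\<^sub>R z + c *\<^sub>R x) = k *\<^sub>R (x + c *\<^sub>R z)"
        by (simp add: k_def scaleR_add_right scaleR_add_left power2_eq_square algebra_simps)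
      thus "pooled c x (k *\<^sub>R z + c *\<^sub>R x) = x + c *\<^sub>R z"
        using k unfolding pooled_def k_def[symmetric] by simp
      show "(1 / k) *\<^sub>R (k *\<^sub>R z + c *\<^sub>R x - c *\<^sub>R x) = z" using k by simp
    qed
    have 2: "(\<integral>\<^sup>+u. \<integral>\<^sup>+y. ennreal (model_dens p c \<theta> x u y) * indicator A (pooled c x y, residual c x u y) \<partial>lborel \<partial>lborel)
      = (\<integral>\<^sup>+u. ennreal (1 / sqrt k ^ DIM('b)) * (\<integral>\<^sup>+z. \<Phi> (x + c *\<^sub>R z) ((1 / sqrt k) *\<^sub>R u) z \<partial>lborel) \<partial>lborel)"
    proof (rule nn_integral_cong, goal_cases)
      case _: (1 u)
      have "(\<integral>\<^sup>+y. ennreal (model_dens p c \<theta> x u y) * indicator A (pooled c x y, residual c x u y) \<partial>lborel)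
        = (\<integral>\<^sup>+z. ennreal (1 / sqrt k ^ DIM('b)) * \<Phi> (x + c *\<^sub>R z) ((1 / sqrt k) *\<^sub>R u) z \<partial>lborel)"
        unfolding 1
      proof (rule nn_integral_cong, goal_cases)
        case _: (1 z)
        have e: "e = ennreal (1 / sqrt k ^ DIM('b)) * (ennreal (sqrt k ^ DIM('b)) * e)" for e
          using k by (simp add: mult.assoc[symmetric] ennreal_mult[symmetric])
        show ?case
          using model_dens[of x u "k *\<^sub>R z + c *\<^sub>R x"] unfolding arg
          by (subst e) (simp add: mult.left_commute)
      qed
      also have "\<dots> = ennreal (1 / sqrt k ^ DIM('b)) * (\<integral>\<^sup>+z. \<Phi> (x + c *\<^sub>R z) ((1 / sqrt k) *\<^sub>R u) z \<partial>lborel)"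
        by (rule nn_integral_cmult) (unfold \<Phi>_def, measurable)
      finally show ?case .
    qed
    have "(\<integral>\<^sup>+u. \<integral>\<^sup>+z. \<Phi> (x + c *\<^sub>R z) u z \<partial>lborel \<partial>lborel)
      = ennreal ((1 / sqrt k) ^ DIM('b)) * (\<integral>\<^sup>+u. \<integral>\<^sup>+z. \<Phi> (x + c *\<^sub>R z) ((1 / sqrt k) *\<^sub>R u) z \<partial>lborel \<partial>lborel)"
      using k by (intro nn_integral_lborel_scale) (unfold \<Phi>_def, measurable)
    also have "\<dots> = (\<integral>\<^sup>+u. ennreal (1 / sqrt k ^ DIM('b)) * (\<integral>\<^sup>+z. \<Phi> (x + c *\<^sub>R z) ((1 / sqrt k) *\<^sub>R u) z \<partial>lborel) \<partial>lborel)"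
      by (subst nn_integral_cmult) (unfold \<Phi>_def, measurable, simp add: power_divide)
    finally show ?case using 2 by simp
  qed
  \<comment> \<open>Bringing the integral over \<open>x\<close> to the innermost place lets
    translation invariance remove the shear \<open>x + c *\<^sub>R z\<close>.\<close>
  also have "\<dots> = (\<integral>\<^sup>+u. \<integral>\<^sup>+x. \<integral>\<^sup>+z. \<Phi> (x + c *\<^sub>R z) u z \<partial>lborel \<partial>lborel \<partial>lborel)"
    by (rule nn_integral_swap_lborel) (unfold \<Phi>_def, measurable)
  also have "\<dots> = (\<integral>\<^sup>+u. \<integral>\<^sup>+z. \<integral>\<^sup>+x. \<Phi> (x + c *\<^sub>R z) u z \<partial>lborel \<partial>lborel \<partial>lborel)"
    by (intro nn_integral_cong nn_integral_swap_lborel) (unfold \<Phi>_def, measurable)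
  also have "\<dots> = (\<integral>\<^sup>+u. \<integral>\<^sup>+z. \<integral>\<^sup>+x. \<Phi> x u z \<partial>lborel \<partial>lborel \<partial>lborel)"
    by (intro nn_integral_cong nn_integral_lborel_shift[of "\<lambda>x. \<Phi> x u z" for u z]) (unfold \<Phi>_def, measurable)
  also have "\<dots> = (\<integral>\<^sup>+u. \<integral>\<^sup>+x. \<integral>\<^sup>+z. \<Phi> x u z \<partial>lborel \<partial>lborel \<partial>lborel)"
    by (intro nn_integral_cong nn_integral_swap_lborel) (unfold \<Phi>_def, measurable)
  also have "\<dots> = (\<integral>\<^sup>+x. \<integral>\<^sup>+u. \<integral>\<^sup>+z. \<Phi> x u z \<partial>lborel \<partial>lborel \<partial>lborel)"
    by (rule nn_integral_swap_lborel) (unfold \<Phi>_def, measurable)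
  also have "\<dots> = (\<integral>\<^sup>+x. \<integral>\<^sup>+v. ennreal (normal_dens (k * p) (x - \<theta>)) * ennreal (normal_dens (k * p) (v - 0)) * indicator A (x, v) \<partial>lborel \<partial>lborel)"
  proof (rule nn_integral_cong, goal_cases)
    case _: (1 x)
    define f where "f v = ennreal (normal_dens (k * p) (x - \<theta>)) * ennreal (normal_dens (k * p) (v - 0)) * indicator A (x, v)" for v
    have "f \<in> borel_measurable borel" unfolding f_def by measurable
    hence "f \<in> borel_measurable (lborel \<Otimes>\<^sub>M lborel)" by (simp add: lborel_prod)
    from lborel.nn_integral_fst[OF this]
    have "(\<integral>\<^sup>+v. f v \<partial>lborel) = (\<integral>\<^sup>+u. \<integral>\<^sup>+z. f (u, z) \<partial>lborel \<partial>lborel)"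
      by (simp add: lborel_prod)
    also have "\<dots> = (\<integral>\<^sup>+u. \<integral>\<^sup>+z. \<Phi> x u z \<partial>lborel \<partial>lborel)"
      using kp by (intro nn_integral_cong) (simp add: f_def \<Phi>_def normal_dens_Pair ennreal_mult mult.assoc)
    finally show ?case
      unfolding f_def by (rule sym)
  qed
  also have "\<dots> = (\<integral>\<^sup>+z. indicator A z \<partial>?N)"
    by (rule nn_integral_pair_normal_law[symmetric, OF kp kp]) measurable
  also have "\<dots> = emeasure ?N A"
    by (rule nn_integral_indicator[OF A'])
  finally show "emeasure (distr (model_law p c \<theta>) (borel \<Otimes>\<^sub>M borel) ?T) A
    = emeasure (normal_law ((1 + c\<^sup>2) * p) \<theta> \<Otimes>\<^sub>M normal_law ((1 + c\<^sup>2) * p) (0::'b \<times> 'a)) A"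
    by (simp add: k_def)
qed

text \<open>The logarithm of the quotient of the harmonic and the flat predictive density, hence the
  loss of the flat one minus that of the harmonic one. It contains neither the parameters nor
  \<open>f\<close>.\<close>

definition log_gain :: "real \<Rightarrow> 'a::euclidean_space \<times> 'b::euclidean_space \<times> 'a \<Rightarrow> real" where
  "log_gain c = (\<lambda>(x, u, y).
     ln (psi (real DIM('a) / 2 - 1) (real DIM('b \<times> 'a) / 2) ((norm (pooled c x y))\<^sup>2) ((norm (residual c x u y))\<^sup>2))
     - ln (psi (real DIM('a) / 2 - 1) (real DIM('b) / 2) ((norm x)\<^sup>2) ((norm u)\<^sup>2)))"

text \<open>Each of the two logarithms is integrable by itself, so the mean splits. The
  push-forwards to the rotated observation and to \<open>(x, u)\<close> are products of normal laws,
  which turns the parts into \<open>mean_ln_psi\<close> with residual types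
  \<open>'b \<times> 'a\<close> and \<open>'b\<close>.\<close>

lemma log_gain_expected_pos:
  fixes \<theta> :: "'a::euclidean_space"
  assumes d: "DIM('a) \<ge> 3" and p: "p > 0" and c: "c > 0"
  shows "integrable (model_law p c \<theta> :: ('a \<times> 'b::euclidean_space \<times> 'a) measure) (log_gain c)"
    and "(\<integral>t. log_gain c t \<partial>(model_law p c \<theta> :: ('a \<times> 'b \<times> 'a) measure)) > 0"
proof -
  define a b b' where "a = real DIM('a) / 2 - 1" and "b = real DIM('b) / 2" and "b' = real DIM('b \<times> 'a) / 2"
  have ab: "a > 0" "b > 0" "b' > 0" using d by (auto simp: a_def b_def b'_def)
  define k where "k = 1 + c\<^sup>2"
  have k: "k > 1" using c by (simp add: k_def)
  have kp: "k * p > 0" using k p by simp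
  let ?P = "model_law p c \<theta> :: ('a \<times> 'b \<times> 'a) measure"
  let ?T = "\<lambda>(x, u, y). (pooled c x y, residual c x (u::'b) y)"
  define h' where "h' z = ln (psi a b' ((norm (fst z))\<^sup>2) ((norm (snd z))\<^sup>2))" for z :: "'a \<times> 'b \<times> 'a"
  define h where "h z = ln (psi a b ((norm (fst z))\<^sup>2) ((norm (snd z))\<^sup>2))" for z :: "'a \<times> 'b"
  have [measurable]: "h' \<in> borel_measurable (borel \<Otimes>\<^sub>M borel)" "h \<in> borel_measurable (borel \<Otimes>\<^sub>M borel)"
    unfolding h'_def h_def using ab by measurable
  have T: "?T \<in> measurable ?P (borel \<Otimes>\<^sub>M borel)"
    unfolding measurable_cong_sets[OF sets_model_law refl] borel_prod[symmetric] pooled_def residual_def by measurable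
  have S: "(\<lambda>(x, u, y). (x, u)) \<in> measurable ?P (borel \<Otimes>\<^sub>M borel)"
    unfolding measurable_cong_sets[OF sets_model_law refl] borel_prod[symmetric] by measurable
  note dT = distr_model_law_rotate[OF p, of c \<theta>, where 'b='b, folded k_def]
  note dS = distr_model_law_xu[OF p, of c \<theta>, where 'b='b]
  have "integrable (distr ?P (borel \<Otimes>\<^sub>M borel) ?T) h'"
    unfolding dT h'_def by (rule integrable_pair_ln_psi[OF ab(1,3) kp kp])
  hence 1: "integrable ?P (\<lambda>t. h' (?T t))" by (rule integrable_distr[OF T])
  have "integrable (distr ?P (borel \<Otimes>\<^sub>M borel) (\<lambda>(x, u, y). (x, u))) h"
    unfolding dS h_def by (rule integrable_pair_ln_psi[OF ab(1,2) p p])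
  hence 2: "integrable ?P (\<lambda>t. h (case t of (x, u, y) \<Rightarrow> (x, u)))" by (rule integrable_distr[OF S])
  have 3: "log_gain c = (\<lambda>t. h' (?T t) - h (case t of (x, u, y) \<Rightarrow> (x, u)))"
    by (auto simp: log_gain_def h'_def h_def a_def b_def b'_def)
  show "integrable ?P (log_gain c)" unfolding 3 using 1 2 by (rule Bochner_Integration.integrable_diff)
  have "(\<integral>t. log_gain c t \<partial>?P) = (\<integral>t. h' (?T t) \<partial>?P) - (\<integral>t. h (case t of (x, u, y) \<Rightarrow> (x, u)) \<partial>?P)"
    unfolding 3 using 1 2 by (rule Bochner_Integration.integral_diff)
  also have "(\<integral>t. h' (?T t) \<partial>?P) = (\<integral>z. h' z \<partial>distr ?P (borel \<Otimes>\<^sub>M borel) ?T)"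
    by (rule integral_distr[OF T, symmetric]) measurable
  also have "\<dots> = mean_ln_psi \<theta> TYPE('b \<times> 'a) (k * p) (k * p)"
    unfolding dT mean_ln_psi_def h'_def a_def b'_def by (rule refl)
  also have "(\<integral>t. h (case t of (x, u, y) \<Rightarrow> (x, u)) \<partial>?P) = (\<integral>z. h z \<partial>distr ?P (borel \<Otimes>\<^sub>M borel) (\<lambda>(x, u, y). (x, u)))"
    by (rule integral_distr[OF S, symmetric]) measurable
  also have "\<dots> = mean_ln_psi \<theta> TYPE('b) p p"
    unfolding dS mean_ln_psi_def h_def a_def b_def by (rule refl)
  finally show "(\<integral>t. log_gain c t \<partial>?P) > 0"
    using mean_ln_psi_less[OF d p k, of \<theta>, where 'b='b and 'c="'b \<times> 'a"] by simp
qed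

section \<open>Scale mixtures\<close>

text \<open>Away from the origin the exponential beats the power as the precision grows, so the
  bound is uniform in \<open>p\<close>. This keeps the mixed densities finite at
  \<open>u \<noteq> 0\<close> for every mixing distribution.\<close>

lemma normal_dens_bounded:
  fixes v :: "'a::euclidean_space"
  assumes "v \<noteq> 0"
  shows "\<exists>K. \<forall>p>0. normal_dens p v \<le> K"
proof -
  define q where "q = real DIM('a) / 2"
  have q: "q > 0" by (simp add: q_def)
  define s where "s = (norm v)\<^sup>2"
  have s: "s > 0" using assms by (simp add: s_def)
  have t: "t powr q * exp (- t) \<le> q powr q" if t: "t > 0" for t
  proof -
    have "ln (t / q) \<le> t / q - 1" using t q by (intro ln_le_minus_one) simp
    hence "q * ln (t / q) \<le> q * (t / q - 1)" using q by (intro mult_left_mono) auto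
    hence "q * ln t - t \<le> q * ln q" using t q by (simp add: ln_div algebra_simps)
    hence "exp (q * ln t - t) \<le> exp (q * ln q)" by simp
    thus ?thesis using t q by (simp add: powr_def exp_diff exp_minus field_simps)
  qed
  have "normal_dens p v \<le> (1 / (pi * s)) powr q * q powr q" if p: "p > 0" for p
  proof -
    have "normal_dens p v = (1 / (pi * s) * (p * s / 2)) powr q * exp (- (p * s / 2))"
      using s by (simp add: normal_dens_def q_def s_def mult.commute)
    also have "\<dots> = (1 / (pi * s)) powr q * ((p * s / 2) powr q * exp (- (p * s / 2)))"
      using p s powr_mult[of "1 / (pi * s)" "p * s / 2" q] by simp
    also have "\<dots> \<le> (1 / (pi * s)) powr q * q powr q"
      using p s by (intro mult_left_mono t) auto
    finally show ?thesis .
  qed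
  thus ?thesis by blast
qed

lemma AE_lborel_pair:
  fixes P :: "'a::euclidean_space \<times> 'b::euclidean_space \<Rightarrow> bool"
  assumes [measurable]: "Measurable.pred (borel \<Otimes>\<^sub>M borel) P" and ae: "AE x in lborel. AE y in lborel. P (x, y)"
  shows "AE z in lborel. P z"
proof -
  have "AE z in lborel \<Otimes>\<^sub>M lborel. P z"
    by (rule lborel_pair.AE_pair_measure[OF _ ae]) measurable
  thus ?thesis unfolding lborel_prod .
qed

text \<open>Collects the conditions under which the formulas for the predictive densities hold.
  Given \<open>x\<close>, the last one fails for a single \<open>y\<close>, which is where
  \<open>c \<noteq> 0\<close> enters.\<close>

lemma AE_lborel_nondegenerate:
  assumes c: "c \<noteq> 0"
  shows "AE (x, u, y) in lborel. x \<noteq> (0::'a::euclidean_space) \<and> u \<noteq> (0::'b::euclidean_space) \<and> pooled c x y \<noteq> 0"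
proof (rule AE_lborel_pair)
  show "Measurable.pred (borel \<Otimes>\<^sub>M borel) (\<lambda>(x, u, y). x \<noteq> (0::'a) \<and> u \<noteq> (0::'b) \<and> pooled c x y \<noteq> 0)"
    unfolding pooled_def borel_prod[symmetric] by measurable
  have "AE v in lborel. case v of (u, y) \<Rightarrow> u \<noteq> (0::'b) \<and> pooled c x y \<noteq> 0" for x :: 'a
  proof (rule AE_lborel_pair)
    show "Measurable.pred (borel \<Otimes>\<^sub>M borel) (\<lambda>(u, y). u \<noteq> (0::'b) \<and> pooled c x y \<noteq> 0)"
      unfolding pooled_def by measurable
    have ne: "pooled c x y \<noteq> 0" if "y \<noteq> - (1 / c) *\<^sub>R x" for y
    proof
      assume "pooled c x y = 0"
      hence "x + c *\<^sub>R y = 0" using one_plus_square_pos[of c] by (simp add: pooled_def)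
      hence "c *\<^sub>R y = - x" by (simp add: add_eq_0_iff)
      hence "(1 / c) *\<^sub>R (c *\<^sub>R y) = (1 / c) *\<^sub>R (- x)" by simp
      thus False using c that by simp
    qed
    show "AE u in lborel. AE y in lborel. case (u, y) of (u, y) \<Rightarrow> u \<noteq> (0::'b) \<and> pooled c x y \<noteq> 0"
      using AE_lborel_singleton[of "0::'b"]
    proof eventually_elim
      case _: (elim u)
      thus ?case
        using AE_lborel_singleton[of "- (1 / c) *\<^sub>R x"] ne by (auto elim!: eventually_mono)
    qed
  qed
  thus "AE x in lborel. AE v in lborel. case (x, v) of (x, u, y) \<Rightarrow> x \<noteq> (0::'a) \<and> u \<noteq> (0::'b) \<and> pooled c x y \<noteq> 0"
    using AE_lborel_singleton[of "0::'a"] by (auto elim!: eventually_mono)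
qed

section \<open>Normal models mixed over a positive variance factor\<close>

locale positive_distribution = real_distribution G for G +
  assumes cdf_0: "cdf G 0 = 0"
begin

lemma AE_pos: "AE z in G. z > 0"
proof -
  have "emeasure G {..0} = 0" using cdf_0 by (simp add: cdf_def emeasure_eq_measure)
  thus ?thesis by (intro AE_I[where N = "{..0}"]) auto
qed

text \<open>The point at which the mixing distribution drops out: for fixed \<open>z\<close> the
  dilation by \<open>1 / z\<close> preserves \<open>haar\<close>, and \<open>G\<close> has total
  mass one.\<close>

lemma nn_integral_mixture_haar:
  assumes [measurable]: "F \<in> borel_measurable borel"
  shows "(\<integral>\<^sup>+\<eta>. \<integral>\<^sup>+z. F (\<eta> / z) \<partial>G \<partial>haar) = (\<integral>\<^sup>+p. F p \<partial>haar)"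
proof -
  have "(\<integral>\<^sup>+\<eta>. \<integral>\<^sup>+z. F (\<eta> / z) \<partial>G \<partial>haar) = (\<integral>\<^sup>+z. \<integral>\<^sup>+\<eta>. F (\<eta> / z) \<partial>haar \<partial>G)"
    by (rule nn_integral_swap[OF haar.sigma_finite_measure_axioms sigma_finite_measure_axioms]) measurable
  also have "\<dots> = (\<integral>\<^sup>+z. (\<integral>\<^sup>+p. F p \<partial>haar) \<partial>G)"
  proof (rule nn_integral_cong_AE, use AE_pos in eventually_elim, goal_cases)
    case _: (1 z)
    thus ?case
      using nn_integral_haar_scale[of F "1 / z"] by simp
  qed
  also have "\<dots> = (\<integral>\<^sup>+p. F p \<partial>haar)" using emeasure_space_1 by simp
  finally show ?thesis .
qed

lemma nn_integral_pos_bounded: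
  assumes [measurable]: "h \<in> borel_measurable borel"
    and pos: "\<And>z. z > 0 \<Longrightarrow> h z > 0" and bound: "\<And>z. z > 0 \<Longrightarrow> h z \<le> K"
  shows "(\<integral>\<^sup>+z. ennreal (h z) \<partial>G) \<noteq> 0" "(\<integral>\<^sup>+z. ennreal (h z) \<partial>G) \<noteq> \<top>"
proof -
  show "(\<integral>\<^sup>+z. ennreal (h z) \<partial>G) \<noteq> 0"
  proof
    assume "(\<integral>\<^sup>+z. ennreal (h z) \<partial>G) = 0"
    hence "AE z in G. ennreal (h z) = 0" by (subst (asm) nn_integral_0_iff_AE) auto
    hence "AE z in G. False" using AE_pos
      by eventually_elim (use pos in \<open>auto simp: ennreal_eq_0_iff not_le[symmetric] dest: leD\<close>)
    thus False by simp
  qed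
  have "(\<integral>\<^sup>+z. ennreal (h z) \<partial>G) \<le> (\<integral>\<^sup>+z. ennreal K \<partial>G)"
    by (rule nn_integral_mono_AE) (use AE_pos in eventually_elim, use bound in \<open>auto intro: ennreal_leI\<close>)
  also have "\<dots> < \<top>" using emeasure_space_1 by simp
  finally show "(\<integral>\<^sup>+z. ennreal (h z) \<partial>G) \<noteq> \<top>" by simp
qed

definition mixed_model_dens :: "real \<Rightarrow> 'a::euclidean_space \<Rightarrow> real \<Rightarrow> 'a \<Rightarrow> 'b::euclidean_space \<Rightarrow> 'a \<Rightarrow> ennreal" where
  "mixed_model_dens c \<theta> \<eta> x u y = (\<integral>\<^sup>+z. ennreal (model_dens (\<eta> / z) c \<theta> x u y) \<partial>G)"

definition mixed_marginal :: "'a::euclidean_space \<Rightarrow> real \<Rightarrow> 'a \<Rightarrow> 'b::euclidean_space \<Rightarrow> ennreal" where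
  "mixed_marginal \<theta> \<eta> x u = (\<integral>\<^sup>+z. ennreal (normal_dens (\<eta> / z) (x - \<theta>) * normal_dens (\<eta> / z) u) \<partial>G)"

lemma mixed_model_dens_measurable [measurable]:
  assumes [measurable]: "\<theta> \<in> borel_measurable M" "\<eta> \<in> borel_measurable M" "x \<in> borel_measurable M"
    "u \<in> borel_measurable M" "y \<in> borel_measurable M"
  shows "(\<lambda>t. mixed_model_dens c (\<theta> t) (\<eta> t) (x t) (u t) (y t)) \<in> borel_measurable M"
  unfolding mixed_model_dens_def by measurable

lemma mixed_marginal_measurable [measurable]:
  assumes [measurable]: "\<theta> \<in> borel_measurable M" "\<eta> \<in> borel_measurable M" "x \<in> borel_measurable M"
    "u \<in> borel_measurable M"
  shows "(\<lambda>t. mixed_marginal (\<theta> t) (\<eta> t) (x t) (u t)) \<in> borel_measurable M"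
  unfolding mixed_marginal_def by measurable

lemma nn_integral_mixed_model_dens:
  assumes \<eta>: "\<eta> > 0"
  shows "(\<integral>\<^sup>+y. mixed_model_dens c \<theta> \<eta> x u y \<partial>lborel) = mixed_marginal \<theta> \<eta> x (u::'b::euclidean_space)"
proof -
  have "(\<integral>\<^sup>+y. mixed_model_dens c \<theta> \<eta> x u y \<partial>lborel) = (\<integral>\<^sup>+z. \<integral>\<^sup>+y. ennreal (model_dens (\<eta> / z) c \<theta> x u y) \<partial>lborel \<partial>G)"
    unfolding mixed_model_dens_def
    by (rule nn_integral_swap[OF sigma_finite_lborel sigma_finite_measure_axioms]) measurable
  also have "\<dots> = mixed_marginal \<theta> \<eta> x u"
    unfolding mixed_marginal_def
  proof (rule nn_integral_cong_AE, use AE_pos in eventually_elim, goal_cases)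
    case _: (1 z)
    hence p: "\<eta> / z > 0" using \<eta> by simp
    have "(\<integral>\<^sup>+y. ennreal (model_dens (\<eta> / z) c \<theta> x u y) \<partial>lborel)
      = (\<integral>\<^sup>+y. ennreal (normal_dens (\<eta> / z) (x - \<theta>) * normal_dens (\<eta> / z) u) * ennreal (normal_dens (\<eta> / z) (y + - (c *\<^sub>R \<theta>))) \<partial>lborel)"
      by (intro nn_integral_cong) (simp add: model_dens_def ennreal_mult mult_ac)
    also have "\<dots> = ennreal (normal_dens (\<eta> / z) (x - \<theta>) * normal_dens (\<eta> / z) u) * (\<integral>\<^sup>+y. ennreal (normal_dens (\<eta> / z) (y + - (c *\<^sub>R \<theta>))) \<partial>lborel)"
      by (rule nn_integral_cmult) measurable
    also have "(\<integral>\<^sup>+y. ennreal (normal_dens (\<eta> / z) (y + - (c *\<^sub>R \<theta>))) \<partial>lborel) = (\<integral>\<^sup>+y. ennreal (normal_dens (\<eta> / z) (y::'a)) \<partial>lborel)"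
      by (rule nn_integral_lborel_shift) measurable
    finally show ?case
      using nn_integral_normal_dens[OF p, where 'a='a] by simp
  qed
  finally show ?thesis .
qed

lemma mixed_model_dens_pos_finite:
  assumes \<eta>: "\<eta> > 0" and u: "u \<noteq> 0"
  shows "mixed_model_dens c \<theta> \<eta> x u y \<noteq> 0" "mixed_model_dens c \<theta> \<eta> x u y \<noteq> \<top>"
proof -
  obtain K where K: "\<forall>p>0. normal_dens p (x - \<theta>, u, y - c *\<^sub>R \<theta>) \<le> K"
    using normal_dens_bounded[of "(x - \<theta>, u, y - c *\<^sub>R \<theta>)"] u by (auto simp: zero_prod_def)
  have eq: "model_dens (\<eta> / z) c \<theta> x u y = normal_dens (\<eta> / z) (x - \<theta>, u, y - c *\<^sub>R \<theta>)" if "z > 0" for z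
    using that \<eta> by (simp add: model_dens_def normal_dens_Pair mult.assoc)
  show "mixed_model_dens c \<theta> \<eta> x u y \<noteq> 0"
    unfolding mixed_model_dens_def
    by (rule nn_integral_pos_bounded(1)[where K = K]) (use K eq \<eta> in \<open>auto simp: normal_dens_pos\<close>)
  show "mixed_model_dens c \<theta> \<eta> x u y \<noteq> \<top>"
    unfolding mixed_model_dens_def
    by (rule nn_integral_pos_bounded(2)[where K = K]) (use K eq \<eta> in \<open>auto simp: normal_dens_pos\<close>)
qed

lemma mixed_marginal_pos_finite:
  assumes \<eta>: "\<eta> > 0" and u: "u \<noteq> 0"
  shows "mixed_marginal \<theta> \<eta> x u \<noteq> 0" "mixed_marginal \<theta> \<eta> x u \<noteq> \<top>"
proof -
  obtain K where K: "\<forall>p>0. normal_dens p (x - \<theta>, u) \<le> K"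
    using normal_dens_bounded[of "(x - \<theta>, u)"] u by (auto simp: zero_prod_def)
  have eq: "normal_dens (\<eta> / z) (x - \<theta>) * normal_dens (\<eta> / z) u = normal_dens (\<eta> / z) (x - \<theta>, u)" if "z > 0" for z
    using that \<eta> by (simp add: normal_dens_Pair)
  show "mixed_marginal \<theta> \<eta> x u \<noteq> 0"
    unfolding mixed_marginal_def
    by (rule nn_integral_pos_bounded(1)[where K = K]) (use K eq \<eta> in \<open>auto simp: normal_dens_pos\<close>)
  show "mixed_marginal \<theta> \<eta> x u \<noteq> \<top>"
    unfolding mixed_marginal_def
    by (rule nn_integral_pos_bounded(2)[where K = K]) (use K eq \<eta> in \<open>auto simp: normal_dens_pos\<close>)
qed

end

text \<open>The argument \<open>dk\<close> carries no data; it fixes the types \<open>'d\<close> and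
  \<open>'k\<close>, on whose cardinalities the assumption on \<open>f\<close> depends.\<close>

locale mixture_model = positive_distribution G for G +
  fixes f :: "real \<Rightarrow> ennreal" and dk :: "('d::finite \<times> 'k::finite) itself"
  assumes f_eq: "t \<ge> 0 \<Longrightarrow> f t = (\<integral>\<^sup>+z\<in>{0<..}. ennreal (z powr (- real (2 * CARD('d) + CARD('k)) / 2) *
      std_normal_generator (2 * CARD('d) + CARD('k)) (t / z)) \<partial>G)"
begin

lemma joint_density_eq:
  fixes \<theta> x y :: "real^'d" and u :: "real^'k"
  assumes \<eta>: "\<eta> > 0"
  shows "joint_density c f \<theta> \<eta> x u y = mixed_model_dens c \<theta> \<eta> x u y"
proof -
  define m where "m = real CARD('d) + real CARD('k) / 2"
  define A where "A = (norm (x - \<theta>))\<^sup>2 + (norm u)\<^sup>2 + (norm (y - c *\<^sub>R \<theta>))\<^sup>2"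
  have A: "A \<ge> 0" by (simp add: A_def)
  have n: "- real (2 * CARD('d) + CARD('k)) / 2 = - m" by (simp add: m_def add_divide_distrib)
  have model_dens: "\<eta> powr m * (z powr (- m) * ((2 * pi) powr (- m) * exp (- (\<eta> * A / z) / 2))) = model_dens (\<eta> / z) c \<theta> x u y"
    if z: "z > 0" for z
  proof -
    define q where "q = \<eta> / z"
    have q: "q > 0" using z \<eta> by (simp add: q_def)
    have e: "exp (- (\<eta> * A / z) / 2) = exp (- (q * (norm (x - \<theta>))\<^sup>2 / 2)) * exp (- (q * (norm u)\<^sup>2 / 2)) * exp (- (q * (norm (y - c *\<^sub>R \<theta>))\<^sup>2 / 2))"
      by (simp add: exp_add[symmetric] q_def A_def distrib_left add_divide_distrib)
    have "(q / (2 * pi)) powr m = \<eta> powr m * (z powr (- m) * (2 * pi) powr (- m))"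
      using z \<eta> by (simp add: q_def powr_divide powr_mult powr_minus_divide)
    moreover have "(q / (2 * pi)) powr m = (q / (2 * pi)) powr (real CARD('d) / 2) * (q / (2 * pi)) powr (real CARD('k) / 2) * (q / (2 * pi)) powr (real CARD('d) / 2)"
      by (simp add: powr_add[symmetric] m_def)
    ultimately have c: "\<eta> powr m * (z powr (- m) * (2 * pi) powr (- m)) = (q / (2 * pi)) powr (real CARD('d) / 2) * (q / (2 * pi)) powr (real CARD('k) / 2) * (q / (2 * pi)) powr (real CARD('d) / 2)"
      by simp
    have "\<eta> powr m * (z powr (- m) * ((2 * pi) powr (- m) * exp (- (\<eta> * A / z) / 2))) = \<eta> powr m * (z powr (- m) * (2 * pi) powr (- m)) * exp (- (\<eta> * A / z) / 2)"
      by simp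
    also have "\<dots> = model_dens (\<eta> / z) c \<theta> x u y"
      unfolding c e model_dens_def normal_dens_def q_def[symmetric] by (simp add: mult_ac)
    finally show ?thesis .
  qed
  have "joint_density c f \<theta> \<eta> x u y = ennreal (\<eta> powr m) * f (\<eta> * A)"
    by (simp add: joint_density_def m_def A_def)
  also have "\<dots> = ennreal (\<eta> powr m) * (\<integral>\<^sup>+z\<in>{0<..}. ennreal (z powr (- m) * ((2 * pi) powr (- m) * exp (- (\<eta> * A / z) / 2))) \<partial>G)"
  proof -
    have "\<eta> * A \<ge> 0" using \<eta> A by simp
    thus ?thesis by (simp only: f_eq std_normal_generator_def n)
  qed
  also have "\<dots> = (\<integral>\<^sup>+z. ennreal (\<eta> powr m) * (ennreal (z powr (- m) * ((2 * pi) powr (- m) * exp (- (\<eta> * A / z) / 2))) * indicator {0<..} z) \<partial>G)"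
    by (rule nn_integral_cmult[symmetric]) measurable
  also have "\<dots> = mixed_model_dens c \<theta> \<eta> x u y"
    unfolding mixed_model_dens_def
  proof (rule nn_integral_cong_AE, use AE_pos in eventually_elim, goal_cases)
    case z: (1 z)
    show ?case
      unfolding model_dens[OF z, symmetric] using z by (simp add: ennreal_mult[symmetric])
  qed
  finally show ?thesis .
qed

lemma marginal_density_eq:
  fixes \<theta> x :: "real^'d" and u :: "real^'k"
  assumes \<eta>: "\<eta> > 0"
  shows "marginal_density c f \<theta> \<eta> x u = mixed_marginal \<theta> \<eta> x u"
  by (simp add: marginal_density_def joint_density_eq[OF \<eta>] nn_integral_mixed_model_dens[OF \<eta>])

lemma nn_integral_prior:
  fixes h :: "real^'d \<Rightarrow> real \<Rightarrow> ennreal"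
  assumes h: "(\<lambda>(\<theta>, \<eta>). h \<theta> \<eta>) \<in> borel_measurable (borel \<Otimes>\<^sub>M borel)" and [measurable]: "g \<in> borel_measurable borel"
    and g: "\<And>\<theta>. g \<theta> \<ge> 0"
  shows "set_nn_integral lborel (UNIV \<times> {0<..}) (\<lambda>(\<theta>, \<eta>). h \<theta> \<eta> * ennreal (1 / \<eta> * g \<theta>))
    = (\<integral>\<^sup>+\<theta>. ennreal (g \<theta>) * (\<integral>\<^sup>+\<eta>. h \<theta> \<eta> \<partial>haar) \<partial>lborel)"
proof -
  note [measurable] = h
  define k where "k z = (case z of (\<theta>, \<eta>) \<Rightarrow> ennreal (g \<theta>) * (ennreal (indicator {0<..} \<eta> / \<eta>) * h \<theta> \<eta>))" for z
  have k: "k \<in> borel_measurable (lborel \<Otimes>\<^sub>M lborel)" unfolding k_def by measurable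
  have "set_nn_integral lborel (UNIV \<times> {0<..}) (\<lambda>(\<theta>, \<eta>). h \<theta> \<eta> * ennreal (1 / \<eta> * g \<theta>)) = (\<integral>\<^sup>+z. k z \<partial>lborel)"
  proof (rule nn_integral_cong, goal_cases)
    case _: (1 z)
    have "ennreal (1 / \<eta> * g \<theta>) = ennreal (g \<theta>) * ennreal (1 / \<eta>)" if "\<eta> > 0" for \<theta> \<eta>
      using that g by (simp add: ennreal_mult[symmetric])
    thus ?case
      by (cases z) (auto simp: k_def indicator_def mult_ac simp del: times_divide_eq_left)
  qed
  also have "\<dots> = (\<integral>\<^sup>+z. k z \<partial>(lborel \<Otimes>\<^sub>M lborel))" by (simp add: lborel_prod)
  also have "\<dots> = (\<integral>\<^sup>+\<theta>. \<integral>\<^sup>+\<eta>. k (\<theta>, \<eta>) \<partial>lborel \<partial>lborel)" by (rule lborel.nn_integral_fst[OF k, symmetric])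
  also have "\<dots> = (\<integral>\<^sup>+\<theta>. ennreal (g \<theta>) * (\<integral>\<^sup>+\<eta>. h \<theta> \<eta> \<partial>haar) \<partial>lborel)"
    by (simp add: k_def nn_integral_cmult nn_integral_haar)
  finally show ?thesis .
qed

text \<open>The marginal density cancels between the conditional and the posterior density, which
  needs it to be positive and finite, hence \<open>u \<noteq> 0\<close>. By Tonelli the integral
  over \<eta> can be taken first, and there the mixture is absorbed by \<open>haar\<close>, in the
  numerator and in the normaliser \<open>Z\<close> alike.\<close>

lemma bayes_predictive_density_eq:
  fixes x y :: "real^'d" and u :: "real^'k"
  assumes u: "u \<noteq> 0" and [measurable]: "g \<in> borel_measurable borel" and g: "\<And>\<theta>. g \<theta> \<ge> 0"
    and \<pi>: "\<And>\<theta> \<eta>. \<pi> \<theta> \<eta> = 1 / \<eta> * g \<theta>"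
  shows "bayes_predictive_density c f \<pi> x u y = bayes_pred c g x u y"
proof -
  define Z where "Z = set_nn_integral lborel (UNIV \<times> {0<..})
       (\<lambda>(\<theta>', \<eta>'). marginal_density c f \<theta>' \<eta>' x u * ennreal (\<pi> \<theta>' \<eta>'))"
  have swap: "(\<integral>\<^sup>+\<eta>. mixed_model_dens c \<theta> \<eta> x u y \<partial>haar) = (\<integral>\<^sup>+p. ennreal (model_dens p c \<theta> x u y) \<partial>haar)" for \<theta> y
    unfolding mixed_model_dens_def by (rule nn_integral_mixture_haar) measurable
  have J: "(\<integral>\<^sup>+\<theta>. ennreal (g \<theta>) * (\<integral>\<^sup>+\<eta>. mixed_model_dens c \<theta> \<eta> x u y \<partial>haar) \<partial>lborel) = bayes_num c g x u y" for y
    unfolding bayes_num_def swap by (rule refl)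
  have "Z = set_nn_integral lborel (UNIV \<times> {0<..}) (\<lambda>(\<theta>', \<eta>'). mixed_marginal \<theta>' \<eta>' x u * ennreal (1 / \<eta>' * g \<theta>'))"
    unfolding Z_def by (intro nn_integral_cong) (auto simp: indicator_def marginal_density_eq \<pi>)
  also have "\<dots> = (\<integral>\<^sup>+\<theta>. ennreal (g \<theta>) * (\<integral>\<^sup>+\<eta>. mixed_marginal \<theta> \<eta> x u \<partial>haar) \<partial>lborel)"
    by (rule nn_integral_prior) (use g in measurable)
  also have "\<dots> = (\<integral>\<^sup>+\<theta>. \<integral>\<^sup>+y. ennreal (g \<theta>) * (\<integral>\<^sup>+\<eta>. mixed_model_dens c \<theta> \<eta> x u y \<partial>haar) \<partial>lborel \<partial>lborel)"
  proof (rule nn_integral_cong)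
    fix \<theta>
    have "(\<integral>\<^sup>+\<eta>. mixed_marginal \<theta> \<eta> x u \<partial>haar) = (\<integral>\<^sup>+\<eta>. \<integral>\<^sup>+y. mixed_model_dens c \<theta> \<eta> x u y \<partial>lborel \<partial>haar)"
      by (intro nn_integral_haar_cong) (simp add: nn_integral_mixed_model_dens)
    also have "\<dots> = (\<integral>\<^sup>+y. \<integral>\<^sup>+\<eta>. mixed_model_dens c \<theta> \<eta> x u y \<partial>haar \<partial>lborel)"
      by (rule nn_integral_swap_lborel_haar[symmetric]) measurable
    finally show "ennreal (g \<theta>) * (\<integral>\<^sup>+\<eta>. mixed_marginal \<theta> \<eta> x u \<partial>haar)
      = (\<integral>\<^sup>+y. ennreal (g \<theta>) * (\<integral>\<^sup>+\<eta>. mixed_model_dens c \<theta> \<eta> x u y \<partial>haar) \<partial>lborel)"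
      by (simp add: nn_integral_cmult)
  qed
  also have "\<dots> = (\<integral>\<^sup>+y. \<integral>\<^sup>+\<theta>. ennreal (g \<theta>) * (\<integral>\<^sup>+\<eta>. mixed_model_dens c \<theta> \<eta> x u y \<partial>haar) \<partial>lborel \<partial>lborel)"
    by (rule nn_integral_swap_lborel) measurable
  also have "\<dots> = (\<integral>\<^sup>+y. bayes_num c g x u y \<partial>lborel)" unfolding J by (rule refl)
  finally have Z: "Z = (\<integral>\<^sup>+y. bayes_num c g x u y \<partial>lborel)" .
  have pt: "conditional_density c f \<theta> \<eta> x u y * posterior_density c f \<pi> x u \<theta> \<eta>
    = mixed_model_dens c \<theta> \<eta> x u y / Z * ennreal (1 / \<eta> * g \<theta>)" if \<eta>: "\<eta> > 0" for \<theta> \<eta>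
  proof -
    define M where "M = mixed_marginal \<theta> \<eta> x u"
    have M: "M \<noteq> 0" "M \<noteq> \<top>" using mixed_marginal_pos_finite[OF \<eta> u] by (auto simp: M_def)
    have "mixed_model_dens c \<theta> \<eta> x u y / M * (M * ennreal (1 / \<eta> * g \<theta>) / Z)
      = (M / M) * (mixed_model_dens c \<theta> \<eta> x u y / Z * ennreal (1 / \<eta> * g \<theta>))"
      by (simp add: divide_ennreal_def mult_ac)
    moreover have "conditional_density c f \<theta> \<eta> x u y * posterior_density c f \<pi> x u \<theta> \<eta>
      = mixed_model_dens c \<theta> \<eta> x u y / M * (M * ennreal (1 / \<eta> * g \<theta>) / Z)"
      unfolding conditional_density_def posterior_density_def Z_def[symmetric] joint_density_eq[OF \<eta>]
        marginal_density_eq[OF \<eta>] M_def by (simp only: \<pi>)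
    ultimately show ?thesis using M by (simp add: top.not_eq_extremum)
  qed
  have "bayes_predictive_density c f \<pi> x u y = set_nn_integral lborel (UNIV \<times> {0<..})
      (\<lambda>(\<theta>, \<eta>). mixed_model_dens c \<theta> \<eta> x u y / Z * ennreal (1 / \<eta> * g \<theta>))"
    unfolding bayes_predictive_density_def by (intro nn_integral_cong) (auto simp: indicator_def pt)
  also have "\<dots> = (\<integral>\<^sup>+\<theta>. ennreal (g \<theta>) * (\<integral>\<^sup>+\<eta>. mixed_model_dens c \<theta> \<eta> x u y / Z \<partial>haar) \<partial>lborel)"
    by (rule nn_integral_prior) (use g in measurable)
  also have "\<dots> = (\<integral>\<^sup>+\<theta>. ennreal (g \<theta>) * (\<integral>\<^sup>+\<eta>. mixed_model_dens c \<theta> \<eta> x u y \<partial>haar) / Z \<partial>lborel)"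
    by (simp add: nn_integral_divide ennreal_times_divide)
  also have "\<dots> = (\<integral>\<^sup>+\<theta>. ennreal (g \<theta>) * (\<integral>\<^sup>+\<eta>. mixed_model_dens c \<theta> \<eta> x u y \<partial>haar) \<partial>lborel) / Z"
    by (rule nn_integral_divide) measurable
  also have "\<dots> = bayes_pred c g x u y"
    unfolding J bayes_pred_def Z by (rule refl)
  finally show ?thesis .
qed

section \<open>Risk comparison under a scale mixture\<close>

lemma sampling_distribution_eq:
  fixes \<theta> :: "real^'d"
  assumes \<eta>: "\<eta> > 0"
  shows "(sampling_distribution c f \<theta> \<eta> :: (_ \<times> (real^'k) \<times> _) measure) = density lborel (\<lambda>(x, u, y). mixed_model_dens c \<theta> \<eta> x u y)"
  unfolding sampling_distribution_def joint_density_eq[OF \<eta>] by (rule refl)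

lemma KL_loss_bayes_pred_measurable:
  fixes \<theta> :: "real^'d"
  assumes \<eta>: "\<eta> > 0" and [measurable]: "g \<in> borel_measurable borel"
  shows "KL_loss c f \<theta> \<eta> (bayes_pred c g :: real^'d \<Rightarrow> real^'k \<Rightarrow> real^'d \<Rightarrow> ennreal) \<in> borel_measurable borel"
proof -
  show ?thesis
    unfolding KL_loss_def conditional_density_def joint_density_eq[OF \<eta>] marginal_density_eq[OF \<eta>] borel_prod[symmetric]
    by measurable
qed

lemma sets_sampling_distribution: "sets (sampling_distribution c f \<theta> \<eta>) = sets borel"
  by (simp add: sampling_distribution_def)

lemma AE_sampling_distribution:
  fixes \<theta> :: "real^'d"
  assumes \<eta>: "\<eta> > 0" and P: "AE t in (lborel :: ((real^'d) \<times> (real^'k) \<times> (real^'d)) measure). P t"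
  shows "AE t in (sampling_distribution c f \<theta> \<eta> :: ((real^'d) \<times> (real^'k) \<times> (real^'d)) measure). P t"
proof -
  have [measurable]: "(\<lambda>(x, u, y). mixed_model_dens c \<theta> \<eta> x (u::real^'k) y) \<in> borel_measurable borel"
    unfolding borel_prod[symmetric] by measurable
  show ?thesis unfolding sampling_distribution_eq[OF \<eta>]
    by (subst AE_density) (use P in \<open>auto elim: eventually_mono\<close>)
qed

text \<open>Both the true conditional density and the flat predictive density \<open>R\<close>
  cancel in the difference of logarithms, and the quotient of the two values of \<psi>
  remains.\<close>

lemma KL_loss_diff:
  fixes \<theta> x y :: "real^'d" and u :: "real^'k"
  assumes \<eta>: "\<eta> > 0" and d: "CARD('d) \<ge> 3" and nz: "x \<noteq> 0" "u \<noteq> 0" "pooled c x y \<noteq> 0"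
  shows "KL_loss c f \<theta> \<eta> (bayes_pred c (\<lambda>_. 1)) (x, u, y) - KL_loss c f \<theta> \<eta> (bayes_pred c harmonic) (x, u, y)
    = log_gain c (x, u, y)"
proof -
  have d': "DIM(real^'d) \<ge> 3" using d by simp
  \<comment> \<open>Finiteness has to be checked as well as positivity, because
    \<open>enn2real\<close> maps infinity to 0 and the logarithm of the quotient would then not
    split.\<close>
  define C where "C = enn2real (conditional_density c f \<theta> \<eta> x u y)"
  have C: "C > 0"
  proof -
    have "conditional_density c f \<theta> \<eta> x u y \<noteq> 0" "conditional_density c f \<theta> \<eta> x u y \<noteq> \<top>"
      using mixed_model_dens_pos_finite[OF \<eta> nz(2), of c \<theta> x y] mixed_marginal_pos_finite[OF \<eta> nz(2), of \<theta> x]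
      by (auto simp: conditional_density_def joint_density_eq[OF \<eta>] marginal_density_eq[OF \<eta>] divide_ennreal_def
          ennreal_mult_eq_top_iff ennreal_inverse_eq_top_iff)
    thus ?thesis unfolding C_def by (simp add: enn2real_positive_iff top.not_eq_extremum zero_less_iff_neq_zero)
  qed
  define R where "R = flat_form (residual c x u y) / rotation_jac c DIM(real^'d) DIM(real^'k) / flat_form u"
  have R: "R > 0" unfolding R_def
    using rotation_jac_pos flat_form_pos[OF nz(2)] flat_form_pos[OF residual_nonzero[OF nz(2), of c x y]] by simp
  define P P' where "P = psi (real DIM(real^'d) / 2 - 1) (real DIM(real^'k) / 2) ((norm x)\<^sup>2) ((norm u)\<^sup>2)"
    and "P' = psi (real DIM(real^'d) / 2 - 1) (real DIM((real^'k) \<times> (real^'d)) / 2) ((norm (pooled c x y))\<^sup>2) ((norm (residual c x u y))\<^sup>2)"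
  have P: "P > 0" "P' > 0" unfolding P_def P'_def using d nz by (auto intro!: psi_pos)
  have 1: "bayes_pred c (\<lambda>_. 1) x u y = ennreal R" unfolding R_def by (rule bayes_pred_one[OF nz(2)])
  have 2: "bayes_pred c harmonic x u y = ennreal (R * (P' / P))"
    unfolding R_def P_def P'_def by (rule bayes_pred_harmonic[OF d' nz(2,1,3)])
  have "KL_loss c f \<theta> \<eta> (bayes_pred c (\<lambda>_. 1)) (x, u, y) - KL_loss c f \<theta> \<eta> (bayes_pred c harmonic) (x, u, y)
    = ln (C / R) - ln (C / (R * (P' / P)))"
    using R P by (simp add: KL_loss_def 1 2 C_def)
  also have "\<dots> = ln P' - ln P" using C R P by (simp add: ln_div ln_mult)
  also have "\<dots> = log_gain c (x, u, y)" by (simp add: log_gain_def P_def P'_def)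
  finally show ?thesis .
qed

text \<open>The sampling distribution is the \<open>G\<close>-mixture of the normal models of
  precision \<open>\<eta> / z\<close>, and the mean gain is positive for each \<open>z > 0\<close>.
  The pointwise statements give no bound uniform in \<open>z\<close>; the assumed integrability
  under the mixture is what permits the exchange of integrals.\<close>

lemma log_gain_mixture_pos:
  fixes \<theta> :: "real^'d"
  assumes \<eta>: "\<eta> > 0" and d: "CARD('d) \<ge> 3" and c: "c > 0"
    and int: "integrable (sampling_distribution c f \<theta> \<eta>) (log_gain c :: (real^'d) \<times> (real^'k) \<times> (real^'d) \<Rightarrow> real)"
  shows "(\<integral>t. log_gain c t \<partial>(sampling_distribution c f \<theta> \<eta> :: ((real^'d) \<times> (real^'k) \<times> (real^'d)) measure)) > 0"
proof -
  let ?L = "lborel :: ((real^'d) \<times> (real^'k) \<times> (real^'d)) measure"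
  let ?D = "log_gain c :: (real^'d) \<times> (real^'k) \<times> (real^'d) \<Rightarrow> real"
  have d': "DIM(real^'d) \<ge> 3" using d by simp
  define k where "k z t = (case t of (x, u, y) \<Rightarrow> model_dens (\<eta> / z) c \<theta> x (u::real^'k) y)" for z t
  have k_nonneg: "k z t \<ge> 0" for z t by (simp add: k_def split: prod.split)
  have D [measurable]: "?D \<in> borel_measurable borel"
    using borel_measurable_integrable[OF int] by (simp add: measurable_cong_sets[OF sets_sampling_distribution refl])
  have kt [measurable]: "(\<lambda>(z, t). k z t) \<in> borel_measurable (borel \<Otimes>\<^sub>M borel)"
    unfolding k_def borel_prod[symmetric] by measurable
  define J where "J t = (\<integral>\<^sup>+z. ennreal (k z t) \<partial>G)" for t
  have J: "J = (\<lambda>(x, u, y). mixed_model_dens c \<theta> \<eta> x u y)"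
    by (auto simp: J_def k_def mixed_model_dens_def)
  have [measurable]: "J \<in> borel_measurable borel" unfolding J_def by measurable
  have S: "(sampling_distribution c f \<theta> \<eta> :: ((real^'d) \<times> (real^'k) \<times> (real^'d)) measure) = density ?L J"
    unfolding J by (rule sampling_distribution_eq[OF \<eta>])
  interpret GL: pair_sigma_finite G ?L
    by (rule pair_sigma_finite.intro[OF sigma_finite_measure_axioms sigma_finite_lborel])
  have int_k: "integrable (G \<Otimes>\<^sub>M ?L) (\<lambda>(z, t). k z t * ?D t)"
  proof (rule integrableI_bounded)
    have "(\<integral>\<^sup>+p. ennreal (norm (case p of (z, t) \<Rightarrow> k z t * ?D t)) \<partial>(G \<Otimes>\<^sub>M ?L))
      = (\<integral>\<^sup>+t. \<integral>\<^sup>+z. ennreal (k z t) * ennreal (norm (?D t)) \<partial>G \<partial>?L)"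
      by (subst GL.nn_integral_snd[symmetric]) (auto simp: abs_mult k_nonneg ennreal_mult)
    also have "\<dots> = (\<integral>\<^sup>+t. J t * ennreal (norm (?D t)) \<partial>?L)"
      by (simp add: J_def nn_integral_multc)
    also have "\<dots> = (\<integral>\<^sup>+t. ennreal (norm (?D t)) \<partial>density ?L J)"
      by (rule nn_integral_density[symmetric]) measurable
    also have "\<dots> < \<infinity>" using int unfolding S integrable_iff_bounded by simp
    finally show "(\<integral>\<^sup>+p. ennreal (norm (case p of (z, t) \<Rightarrow> k z t * ?D t)) \<partial>(G \<Otimes>\<^sub>M ?L)) < \<infinity>" .
  qed measurable
  \<comment> \<open>The signed integral is handled with a real-valued density; \<open>J\<close> is
    finite almost everywhere, namely off \<open>u = 0\<close>.\<close>
  have "(\<integral>t. ?D t \<partial>density ?L J) = (\<integral>t. ?D t \<partial>density ?L (\<lambda>t. ennreal (enn2real (J t))))"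
  proof -
    have "density ?L J = density ?L (\<lambda>t. ennreal (enn2real (J t)))"
    proof (rule density_cong)
      show "AE t in ?L. J t = ennreal (enn2real (J t))"
        using AE_lborel_nondegenerate[OF less_imp_neq[OF c, symmetric], where 'a="real^'d" and 'b="real^'k"]
        by (rule eventually_mono) (auto simp: J ennreal_enn2real_if mixed_model_dens_pos_finite(2)[OF \<eta>])
    qed measurable
    thus ?thesis by simp
  qed
  also have "\<dots> = (\<integral>t. enn2real (J t) * ?D t \<partial>?L)"
    by (subst integral_density) auto
  also have "\<dots> = (\<integral>t. \<integral>z. k z t * ?D t \<partial>G \<partial>?L)"
  proof (rule Bochner_Integration.integral_cong[OF refl], goal_cases)
    case _: (1 t)
    have "(\<integral>z. k z t \<partial>G) = enn2real (J t)"
      unfolding J_def by (rule integral_eq_nn_integral) (auto simp: k_nonneg)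
    thus ?case by simp
  qed
  also have "\<dots> = (\<integral>z. \<integral>t. k z t * ?D t \<partial>?L \<partial>G)"
    by (rule GL.Fubini_integral[OF int_k])
  finally have eq: "(\<integral>t. ?D t \<partial>sampling_distribution c f \<theta> \<eta>) = (\<integral>z. \<integral>t. k z t * ?D t \<partial>?L \<partial>G)"
    unfolding S .
  have pos: "(\<integral>t. k z t * ?D t \<partial>?L) > 0" if "z > 0" for z
  proof -
    have p: "\<eta> / z > 0" using \<eta> that by simp
    have "(\<integral>t. ?D t \<partial>model_law (\<eta> / z) c \<theta>) = (\<integral>t. k z t * ?D t \<partial>?L)"
    proof -
      have "model_law (\<eta> / z) c \<theta> = density ?L (\<lambda>t. ennreal (k z t))"
        unfolding model_law_def k_def by (intro arg_cong[of _ _ "density lborel"]) auto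
      thus ?thesis by (simp add: integral_density k_nonneg)
    qed
    thus ?thesis using log_gain_expected_pos(2)[OF d' p c, of \<theta>, where 'b="real^'k"] by simp
  qed
  \<comment> \<open>Strictness survives the mixing: a nonnegative function with integral 0 would
    vanish almost everywhere, while this one is positive at every \<open>z > 0\<close>.\<close>
  have "(\<integral>z. \<integral>t. k z t * ?D t \<partial>?L \<partial>G) \<noteq> 0"
  proof
    assume 0: "(\<integral>z. \<integral>t. k z t * ?D t \<partial>?L \<partial>G) = 0"
    have "AE z in G. 0 \<le> (\<integral>t. k z t * ?D t \<partial>?L)"
      using AE_pos by eventually_elim (use pos in \<open>auto intro: less_imp_le\<close>)
    with 0 have "AE z in G. (\<integral>t. k z t * ?D t \<partial>?L) = 0"
      using GL.integrable_fst[OF int_k] by (subst (asm) integral_nonneg_eq_0_iff_AE) auto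
    hence "AE z in G. False" using AE_pos by eventually_elim (use pos in force)
    thus False by simp
  qed
  moreover have "(\<integral>z. \<integral>t. k z t * ?D t \<partial>?L \<partial>G) \<ge> 0"
    by (rule integral_nonneg_AE) (use AE_pos in eventually_elim, use pos in \<open>auto intro: less_imp_le\<close>)
  ultimately show ?thesis unfolding eq by simp
qed

lemma KL_loss_cong_AE:
  fixes q q' :: "real^'d \<Rightarrow> real^'k \<Rightarrow> real^'d \<Rightarrow> ennreal"
  assumes \<eta>: "\<eta> > 0" and eq: "\<And>x u y. u \<noteq> 0 \<Longrightarrow> q x u y = q' x u y"
  shows "AE t in sampling_distribution c f \<theta> \<eta>. KL_loss c f \<theta> \<eta> q t = KL_loss c f \<theta> \<eta> q' t"
proof (rule AE_sampling_distribution[OF \<eta>])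
  show "AE t in lborel. KL_loss c f \<theta> \<eta> q t = KL_loss c f \<theta> \<eta> q' t"
    \<comment> \<open>The event extracted here is \<open>u \<noteq> 0\<close>; the value 1 is an
      arbitrary nonzero instance.\<close>
    using AE_lborel_nondegenerate[of 1, where 'a="real^'d" and 'b="real^'k", OF one_neq_zero]
    by (rule eventually_mono) (auto simp: KL_loss_def eq)
qed

text \<open>\<open>qh\<close> and \<open>q0\<close> stand for any versions that agree with the
  \<open>f\<close>-free densities off the null set \<open>u = 0\<close>, so domination transfers
  between the two pairs. The strict inequality is obtained at every parameter.\<close>

lemma dominates_bayes_pred:
  fixes qh q0 :: "real^'d \<Rightarrow> real^'k \<Rightarrow> real^'d \<Rightarrow> ennreal"
  assumes d: "CARD('d) \<ge> 3" and c: "c > 0"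
    and qh: "\<And>x u y. u \<noteq> 0 \<Longrightarrow> qh x u y = bayes_pred c harmonic x u y"
    and q0: "\<And>x u y. u \<noteq> 0 \<Longrightarrow> q0 x u y = bayes_pred c (\<lambda>_. 1) x u y"
    and fin: "finite_KL_risk c f qh" "finite_KL_risk c f q0"
  shows "dominates c f qh q0 \<and> dominates c f (bayes_pred c harmonic :: real^'d \<Rightarrow> real^'k \<Rightarrow> real^'d \<Rightarrow> ennreal) (bayes_pred c (\<lambda>_. 1))"
proof -
  have main: "KL_risk c f \<theta> \<eta> qh < KL_risk c f \<theta> \<eta> q0
     \<and> KL_risk c f \<theta> \<eta> (bayes_pred c harmonic :: real^'d \<Rightarrow> real^'k \<Rightarrow> real^'d \<Rightarrow> ennreal) = KL_risk c f \<theta> \<eta> qh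
     \<and> KL_risk c f \<theta> \<eta> (bayes_pred c (\<lambda>_. 1) :: real^'d \<Rightarrow> real^'k \<Rightarrow> real^'d \<Rightarrow> ennreal) = KL_risk c f \<theta> \<eta> q0"
    if \<eta>: "\<eta> > 0" for \<theta> :: "real^'d" and \<eta>
  proof -
    let ?S = "sampling_distribution c f \<theta> \<eta> :: ((real^'d) \<times> (real^'k) \<times> (real^'d)) measure"
    have ih: "integrable ?S (KL_loss c f \<theta> \<eta> qh)" and i0: "integrable ?S (KL_loss c f \<theta> \<eta> q0)"
      using fin \<eta> by (auto simp: finite_KL_risk_def)
    have mh: "KL_loss c f \<theta> \<eta> (bayes_pred c harmonic :: real^'d \<Rightarrow> real^'k \<Rightarrow> real^'d \<Rightarrow> ennreal) \<in> borel_measurable ?S"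
      unfolding measurable_cong_sets[OF sets_sampling_distribution refl] by (rule KL_loss_bayes_pred_measurable[OF \<eta>]) measurable
    have m0: "KL_loss c f \<theta> \<eta> (bayes_pred c (\<lambda>_. 1) :: real^'d \<Rightarrow> real^'k \<Rightarrow> real^'d \<Rightarrow> ennreal) \<in> borel_measurable ?S"
      unfolding measurable_cong_sets[OF sets_sampling_distribution refl] by (rule KL_loss_bayes_pred_measurable[OF \<eta>]) measurable
    have aeh: "AE t in ?S. KL_loss c f \<theta> \<eta> (bayes_pred c harmonic) t = KL_loss c f \<theta> \<eta> qh t"
      by (rule KL_loss_cong_AE[OF \<eta>]) (rule qh[symmetric])
    have ae0: "AE t in ?S. KL_loss c f \<theta> \<eta> (bayes_pred c (\<lambda>_. 1)) t = KL_loss c f \<theta> \<eta> q0 t"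
      by (rule KL_loss_cong_AE[OF \<eta>]) (rule q0[symmetric])
    have eqh: "KL_risk c f \<theta> \<eta> (bayes_pred c harmonic :: real^'d \<Rightarrow> real^'k \<Rightarrow> real^'d \<Rightarrow> ennreal) = KL_risk c f \<theta> \<eta> qh"
      unfolding KL_risk_def by (rule integral_cong_AE[OF mh borel_measurable_integrable[OF ih] aeh])
    have eq0: "KL_risk c f \<theta> \<eta> (bayes_pred c (\<lambda>_. 1) :: real^'d \<Rightarrow> real^'k \<Rightarrow> real^'d \<Rightarrow> ennreal) = KL_risk c f \<theta> \<eta> q0"
      unfolding KL_risk_def by (rule integral_cong_AE[OF m0 borel_measurable_integrable[OF i0] ae0])
    have "AE t in ?S. case t of (x, u, y) \<Rightarrow> x \<noteq> 0 \<and> u \<noteq> 0 \<and> pooled c x y \<noteq> 0"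
      by (rule AE_sampling_distribution[OF \<eta>], rule AE_lborel_nondegenerate) (use c in simp)
    with aeh ae0 have ae: "AE t in ?S. KL_loss c f \<theta> \<eta> q0 t - KL_loss c f \<theta> \<eta> qh t = log_gain c t"
    proof eventually_elim
      case _: (elim t)
      assume t: "case t of (x, u, y) \<Rightarrow> x \<noteq> 0 \<and> u \<noteq> 0 \<and> pooled c x y \<noteq> 0"
        "KL_loss c f \<theta> \<eta> (bayes_pred c harmonic) t = KL_loss c f \<theta> \<eta> qh t"
        "KL_loss c f \<theta> \<eta> (bayes_pred c (\<lambda>_. 1)) t = KL_loss c f \<theta> \<eta> q0 t"
      obtain x u y where "t = (x, u, y)" by (cases t) auto
      thus ?case
        using t KL_loss_diff[OF \<eta> d, of x u c y \<theta>] by simp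
    qed
    have D: "(log_gain c :: (real^'d) \<times> (real^'k) \<times> (real^'d) \<Rightarrow> real) \<in> borel_measurable ?S"
    proof -
      have ab: "real DIM(real^'d) / 2 - 1 > 0" "real DIM(real^'k) / 2 > 0" "real DIM((real^'k) \<times> (real^'d)) / 2 > 0"
        using d by auto
      show ?thesis
        unfolding measurable_cong_sets[OF sets_sampling_distribution refl] log_gain_def borel_prod[symmetric] pooled_def residual_def
        using ab by measurable
    qed
    \<comment> \<open>Here the finite risks enter: the gain is almost everywhere the difference of
      two integrable losses.\<close>
    have iD: "integrable ?S (log_gain c)"
      by (rule integrable_cong_AE_imp[OF Bochner_Integration.integrable_diff[OF i0 ih] D])
        (use ae in \<open>auto elim: eventually_mono\<close>)
    have "KL_risk c f \<theta> \<eta> q0 - KL_risk c f \<theta> \<eta> qh = (\<integral>t. KL_loss c f \<theta> \<eta> q0 t - KL_loss c f \<theta> \<eta> qh t \<partial>?S)"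
      unfolding KL_risk_def using i0 ih by (rule Bochner_Integration.integral_diff[symmetric])
    also have "\<dots> = (\<integral>t. log_gain c t \<partial>?S)"
      by (rule integral_cong_AE) (use i0 ih D ae in auto)
    also have "\<dots> > 0" by (rule log_gain_mixture_pos[OF \<eta> d c iD])
    finally show ?thesis using eqh eq0 by simp
  qed
  have "\<exists>\<theta>. \<exists>\<eta>>0. KL_risk c f \<theta> \<eta> qh < KL_risk c f \<theta> \<eta> q0"
    using main[of 1 0] by (intro exI[of _ 0] exI[of _ 1]) simp
  moreover have "\<exists>\<theta>. \<exists>\<eta>>0. KL_risk c f \<theta> \<eta> (bayes_pred c harmonic :: real^'d \<Rightarrow> real^'k \<Rightarrow> real^'d \<Rightarrow> ennreal)
      < KL_risk c f \<theta> \<eta> (bayes_pred c (\<lambda>_. 1) :: real^'d \<Rightarrow> real^'k \<Rightarrow> real^'d \<Rightarrow> ennreal)"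
    using main[of 1 0] by (intro exI[of _ 0] exI[of _ 1]) simp
  ultimately show ?thesis
    unfolding dominates_def using main by (simp add: less_imp_le)
qed

end

text \<open>Simultaneity is expressed by choosing \<open>qh\<close> and \<open>q0\<close> before
  \<open>f\<close>. They are compared with the Bayes predictive densities at
  \<open>u \<noteq> 0\<close>, a set of full measure on which the marginal densities are positive
  and finite.\<close>

theorem corollary4p1:
  fixes c :: real
  assumes "CARD('d::finite) \<ge> 3" and "c > 0"
  shows "\<exists>qh q0 :: real^'d \<Rightarrow> real^'k::finite \<Rightarrow> real^'d \<Rightarrow> ennreal.
    \<forall>f. scale_mixture_of_normals (2 * CARD('d) + CARD('k)) f \<longrightarrow>
      (let qh_f = bayes_predictive_density c f harmonic_prior :: real^'d \<Rightarrow> real^'k \<Rightarrow> real^'d \<Rightarrow> ennreal;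
           q0_f = bayes_predictive_density c f prior_0 :: real^'d \<Rightarrow> real^'k \<Rightarrow> real^'d \<Rightarrow> ennreal
       in finite_KL_risk c f qh_f \<and> finite_KL_risk c f q0_f \<longrightarrow>
            dominates c f qh_f q0_f \<and>
            (\<forall>x u y. u \<noteq> 0 \<longrightarrow> qh_f x u y = qh x u y \<and> q0_f x u y = q0 x u y) \<and>
            dominates c f qh q0)"
proof (intro exI allI impI)
  fix f assume "scale_mixture_of_normals (2 * CARD('d) + CARD('k)) f"
  then obtain G where G: "real_distribution G" "cdf G 0 = 0"
    "\<And>t. t \<ge> 0 \<Longrightarrow> f t = (\<integral>\<^sup>+z\<in>{0<..}. ennreal (z powr (- real (2 * CARD('d) + CARD('k)) / 2) *
      std_normal_generator (2 * CARD('d) + CARD('k)) (t / z)) \<partial>G)"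
    unfolding scale_mixture_of_normals_def by blast
  interpret mixture_model G f "TYPE('d \<times> 'k)"
    using G by (simp add: mixture_model_def mixture_model_axioms_def positive_distribution_def positive_distribution_axioms_def)
  have h: "bayes_predictive_density c f harmonic_prior x u y = bayes_pred c harmonic x u y"
    if "u \<noteq> 0" for x y :: "real^'d" and u :: "real^'k"
    by (rule bayes_predictive_density_eq[OF that]) (auto simp: harmonic_prior_def harmonic_def)
  have z: "bayes_predictive_density c f prior_0 x u y = bayes_pred c (\<lambda>_. 1) x u y"
    if "u \<noteq> 0" for x y :: "real^'d" and u :: "real^'k"
    by (rule bayes_predictive_density_eq[OF that]) (auto simp: prior_0_def)
  show "let qh_f = bayes_predictive_density c f harmonic_prior :: real^'d \<Rightarrow> real^'k \<Rightarrow> real^'d \<Rightarrow> ennreal;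
           q0_f = bayes_predictive_density c f prior_0 :: real^'d \<Rightarrow> real^'k \<Rightarrow> real^'d \<Rightarrow> ennreal
       in finite_KL_risk c f qh_f \<and> finite_KL_risk c f q0_f \<longrightarrow>
            dominates c f qh_f q0_f \<and>
            (\<forall>x u y. u \<noteq> 0 \<longrightarrow> qh_f x u y = bayes_pred c harmonic x u y \<and> q0_f x u y = bayes_pred c (\<lambda>_. 1) x u y) \<and>
            dominates c f (bayes_pred c harmonic :: real^'d \<Rightarrow> real^'k \<Rightarrow> real^'d \<Rightarrow> ennreal) (bayes_pred c (\<lambda>_. 1))"
    unfolding Let_def using dominates_bayes_pred[OF assms h z] h z by blast
qed

end
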